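(* Let $\Lambda:[0,T]\to\mathcal{S}'_r(\mathbb{R}^d)$ be deterministic, with $(t,\xi)\mapsto\mathcal{F}\Lambda(t)(\xi)$ measurable and $$\int_0^T\sup_{\eta\in\mathbb{R}^d}\int_{\mathbb{R}^d}|\mathcal{F}\Lambda(s)(\xi+\eta)|^2\mu(d\xi)\,ds<\infty,$$ and such that at least one of the following holds: (i) for every nonnegative $\phi\in\mathcal C_0^\infty(\mathbb{R}^d)$ supported in the unit ball with $\int\phi\,dx=1$ and all $0\le a\le b\le T$, $\int_a^b(\Lambda(s)\ast\phi)(x)\,ds\in\mathcal S(\mathbb{R}^d)$ and $\int_{\mathbb{R}^d}\int_a^b|(\Lambda(s)\ast\phi)(x)|\,ds\,dx<\infty$; (ii) $\lim_{h\downarrow0}\int_0^T\sup_{\eta\in\mathbb{R}^d}\int_{\mathbb{R}^d}\sup_{s<r<s+h}|\mathcal{F}\Lambda(r)(\xi+\eta)-\mathcal{F}\Lambda(s)(\xi+\eta)|^2\mu(d\xi)ds=0$. Let $Z$ be a real predictable process with $\sup_{(t,x)\in[0,T]\times\mathbb{R}^d}E[Z(t,x)^2]<\infty$ and $E[Z(t,x)Z(t,x+y)]=E[Z(t,0)Z(t,y)]$ for all $t\in[0,T]$, $x,y\in\mathbb{R}^d$. Fix $(t,x)\in[0,T]\times\mathbb{R}^d$ and let $\Phi_{t,x}$ be the limit in $\mathcal{P}_0$, as $n\to\infty$, of the processes $(s,y)\mapsto\Lambda_n(t-s,x-y)Z(s,y)$, where $\Lambda_n(r)=\Lambda(r)\ast\zeta_n$.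 Then $$\delta(\Phi_{t,x})=(\Phi_{t,x}\cdot W)_t,$$ where $\delta$ denotes the Skorohod integral (divergence operator).
   Context: $T>0$, $d\in\mathbb{N}$; $\mathcal{F}$ is the Fourier transform on $\mathbb{R}^d$, $\tilde g(x)=g(-x)$, $\mathcal{S}(\mathbb{R}^d)$ is the Schwartz space and $\mathcal{S}'_r(\mathbb{R}^d)$ the space of tempered distributions with rapid decrease (Schwartz's $\mathcal O_C'$). $\Gamma$ is a nonnegative, nonnegative definite tempered measure on $\mathbb{R}^d$ and $\mu$ is the nonnegative tempered measure with $\mathcal{F}\mu=\Gamma$. $\mathcal{H}$ is the completion of $\mathcal{S}(\mathbb{R}^d)$ under $\langle\phi,\psi\rangle_{\mathcal H}=\int(\phi\ast\tilde\psi)d\Gamma=\int\mathcal{F}\phi\,\overline{\mathcal{F}\psi}\,d\mu$; $\mathcal{H}_T=L^2([0,T];\mathcal{H})$. $F$ is an isonormal Gaussian process on $\mathcal{H}_T$: centered Gaussian with $E[F(\phi)F(\psi)]=\langle\phi,\psi\rangle_{\mathcal{H}_T}$, on its canonical probability space; $M_t(A)=F(1_{[0,t]}1_A)$ ($A$ bounded Borel) is the associated martingale measure, $(\mathcal{F}_t)$ its natural filtration; "predictable" refers to it. $\delta$ is the divergence operator (adjoint of the Malliavin derivative $D$) of the Malliavin calculus based on $F$. For a complete orthonormal system $(e_k)$ of $\mathcal{H}$, $W^k_t=F(1_{[0,t]}e_k)$ are independent standard Brownian motions, and for predictable $g\in L^2(\Omega\times[0,T];\mathcal{H})$, $(g\cdot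 W)_t=\sum_k\int_0^t\langle g(s),e_k\rangle_{\mathcal{H}}dW_s^k$. $\zeta_n(x)=n^d\zeta(nx)$ with $\zeta\in\mathcal{C}_0^\infty(\mathbb{R}^d)$ nonnegative, supported in the unit ball, $\int\zeta=1$. Simple processes: finite sums of $1_{(a,b]}(t)1_A(x)X$, $0\le a<b\le T$, $A$ bounded Borel, $X$ bounded and $\mathcal{F}_a$-measurable. $\mathcal{P}_0$ is the completion of the simple processes under $\|g\|_0^2=E\int_0^T\int|\mathcal{F}g(s)(\xi)|^2\mu(d\xi)ds$; $\mathcal{P}_0\subseteq L^2(\Omega;\mathcal{H}_T)$ with the same norm. The limit $\Phi_{t,x}$ exists in $\mathcal{P}_0$ under the stated assumptions; $\Lambda_n(t-s,\cdot)$ is taken to be zero for $s>t$. *)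

theory Defs
  imports "HOL-Probability.Probability"
begin

definition partial_deriv :: "'d::finite \<Rightarrow> (real^'d \<Rightarrow> 'b::real_normed_vector) \<Rightarrow> real^'d \<Rightarrow> 'b" where
  "partial_deriv i f x = frechet_derivative f (at x) (axis i 1)"

text \<open>Multi-indices are replaced by lists of coordinate directions.\<close>

definition iter_partial :: "'d::finite list \<Rightarrow> (real^'d \<Rightarrow> 'b::real_normed_vector) \<Rightarrow> real^'d \<Rightarrow> 'b" where
  "iter_partial is f = foldr partial_deriv is f"

definition smooth :: "(real^'d::finite \<Rightarrow> 'b::real_normed_vector) \<Rightarrow> bool" where
  "smooth f \<longleftrightarrow> (\<forall>is x. iter_partial is f differentiable (at x))"

definition schwartz :: "(real^'d::finite \<Rightarrow> 'b::real_normed_vector) set" where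
  "schwartz = {f. smooth f \<and>
     (\<forall>is k. bdd_above (range (\<lambda>x. norm x ^ k * norm (iter_partial is f x))))}"

definition schwartz_seminorm :: "nat \<Rightarrow> (real^'d::finite \<Rightarrow> 'b::real_normed_vector) \<Rightarrow> real" where
  "schwartz_seminorm m f =
     (\<Sum>is | length is \<le> m. \<Sum>k\<le>m. SUP x. norm x ^ k * norm (iter_partial is f x))"

definition test_functions :: "(real^'d::finite \<Rightarrow> real) set" where
  "test_functions = {f. smooth f \<and> bounded {x. f x \<noteq> 0}}"

definition unit_bumps :: "(real^'d::finite \<Rightarrow> real) set" where
  "unit_bumps = {\<phi> \<in> test_functions. (\<forall>x. 0 \<le> \<phi> x) \<and> closure {x. \<phi> x \<noteq> 0} \<subseteq> cball 0 1 \<and>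
     (\<integral>x. \<phi> x \<partial>lborel) = 1}"

text \<open>The normalisation is the one for which convolution becomes multiplication without a
  constant, as needed for the two expressions of the inner product below to agree.\<close>

definition fourier :: "(real^'d::finite \<Rightarrow> complex) \<Rightarrow> real^'d \<Rightarrow> complex" where
  "fourier f \<xi> = (\<integral>x. cis (- (\<xi> \<bullet> x)) * f x \<partial>lborel)"

abbreviation rfourier :: "(real^'d::finite \<Rightarrow> real) \<Rightarrow> real^'d \<Rightarrow> complex" where
  "rfourier f \<equiv> fourier (\<lambda>x. complex_of_real (f x))"

definition reflect :: "(real^'d::finite \<Rightarrow> real) \<Rightarrow> real^'d \<Rightarrow> real" where
  "reflect g x = g (- x)"

definition conv :: "(real^'d::finite \<Rightarrow> real) \<Rightarrow> (real^'d \<Rightarrow> real) \<Rightarrow> real^'d \<Rightarrow> real" where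
  "conv f g x = (\<integral>y. f (x - y) * g y \<partial>lborel)"

text \<open>Distributions are real, i.e. real-valued functionals on real test functions; their values
  off the test space are irrelevant.\<close>

type_synonym 'd functional = "(real^'d \<Rightarrow> real) \<Rightarrow> real"

definition tempered_dist :: "'d::finite functional set" where
  "tempered_dist = {S.
     (\<forall>\<phi>\<in>schwartz. \<forall>\<psi>\<in>schwartz. S (\<lambda>x. \<phi> x + \<psi> x) = S \<phi> + S \<psi>) \<and>
     (\<forall>\<phi>\<in>schwartz. \<forall>c. S (\<lambda>x. c * \<phi> x) = c * S \<phi>) \<and>
     (\<exists>C m. \<forall>\<phi>\<in>schwartz. \<bar>S \<phi>\<bar> \<le> C * schwartz_seminorm m \<phi>)}"

text \<open>Schwartz's definition: for every \<open>k\<close> the distribution \<open>(1 + |x|^2)^k S\<close> is bounded, i.e.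
  it extends to a continuous linear form on the space of smooth functions all of whose
  derivatives are integrable (in which the test functions are dense).\<close>

definition rapid_decrease :: "'d::finite functional set" where
  "rapid_decrease = {S \<in> tempered_dist.
     \<forall>k::nat. \<exists>C m. \<forall>\<phi>\<in>test_functions.
       \<bar>S (\<lambda>x. (1 + (norm x)\<^sup>2) ^ k * \<phi> x)\<bar>
         \<le> C * (\<Sum>is | length is \<le> m. \<integral>x. \<bar>iter_partial is \<phi> x\<bar> \<partial>lborel)}"

definition dist_conv :: "'d::finite functional \<Rightarrow> (real^'d \<Rightarrow> real) \<Rightarrow> real^'d \<Rightarrow> real" where
  "dist_conv S \<phi> x = S (\<lambda>y. \<phi> (x - y))"

definition complexify :: "'d::finite functional \<Rightarrow> (real^'d \<Rightarrow> complex) \<Rightarrow> complex" where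
  "complexify S f = Complex (S (\<lambda>x. Re (f x))) (S (\<lambda>x. Im (f x)))"

text \<open>The Fourier transform of a distribution with rapid decrease is a smooth function; the
  continuous representative is selected, so that pointwise values make sense.\<close>

definition fourier_dist :: "'d::finite functional \<Rightarrow> real^'d \<Rightarrow> complex" where
  "fourier_dist S = (THE g. continuous_on UNIV g \<and>
     (\<forall>\<phi>\<in>schwartz. integrable lborel (\<lambda>\<xi>. g \<xi> * \<phi> \<xi>) \<and>
        complexify S (fourier \<phi>) = (\<integral>\<xi>. g \<xi> * \<phi> \<xi> \<partial>lborel)))"

definition tempered_measure :: "(real^'d::finite) measure \<Rightarrow> bool" where
  "tempered_measure \<nu> \<longleftrightarrow> sets \<nu> = sets borel \<and>
     (\<exists>k::nat. (\<integral>\<^sup>+x. ennreal (1 / (1 + (norm x)\<^sup>2) ^ k) \<partial>\<nu>) < \<infinity>)"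

definition nonneg_definite :: "(real^'d::finite) measure \<Rightarrow> bool" where
  "nonneg_definite \<Gamma> \<longleftrightarrow> (\<forall>\<phi>\<in>schwartz. 0 \<le> (\<integral>x. conv \<phi> (reflect \<phi>) x \<partial>\<Gamma>))"

definition fourier_measure_eq :: "(real^'d::finite) measure \<Rightarrow> (real^'d) measure \<Rightarrow> bool" where
  "fourier_measure_eq \<mu> \<Gamma> \<longleftrightarrow>
     (\<forall>\<phi>\<in>schwartz. (\<integral>x. \<phi> x \<partial>\<Gamma>) = (\<integral>\<xi>. fourier \<phi> \<xi> \<partial>\<mu>))"

definition spectral_covariance :: "(real^'d::finite) measure \<Rightarrow> (real^'d) measure \<Rightarrow> bool" where
  "spectral_covariance \<Gamma> \<mu> \<longleftrightarrow> tempered_measure \<Gamma> \<and> nonneg_definite \<Gamma> \<and>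
     tempered_measure \<mu> \<and> fourier_measure_eq \<mu> \<Gamma>"

text \<open>The complete space \<open>'h\<close> is, through \<open>\<iota>\<close>, a completion of the real Schwartz space.
  Linearity of \<open>\<iota>\<close> on the Schwartz space follows from the inner product formula. Any such
  completion is separable, so the sort \<open>second_countable_topology\<close> used below for
  measurability is no restriction.\<close>

definition is_completion ::
  "(real^'d::finite) measure \<Rightarrow> (real^'d) measure \<Rightarrow>
   ((real^'d \<Rightarrow> real) \<Rightarrow> 'h::{real_inner,banach,second_countable_topology}) \<Rightarrow> bool" where
  "is_completion \<Gamma> \<mu> \<iota> \<longleftrightarrow>
     (\<forall>\<phi>\<in>schwartz. \<forall>\<psi>\<in>schwartz.
        \<iota> \<phi> \<bullet> \<iota> \<psi> = (\<integral>x. conv \<phi> (reflect \<psi>) x \<partial>\<Gamma>) \<and>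
        complex_of_real (\<iota> \<phi> \<bullet> \<iota> \<psi>) = (\<integral>\<xi>. rfourier \<phi> \<xi> * cnj (rfourier \<psi> \<xi>) \<partial>\<mu>)) \<and>
     closure (\<iota> ` schwartz) = UNIV"

text \<open>The element \<open>h\<close> of the completion is the integrable function \<open>f\<close>: some sequence of Schwartz
  functions converges to \<open>h\<close> in the completion while its Fourier transforms converge to that of
  \<open>f\<close> in \<open>L\<^sup>2(\<mu>)\<close>. There is at most one such \<open>h\<close>, and its squared norm is
  \<open>\<integral>|\<F>f|\<^sup>2 d\<mu>\<close>.\<close>

definition represents ::
  "(real^'d::finite) measure \<Rightarrow> ((real^'d \<Rightarrow> real) \<Rightarrow> 'h::{real_inner,banach,second_countable_topology}) \<Rightarrow>
   (real^'d \<Rightarrow> real) \<Rightarrow> 'h \<Rightarrow> bool" where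
  "represents \<mu> \<iota> f h \<longleftrightarrow> integrable lborel f \<and>
     (\<exists>\<phi>. (\<forall>n. \<phi> n \<in> schwartz) \<and> (\<lambda>n. \<iota> (\<phi> n)) \<longlonglongrightarrow> h \<and>
        (\<lambda>n::nat. \<integral>\<^sup>+\<xi>. ennreal ((cmod (rfourier (\<phi> n) \<xi> - rfourier f \<xi>))\<^sup>2) \<partial>\<mu>) \<longlonglongrightarrow> 0)"

definition H_of ::
  "(real^'d::finite) measure \<Rightarrow> ((real^'d \<Rightarrow> real) \<Rightarrow> 'h::{real_inner,banach,second_countable_topology}) \<Rightarrow>
   (real^'d \<Rightarrow> real) \<Rightarrow> 'h" where
  "H_of \<mu> \<iota> f = (THE h. represents \<mu> \<iota> f h)"

definition L2 :: "'a measure \<Rightarrow> ('a \<Rightarrow> 'b::{real_normed_vector,second_countable_topology}) set" where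
  "L2 M = {f \<in> borel_measurable M. integrable M (\<lambda>x. (norm (f x))\<^sup>2)}"

definition L2_tendsto ::
  "'a measure \<Rightarrow> (nat \<Rightarrow> 'a \<Rightarrow> 'b::{real_normed_vector,second_countable_topology}) \<Rightarrow> ('a \<Rightarrow> 'b) \<Rightarrow> bool" where
  "L2_tendsto M f g \<longleftrightarrow> (\<forall>n. f n \<in> L2 M) \<and> g \<in> L2 M \<and>
     (\<lambda>n. \<integral>\<^sup>+x. ennreal ((norm (f n x - g x))\<^sup>2) \<partial>M) \<longlonglongrightarrow> 0"

abbreviation time :: "real \<Rightarrow> real measure" where
  "time T \<equiv> restrict_space lborel {0..T}"

text \<open>The space \<open>H\<^sub>T\<close> is \<open>L2 (time T)\<close>, and \<open>L\<^sup>2(\<Omega>; H\<^sub>T)\<close> is \<open>L2 (M \<Otimes>\<^sub>M time T)\<close>, in both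
  cases with functions rather than classes of functions as elements.\<close>

definition centered_gaussian :: "'w measure \<Rightarrow> ('w \<Rightarrow> real) \<Rightarrow> bool" where
  "centered_gaussian M X \<longleftrightarrow> X \<in> borel_measurable M \<and>
     ((AE \<omega> in M. X \<omega> = 0) \<or> (\<exists>\<sigma>>0. distributed M lborel X (\<lambda>x. ennreal (normal_density 0 \<sigma> x))))"

definition isonormal ::
  "'w measure \<Rightarrow> real \<Rightarrow> ((real \<Rightarrow> 'h::{real_inner,banach,second_countable_topology}) \<Rightarrow> 'w \<Rightarrow> real) \<Rightarrow> bool" where
  "isonormal M T F \<longleftrightarrow>
     (\<forall>S c. finite S \<and> S \<subseteq> L2 (time T) \<longrightarrow> centered_gaussian M (\<lambda>\<omega>. \<Sum>\<phi>\<in>S. c \<phi> * F \<phi> \<omega>)) \<and>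
     (\<forall>\<phi>\<in>L2 (time T). \<forall>\<psi>\<in>L2 (time T).
        (\<integral>\<omega>. F \<phi> \<omega> * F \<psi> \<omega> \<partial>M) = (\<integral>s. \<phi> s \<bullet> \<psi> s \<partial>time T))"

text \<open>Every event is generated by \<open>F\<close>, up to null sets.\<close>

definition generated_by ::
  "'w measure \<Rightarrow> real \<Rightarrow> ((real \<Rightarrow> 'h::{real_inner,banach,second_countable_topology}) \<Rightarrow> 'w \<Rightarrow> real) \<Rightarrow> bool" where
  "generated_by M T F \<longleftrightarrow> sets M = sigma_sets (space M)
     ({F \<phi> -` B \<inter> space M | \<phi> B. \<phi> \<in> L2 (time T) \<and> B \<in> sets borel} \<union> null_sets M)"

definition noise_path ::
  "((real \<Rightarrow> 'h::real_normed_vector) \<Rightarrow> 'w \<Rightarrow> real) \<Rightarrow> 'h \<Rightarrow> real \<Rightarrow> 'w \<Rightarrow> real" where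
  "noise_path F h t = F (\<lambda>s. indicator {0..t} s *\<^sub>R h)"

definition martingale_measure ::
  "(real^'d::finite) measure \<Rightarrow> ((real^'d \<Rightarrow> real) \<Rightarrow> 'h::{real_inner,banach,second_countable_topology}) \<Rightarrow>
   ((real \<Rightarrow> 'h) \<Rightarrow> 'w \<Rightarrow> real) \<Rightarrow> real \<Rightarrow> (real^'d) set \<Rightarrow> 'w \<Rightarrow> real" where
  "martingale_measure \<mu> \<iota> F t A = noise_path F (H_of \<mu> \<iota> (indicator A)) t"

text \<open>The natural filtration is augmented by the null sets: \<open>F\<close> is only determined almost surely,
  and the Brownian motions obtained from \<open>F\<close> are adapted to the augmented filtration only.\<close>

definition natural_filtration ::
  "'w measure \<Rightarrow> (real^'d::finite) measure \<Rightarrow>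
   ((real^'d \<Rightarrow> real) \<Rightarrow> 'h::{real_inner,banach,second_countable_topology}) \<Rightarrow>
   ((real \<Rightarrow> 'h) \<Rightarrow> 'w \<Rightarrow> real) \<Rightarrow> real \<Rightarrow> 'w measure" where
  "natural_filtration M \<mu> \<iota> F t = sigma (space M)
     ({martingale_measure \<mu> \<iota> F s A -` B \<inter> space M | s A B.
         0 \<le> s \<and> s \<le> t \<and> A \<in> sets borel \<and> bounded A \<and> B \<in> sets borel} \<union> null_sets M)"

definition bounded_rv :: "'w measure \<Rightarrow> ('w \<Rightarrow> real) \<Rightarrow> bool" where
  "bounded_rv M X \<longleftrightarrow> X \<in> borel_measurable M \<and> (\<exists>C. \<forall>\<omega>\<in>space M. \<bar>X \<omega>\<bar> \<le> C)"

definition predictable_sigma ::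
  "'w measure \<Rightarrow> (real \<Rightarrow> 'w measure) \<Rightarrow> real \<Rightarrow> ('w \<times> real \<times> (real^'d::finite)) measure" where
  "predictable_sigma M \<FF> T = sigma (space M \<times> {0..T} \<times> UNIV)
     ({E \<times> {a<..b} \<times> A | E a b A. 0 \<le> a \<and> a < b \<and> b \<le> T \<and> E \<in> sets (\<FF> a) \<and> A \<in> sets borel} \<union>
      {E \<times> {0} \<times> A | E A. E \<in> sets (\<FF> 0) \<and> A \<in> sets borel})"

definition predictable ::
  "'w measure \<Rightarrow> (real \<Rightarrow> 'w measure) \<Rightarrow> real \<Rightarrow> (real \<Rightarrow> real^'d::finite \<Rightarrow> 'w \<Rightarrow> real) \<Rightarrow> bool" where
  "predictable M \<FF> T Z \<longleftrightarrow>
     (\<lambda>(\<omega>, s, y). Z s y \<omega>) \<in> borel_measurable (predictable_sigma M \<FF> T)"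

definition simple_process ::
  "(real \<Rightarrow> 'w measure) \<Rightarrow> real \<Rightarrow> (real \<Rightarrow> real^'d::finite \<Rightarrow> 'w \<Rightarrow> real) \<Rightarrow> bool" where
  "simple_process \<FF> T g \<longleftrightarrow> (\<exists>(N::nat) a b A X.
     (\<forall>i<N. 0 \<le> a i \<and> a i < b i \<and> b i \<le> T \<and> A i \<in> sets borel \<and> bounded (A i) \<and>
            bounded_rv (\<FF> (a i)) (X i)) \<and>
     g = (\<lambda>s y \<omega>. \<Sum>i<N. indicator {a i<..b i} s * indicator (A i) y * X i \<omega>))"

definition represents_process ::
  "'w measure \<Rightarrow> real \<Rightarrow> (real^'d::finite) measure \<Rightarrow>
   ((real^'d \<Rightarrow> real) \<Rightarrow> 'h::{real_inner,banach,second_countable_topology}) \<Rightarrow>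
   (real \<Rightarrow> real^'d \<Rightarrow> 'w \<Rightarrow> real) \<Rightarrow> ('w \<times> real \<Rightarrow> 'h) \<Rightarrow> bool" where
  "represents_process M T \<mu> \<iota> g G \<longleftrightarrow>
     (AE (\<omega>, s) in M \<Otimes>\<^sub>M time T. represents \<mu> \<iota> (\<lambda>y. g s y \<omega>) (G (\<omega>, s)))"

text \<open>On functions representing processes the norm of \<open>L\<^sup>2(\<Omega>; H\<^sub>T)\<close> is the norm
  \<open>(E \<integral>\<integral>|\<F>g(s)(\<xi>)|\<^sup>2 \<mu>(d\<xi>) ds)\<^sup>1\<^sup>/\<^sup>2\<close>, so the completion is the closure in \<open>L\<^sup>2(\<Omega>; H\<^sub>T)\<close>.\<close>

definition P0 ::
  "'w measure \<Rightarrow> (real \<Rightarrow> 'w measure) \<Rightarrow> real \<Rightarrow> (real^'d::finite) measure \<Rightarrow>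
   ((real^'d \<Rightarrow> real) \<Rightarrow> 'h::{real_inner,banach,second_countable_topology}) \<Rightarrow> ('w \<times> real \<Rightarrow> 'h) set" where
  "P0 M \<FF> T \<mu> \<iota> = {G. \<exists>g Gs.
     (\<forall>n. simple_process \<FF> T (g n) \<and> represents_process M T \<mu> \<iota> (g n) (Gs n)) \<and>
     L2_tendsto (M \<Otimes>\<^sub>M time T) Gs G}"

definition P0_limit ::
  "'w measure \<Rightarrow> (real \<Rightarrow> 'w measure) \<Rightarrow> real \<Rightarrow> (real^'d::finite) measure \<Rightarrow>
   ((real^'d \<Rightarrow> real) \<Rightarrow> 'h::{real_inner,banach,second_countable_topology}) \<Rightarrow>
   (nat \<Rightarrow> real \<Rightarrow> real^'d \<Rightarrow> 'w \<Rightarrow> real) \<Rightarrow> ('w \<times> real \<Rightarrow> 'h) \<Rightarrow> bool" where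
  "P0_limit M \<FF> T \<mu> \<iota> g \<Phi> \<longleftrightarrow> \<Phi> \<in> P0 M \<FF> T \<mu> \<iota> \<and> (\<exists>G.
     (\<forall>n\<ge>1. G n \<in> P0 M \<FF> T \<mu> \<iota> \<and> represents_process M T \<mu> \<iota> (g n) (G n)) \<and>
     L2_tendsto (M \<Otimes>\<^sub>M time T) G \<Phi>)"

definition mollifier :: "(real^'d::finite \<Rightarrow> real) \<Rightarrow> nat \<Rightarrow> real^'d \<Rightarrow> real" where
  "mollifier \<zeta> n x = real n ^ CARD('d) * \<zeta> (real n *\<^sub>R x)"

definition mollified_process ::
  "(real \<Rightarrow> 'd::finite functional) \<Rightarrow> (real^'d \<Rightarrow> real) \<Rightarrow> (real \<Rightarrow> real^'d \<Rightarrow> 'w \<Rightarrow> real) \<Rightarrow>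
   real \<Rightarrow> real^'d \<Rightarrow> nat \<Rightarrow> real \<Rightarrow> real^'d \<Rightarrow> 'w \<Rightarrow> real" where
  "mollified_process \<Lambda> \<zeta> Z t x n s y \<omega> =
     (if s \<le> t then dist_conv (\<Lambda> (t - s)) (mollifier \<zeta> n) (x - y) * Z s y \<omega> else 0)"

text \<open>Smooth functions of \<open>m\<close> real variables, for varying \<open>m\<close>, are smooth functions of a sequence
  that depend on its first \<open>m\<close> entries only.\<close>

definition coord_deriv :: "nat \<Rightarrow> ((nat \<Rightarrow> real) \<Rightarrow> real) \<Rightarrow> (nat \<Rightarrow> real) \<Rightarrow> real" where
  "coord_deriv i f x = deriv (\<lambda>r. f (x(i := r))) (x i)"

definition smooth_poly_growth :: "nat \<Rightarrow> ((nat \<Rightarrow> real) \<Rightarrow> real) \<Rightarrow> bool" where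
  "smooth_poly_growth m f \<longleftrightarrow>
     (\<forall>x y. (\<forall>i<m. x i = y i) \<longrightarrow> f x = f y) \<and>
     (\<forall>is. set is \<subseteq> {..<m} \<longrightarrow>
        continuous_on UNIV (foldr coord_deriv is f) \<and>
        (\<forall>i<m. \<forall>x. (\<lambda>r. foldr coord_deriv is f (x(i := r))) differentiable (at (x i))) \<and>
        (\<exists>C (k::nat). \<forall>x. \<bar>foldr coord_deriv is f x\<bar> \<le> C * (1 + (\<Sum>i<m. \<bar>x i\<bar>)) ^ k))"

text \<open>A smooth random variable \<open>G = f(F(\<phi>\<^sub>1), \<dots>, F(\<phi>\<^sub>m))\<close> together with its derivative
  \<open>U = \<Sum>\<^sub>i \<partial>\<^sub>i f(F(\<phi>\<^sub>1), \<dots>, F(\<phi>\<^sub>m)) \<phi>\<^sub>i\<close>.\<close>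

definition smooth_rv_deriv ::
  "real \<Rightarrow> ((real \<Rightarrow> 'h::{real_inner,banach,second_countable_topology}) \<Rightarrow> 'w \<Rightarrow> real) \<Rightarrow>
   ('w \<Rightarrow> real) \<Rightarrow> ('w \<times> real \<Rightarrow> 'h) \<Rightarrow> bool" where
  "smooth_rv_deriv T F G U \<longleftrightarrow> (\<exists>m f \<phi>. smooth_poly_growth m f \<and> (\<forall>i<m. \<phi> i \<in> L2 (time T)) \<and>
     G = (\<lambda>\<omega>. f (\<lambda>i. F (\<phi> i) \<omega>)) \<and>
     U = (\<lambda>(\<omega>, s). \<Sum>i<m. coord_deriv i f (\<lambda>j. F (\<phi> j) \<omega>) *\<^sub>R \<phi> i s))"

text \<open>The closure of the above operator: \<open>G\<close> is in its domain, with derivative \<open>U\<close>.\<close>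

definition has_malliavin_deriv ::
  "'w measure \<Rightarrow> real \<Rightarrow> ((real \<Rightarrow> 'h::{real_inner,banach,second_countable_topology}) \<Rightarrow> 'w \<Rightarrow> real) \<Rightarrow>
   ('w \<Rightarrow> real) \<Rightarrow> ('w \<times> real \<Rightarrow> 'h) \<Rightarrow> bool" where
  "has_malliavin_deriv M T F G U \<longleftrightarrow> (\<exists>Gs Us. (\<forall>n. smooth_rv_deriv T F (Gs n) (Us n)) \<and>
     L2_tendsto M Gs G \<and> L2_tendsto (M \<Otimes>\<^sub>M time T) Us U)"

definition has_divergence ::
  "'w measure \<Rightarrow> real \<Rightarrow> ((real \<Rightarrow> 'h::{real_inner,banach,second_countable_topology}) \<Rightarrow> 'w \<Rightarrow> real) \<Rightarrow>
   ('w \<times> real \<Rightarrow> 'h) \<Rightarrow> ('w \<Rightarrow> real) \<Rightarrow> bool" where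
  "has_divergence M T F u Y \<longleftrightarrow> u \<in> L2 (M \<Otimes>\<^sub>M time T) \<and> Y \<in> L2 M \<and>
     (\<forall>G U. has_malliavin_deriv M T F G U \<longrightarrow>
        (\<integral>\<omega>. G \<omega> * Y \<omega> \<partial>M) = (\<integral>p. U p \<bullet> u p \<partial>(M \<Otimes>\<^sub>M time T)))"

definition divergence_domain ::
  "'w measure \<Rightarrow> real \<Rightarrow> ((real \<Rightarrow> 'h::{real_inner,banach,second_countable_topology}) \<Rightarrow> 'w \<Rightarrow> real) \<Rightarrow>
   ('w \<times> real \<Rightarrow> 'h) set" where
  "divergence_domain M T F = {u. \<exists>Y. has_divergence M T F u Y}"

text \<open>A version of the divergence, which is unique almost surely.\<close>

definition divergence ::
  "'w measure \<Rightarrow> real \<Rightarrow> ((real \<Rightarrow> 'h::{real_inner,banach,second_countable_topology}) \<Rightarrow> 'w \<Rightarrow> real) \<Rightarrow>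
   ('w \<times> real \<Rightarrow> 'h) \<Rightarrow> 'w \<Rightarrow> real" where
  "divergence M T F u = (SOME Y. has_divergence M T F u Y)"

text \<open>Here \<open>\<FF>\<close> is the filtration, \<open>W\<close> a process indexed by time, and \<open>Y\<close> the integral over
  \<open>[0, t]\<close> of the step process \<open>h\<close>.\<close>

definition elementary_ito ::
  "(real \<Rightarrow> 'w measure) \<Rightarrow> real \<Rightarrow> (real \<Rightarrow> 'w \<Rightarrow> real) \<Rightarrow> real \<Rightarrow>
   ('w \<times> real \<Rightarrow> real) \<Rightarrow> ('w \<Rightarrow> real) \<Rightarrow> bool" where
  "elementary_ito \<FF> T W t h Y \<longleftrightarrow> (\<exists>(N::nat) a b X.
     (\<forall>i<N. 0 \<le> a i \<and> a i < b i \<and> b i \<le> T \<and> bounded_rv (\<FF> (a i)) (X i)) \<and>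
     h = (\<lambda>(\<omega>, s). \<Sum>i<N. indicator {a i<..b i} s * X i \<omega>) \<and>
     Y = (\<lambda>\<omega>. \<Sum>i<N. X i \<omega> * (W (min (b i) t) \<omega> - W (min (a i) t) \<omega>)))"

definition has_ito_integral ::
  "'w measure \<Rightarrow> (real \<Rightarrow> 'w measure) \<Rightarrow> real \<Rightarrow> (real \<Rightarrow> 'w \<Rightarrow> real) \<Rightarrow> real \<Rightarrow>
   ('w \<times> real \<Rightarrow> real) \<Rightarrow> ('w \<Rightarrow> real) \<Rightarrow> bool" where
  "has_ito_integral M \<FF> T W t h Y \<longleftrightarrow> (\<exists>hs Ys. (\<forall>n. elementary_ito \<FF> T W t (hs n) (Ys n)) \<and>
     L2_tendsto (M \<Otimes>\<^sub>M time T) hs h \<and> L2_tendsto M Ys Y)"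

text \<open>The index set \<open>K\<close> accommodates finite-dimensional spaces.\<close>

definition complete_orthonormal :: "nat set \<Rightarrow> (nat \<Rightarrow> 'h::real_inner) \<Rightarrow> bool" where
  "complete_orthonormal K e \<longleftrightarrow>
     (\<forall>j\<in>K. \<forall>k\<in>K. e j \<bullet> e k = (if j = k then 1 else 0)) \<and> closure (span (e ` K)) = UNIV"

definition has_stoch_integral ::
  "'w measure \<Rightarrow> (real \<Rightarrow> 'w measure) \<Rightarrow> real \<Rightarrow>
   ((real \<Rightarrow> 'h::{real_inner,banach,second_countable_topology}) \<Rightarrow> 'w \<Rightarrow> real) \<Rightarrow>
   nat set \<Rightarrow> (nat \<Rightarrow> 'h) \<Rightarrow> ('w \<times> real \<Rightarrow> 'h) \<Rightarrow> real \<Rightarrow> ('w \<Rightarrow> real) \<Rightarrow> bool" where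
  "has_stoch_integral M \<FF> T F K e g t Y \<longleftrightarrow> (\<exists>I.
     (\<forall>k\<in>K. has_ito_integral M \<FF> T (noise_path F (e k)) t (\<lambda>p. g p \<bullet> e k) (I k)) \<and>
     L2_tendsto M (\<lambda>n \<omega>. \<Sum>k\<in>K \<inter> {..<n}. I k \<omega>) Y)"

text \<open>A version of \<open>(g \<cdot> W)\<^sub>t\<close>, which is unique almost surely.\<close>

definition stoch_integral ::
  "'w measure \<Rightarrow> (real \<Rightarrow> 'w measure) \<Rightarrow> real \<Rightarrow>
   ((real \<Rightarrow> 'h::{real_inner,banach,second_countable_topology}) \<Rightarrow> 'w \<Rightarrow> real) \<Rightarrow>
   nat set \<Rightarrow> (nat \<Rightarrow> 'h) \<Rightarrow> ('w \<times> real \<Rightarrow> 'h) \<Rightarrow> real \<Rightarrow> 'w \<Rightarrow> real" where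
  "stoch_integral M \<FF> T F K e g t = (SOME Y. has_stoch_integral M \<FF> T F K e g t Y)"

end

theory Submission
  imports Defs
begin

text \<open>Both integrals are limits of integrals of simple processes, so the heart of the matter is the
  duality \<open>E[G X F(\<psi>)] = E[X \<langle>DG, \<psi>\<rangle>]\<close> for a bounded \<open>X\<close> known at time \<open>c\<close> and a deterministic
  \<open>\<psi>\<close> vanishing up to \<open>c\<close>. Such an \<open>X\<close> is measurable with respect to the noise orthogonal to \<open>\<psi>\<close>,
  which is independent of \<open>F(\<psi>)\<close>; splitting each argument of \<open>G\<close> into its orthogonal part and a
  multiple of \<open>F(\<psi>)\<close> reduces the duality to one-dimensional Gaussian integration by parts. With
  linear \<open>G\<close> the same identity is the Ito isometry, which carries everything to \<open>L\<^sup>2\<close> limits and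
  to the expansion along a complete orthonormal system.\<close>

section \<open>Square integrable functions\<close>

text \<open>Two mismatches shape the proof. The divergence sees all of \<open>[0, T]\<close>, while
  the stochastic integral stops at \<open>t\<close>; they can agree because the approximating
  processes, hence also \<open>\<Phi>\<close>, vanish after \<open>t\<close>. Moreover, an element
  of \<open>P0\<close> is a limit of representatives of simple processes in \<open>'h\<close>,
  whereas an integral against \<open>W^k\<close> asks for real step processes. Pairing with
  \<open>e k\<close> should produce these, but a single term \<open>indicator (A i)\<close> of a
  simple process may have no representative even if the whole sum has one; linear algebra on the
  representable combinations supplies deterministic vectors nevertheless.

  The comparison runs through one relation between integrands and integrals that is closed under
  linear combinations and L2 limits. Convergence of integrals is not built into it but follows from
  the isometry. Since \<open>F\<close> is linear only almost surely, families of noise values are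
  closed under combinations only up to null sets, and independence is extracted from characteristic
  functions. The stochastic integral of \<open>\<Phi>\<close> is shown to be a divergence of
  \<open>\<Phi>\<close>, so that the asserted equality becomes uniqueness of the divergence.\<close>

lemma integrable_bound_pointwise:
  fixes f :: "'a \<Rightarrow> 'b::{banach, second_countable_topology}"
    and g :: "'a \<Rightarrow> 'c::{banach, second_countable_topology}"
  assumes "integrable M f" "\<And>x. norm (g x) \<le> norm (f x)" "g \<in> borel_measurable M"
  shows "integrable M g"
  by (rule Bochner_Integration.integrable_bound[OF assms(1,3)]) (use assms(2) in simp)

lemma sq_norm_add_le:
  fixes a b :: "'b::real_normed_vector"
  shows "(norm (a + b))\<^sup>2 \<le> 2 * (norm a)\<^sup>2 + 2 * (norm b)\<^sup>2"
proof -
  have "(norm (a + b))\<^sup>2 \<le> (norm a + norm b)\<^sup>2"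
    by (intro power_mono norm_triangle_ineq) auto
  also have "\<dots> \<le> 2 * (norm a)\<^sup>2 + 2 * (norm b)\<^sup>2"
    using sum_squares_bound[of "norm a" "norm b"] by (simp add: power2_sum)
  finally show ?thesis .
qed

lemma null_sandwich:
  fixes f g :: "nat \<Rightarrow> real"
  assumes "\<And>n. 0 \<le> f n" "\<And>n. f n \<le> g n" "g \<longlonglongrightarrow> 0"
  shows "f \<longlonglongrightarrow> 0"
  by (rule tendsto_sandwich[OF _ _ tendsto_const assms(3)]) (use assms in auto)

lemma L2_measurable [measurable_dest]: "f \<in> L2 M \<Longrightarrow> f \<in> borel_measurable M"
  by (simp add: L2_def)

lemma L2_integrable: "f \<in> L2 M \<Longrightarrow> integrable M (\<lambda>x. (norm (f x))\<^sup>2)"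
  by (simp add: L2_def)

lemma L2_lin:
  assumes "f \<in> L2 M" "g \<in> L2 M"
  shows "(\<lambda>x. f x + c *\<^sub>R g x) \<in> L2 M"
proof -
  have [measurable]: "f \<in> borel_measurable M" "g \<in> borel_measurable M"
    using assms by (auto simp: L2_def)
  have "integrable M (\<lambda>x. 2 * (norm (f x))\<^sup>2 + 2 * (c\<^sup>2 * (norm (g x))\<^sup>2))"
    using assms by (auto intro!: Bochner_Integration.integrable_add integrable_mult_right L2_integrable)
  then have "integrable M (\<lambda>x. (norm (f x + c *\<^sub>R g x))\<^sup>2)"
  proof (rule integrable_bound_pointwise)
    show "norm ((norm (f x + c *\<^sub>R g x))\<^sup>2) \<le> norm (2 * (norm (f x))\<^sup>2 + 2 * (c\<^sup>2 * (norm (g x))\<^sup>2))" for x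
      using sq_norm_add_le[of "f x" "c *\<^sub>R g x"] by (simp add: power_mult_distrib)
  qed simp
  then show ?thesis by (simp add: L2_def)
qed

lemma L2_zero [simp]: "(\<lambda>x. 0) \<in> L2 M"
  by (simp add: L2_def)

lemma L2_diff: "f \<in> L2 M \<Longrightarrow> g \<in> L2 M \<Longrightarrow> (\<lambda>x. f x - g x) \<in> L2 M"
  using L2_lin[of f M g "-1"] by simp

lemma L2_bound:
  assumes "f \<in> L2 M" "g \<in> borel_measurable M" "AE x in M. norm (g x) \<le> norm (f x)"
  shows "g \<in> L2 M"
proof -
  have "integrable M (\<lambda>x. (norm (g x))\<^sup>2)"
    by (rule Bochner_Integration.integrable_bound[OF L2_integrable[OF assms(1)]])
       (use assms in \<open>auto intro!: power_mono\<close>)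
  with assms show ?thesis by (simp add: L2_def)
qed

lemma L2_inner_integrable:
  fixes f g :: "'a \<Rightarrow> 'b::{real_inner, second_countable_topology}"
  assumes "f \<in> L2 M" "g \<in> L2 M"
  shows "integrable M (\<lambda>x. f x \<bullet> g x)"
proof -
  have [measurable]: "f \<in> borel_measurable M" "g \<in> borel_measurable M"
    using assms by (auto simp: L2_def)
  have "integrable M (\<lambda>x. (norm (f x))\<^sup>2 + (norm (g x))\<^sup>2)"
    using assms by (auto intro: L2_integrable)
  then show ?thesis
  proof (rule integrable_bound_pointwise)
    show "norm (f x \<bullet> g x) \<le> norm ((norm (f x))\<^sup>2 + (norm (g x))\<^sup>2)" for x
    proof -
      have "\<bar>f x \<bullet> g x\<bar> \<le> norm (f x) * norm (g x)" by (rule Cauchy_Schwarz_ineq2)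
      also have "\<dots> \<le> (norm (f x))\<^sup>2 + (norm (g x))\<^sup>2"
        using sum_squares_bound[of "norm (f x)" "norm (g x)"]
          mult_nonneg_nonneg[OF norm_ge_zero[of "f x"] norm_ge_zero[of "g x"]]
        by linarith
      finally show ?thesis by simp
    qed
  qed simp
qed

lemma L2_mult_integrable:
  fixes f g :: "'a \<Rightarrow> real"
  shows "f \<in> L2 M \<Longrightarrow> g \<in> L2 M \<Longrightarrow> integrable M (\<lambda>x. f x * g x)"
  using L2_inner_integrable[of f M g] by simp

lemma nn_integral_L2:
  "f \<in> L2 M \<Longrightarrow> (\<integral>\<^sup>+x. ennreal ((norm (f x))\<^sup>2) \<partial>M) = ennreal (\<integral>x. (norm (f x))\<^sup>2 \<partial>M)"
  by (intro nn_integral_eq_integral L2_integrable) auto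

text \<open>The definition measures distances in \<open>ennreal\<close>, so that they cannot be zero
  merely because an integrand fails to be integrable. Once all functions are in \<open>L2\<close>,
  the real integral carries the same information and is easier to calculate with.\<close>

lemma L2_tendsto_iff:
  "L2_tendsto M f g \<longleftrightarrow> (\<forall>n. f n \<in> L2 M) \<and> g \<in> L2 M \<and>
     (\<lambda>n. \<integral>x. (norm (f n x - g x))\<^sup>2 \<partial>M) \<longlonglongrightarrow> 0"
proof -
  have "(\<lambda>n. \<integral>\<^sup>+x. ennreal ((norm (f n x - g x))\<^sup>2) \<partial>M) =
     (\<lambda>n. ennreal (\<integral>x. (norm (f n x - g x))\<^sup>2 \<partial>M))" if "\<forall>n. f n \<in> L2 M" "g \<in> L2 M"
    using that by (auto intro!: nn_integral_L2 L2_diff)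
  moreover have "((\<lambda>n. ennreal (r n)) \<longlonglongrightarrow> 0) \<longleftrightarrow> r \<longlonglongrightarrow> 0" if "\<And>n. 0 \<le> r n" for r :: "nat \<Rightarrow> real"
    using tendsto_ennreal_iff[of r sequentially 0] that by simp
  ultimately show ?thesis
    by (auto simp: L2_tendsto_def)
qed

lemma Cauchy_Schwarz_L2:
  fixes f g :: "'a \<Rightarrow> 'b::{real_inner, second_countable_topology}"
  assumes "f \<in> L2 M" "g \<in> L2 M"
  shows "\<bar>\<integral>x. f x \<bullet> g x \<partial>M\<bar>\<^sup>2 \<le> (\<integral>x. (norm (f x))\<^sup>2 \<partial>M) * (\<integral>x. (norm (g x))\<^sup>2 \<partial>M)"
proof -
  have [measurable]: "f \<in> borel_measurable M" "g \<in> borel_measurable M"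
    using assms by (auto simp: L2_def)
  have "ennreal \<bar>\<integral>x. f x \<bullet> g x \<partial>M\<bar> \<le> (\<integral>\<^sup>+x. ennreal (norm (f x)) * ennreal (norm (g x)) \<partial>M)"
  proof -
    have "ennreal \<bar>\<integral>x. f x \<bullet> g x \<partial>M\<bar> \<le> (\<integral>\<^sup>+x. ennreal (norm (f x \<bullet> g x)) \<partial>M)"
      using integral_norm_bound_ennreal[OF L2_inner_integrable[OF assms]] by simp
    also have "\<dots> \<le> (\<integral>\<^sup>+x. ennreal (norm (f x)) * ennreal (norm (g x)) \<partial>M)"
      by (intro nn_integral_mono) (auto simp: ennreal_mult'[symmetric] intro!: ennreal_leI Cauchy_Schwarz_ineq2)
    finally show ?thesis .
  qed
  then have "(ennreal \<bar>\<integral>x. f x \<bullet> g x \<partial>M\<bar>)\<^sup>2 \<le> (\<integral>\<^sup>+x. ennreal (norm (f x)) * ennreal (norm (g x)) \<partial>M)\<^sup>2"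
    by (rule power_mono) simp
  also have "\<dots> \<le> (\<integral>\<^sup>+x. (ennreal (norm (f x)))\<^sup>2 \<partial>M) * (\<integral>\<^sup>+x. (ennreal (norm (g x)))\<^sup>2 \<partial>M)"
    by (rule Cauchy_Schwarz_nn_integral) auto
  also have "\<dots> = ennreal ((\<integral>x. (norm (f x))\<^sup>2 \<partial>M) * (\<integral>x. (norm (g x))\<^sup>2 \<partial>M))"
    using assms by (simp add: ennreal_power nn_integral_L2 ennreal_mult')
  finally show ?thesis
    by (simp add: ennreal_power)
qed

lemma L2_tendsto_inner:
  fixes f :: "nat \<Rightarrow> 'a \<Rightarrow> 'b::{real_inner, second_countable_topology}"
  assumes "L2_tendsto M f h" "g \<in> L2 M"
  shows "(\<lambda>n. \<integral>x. f n x \<bullet> g x \<partial>M) \<longlonglongrightarrow> (\<integral>x. h x \<bullet> g x \<partial>M)"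
proof -
  have f: "\<And>n. f n \<in> L2 M" and h: "h \<in> L2 M"
    and lim: "(\<lambda>n. \<integral>x. (norm (f n x - h x))\<^sup>2 \<partial>M) \<longlonglongrightarrow> 0"
    using assms by (auto simp: L2_tendsto_iff)
  let ?d = "\<lambda>n. (\<integral>x. f n x \<bullet> g x \<partial>M) - (\<integral>x. h x \<bullet> g x \<partial>M)"
  have eq: "?d n = (\<integral>x. (f n x - h x) \<bullet> g x \<partial>M)" for n
    using f h assms(2) by (simp add: inner_diff_left L2_inner_integrable)
  have "\<bar>?d n\<bar>\<^sup>2 \<le> (\<integral>x. (norm (f n x - h x))\<^sup>2 \<partial>M) * (\<integral>x. (norm (g x))\<^sup>2 \<partial>M)" for n
    unfolding eq using f h assms(2) by (intro Cauchy_Schwarz_L2 L2_diff)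
  moreover have "(\<lambda>n. (\<integral>x. (norm (f n x - h x))\<^sup>2 \<partial>M) * (\<integral>x. (norm (g x))\<^sup>2 \<partial>M)) \<longlonglongrightarrow> 0"
    using tendsto_mult_left_zero[OF lim] by simp
  ultimately have "(\<lambda>n. \<bar>?d n\<bar>\<^sup>2) \<longlonglongrightarrow> 0"
    by (rule null_sandwich[rotated]) simp
  then have "(\<lambda>n. sqrt (\<bar>?d n\<bar>\<^sup>2)) \<longlonglongrightarrow> sqrt 0"
    by (rule tendsto_real_sqrt)
  then have "?d \<longlonglongrightarrow> 0"
    by (simp add: tendsto_rabs_zero_iff)
  then show ?thesis by (simp add: LIM_zero_iff)
qed

lemma L2_tendsto_const:
  assumes "f \<in> L2 M" "g \<in> borel_measurable M" "AE x in M. f x = g x"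
  shows "L2_tendsto M (\<lambda>_. f) g"
proof -
  have "g \<in> L2 M"
    by (rule L2_bound[OF assms(1,2)]) (use assms(3) in auto)
  moreover have "(\<integral>x. (norm (f x - g x))\<^sup>2 \<partial>M) = 0"
    by (rule integral_eq_zero_AE) (use assms(3) in auto)
  ultimately show ?thesis using assms by (simp add: L2_tendsto_iff)
qed

text \<open>Convergence passes through a contraction, even into another value space; later this is a
  cutoff in time or the inner product with a unit vector. Square integrability of \<open>g'\<close>
  is recovered from \<open>f' 0 - (f' 0 - g')\<close>, both terms being dominated.\<close>

lemma L2_tendsto_sandwich:
  assumes "L2_tendsto M f g" "\<And>n. f' n \<in> borel_measurable M" "g' \<in> borel_measurable M"
    and "\<And>n. AE x in M. norm (f' n x) \<le> norm (f n x)"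
    and "\<And>n. AE x in M. norm (f' n x - g' x) \<le> norm (f n x - g x)"
  shows "L2_tendsto M f' g'"
proof -
  have f: "\<And>n. f n \<in> L2 M" and g: "g \<in> L2 M"
    and lim: "(\<lambda>n. \<integral>x. (norm (f n x - g x))\<^sup>2 \<partial>M) \<longlonglongrightarrow> 0"
    using assms by (auto simp: L2_tendsto_iff)
  have f': "f' n \<in> L2 M" for n by (rule L2_bound[OF f assms(2,4)])
  have d: "(\<lambda>x. f' n x - g' x) \<in> L2 M" for n
    by (rule L2_bound[OF L2_diff[OF f[of n] g]]) (use assms(2,3,5) in auto)
  have "g' \<in> L2 M" using L2_diff[OF f'[of 0] d[of 0]] by simp
  moreover have "(\<lambda>n. \<integral>x. (norm (f' n x - g' x))\<^sup>2 \<partial>M) \<longlonglongrightarrow> 0"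
  proof (rule null_sandwich[OF _ _ lim])
    fix n
    show "(\<integral>x. (norm (f' n x - g' x))\<^sup>2 \<partial>M) \<le> (\<integral>x. (norm (f n x - g x))\<^sup>2 \<partial>M)"
    proof (rule integral_mono_AE)
      show "AE x in M. (norm (f' n x - g' x))\<^sup>2 \<le> (norm (f n x - g x))\<^sup>2"
        using assms(5)[of n] by (auto elim!: eventually_mono intro: power_mono)
    qed (intro L2_integrable d L2_diff[OF f g])+
  qed simp
  ultimately show ?thesis using f' by (simp add: L2_tendsto_iff)
qed

lemma nn_integral_sq_norm_add_le:
  assumes [measurable]: "f \<in> borel_measurable M" "g \<in> borel_measurable M"
  shows "(\<integral>\<^sup>+x. ennreal ((norm (f x + g x :: 'b::{real_normed_vector, second_countable_topology}))\<^sup>2) \<partial>M) \<le>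
    2 * (\<integral>\<^sup>+x. ennreal ((norm (f x))\<^sup>2) \<partial>M) + 2 * (\<integral>\<^sup>+x. ennreal ((norm (g x))\<^sup>2) \<partial>M)"
proof -
  have "(\<integral>\<^sup>+x. ennreal ((norm (f x + g x))\<^sup>2) \<partial>M) \<le>
    (\<integral>\<^sup>+x. 2 * ennreal ((norm (f x))\<^sup>2) + 2 * ennreal ((norm (g x))\<^sup>2) \<partial>M)"
  proof (rule nn_integral_mono)
    fix x
    have "ennreal ((norm (f x + g x))\<^sup>2) \<le> ennreal (2 * (norm (f x))\<^sup>2 + 2 * (norm (g x))\<^sup>2)"
      by (intro ennreal_leI sq_norm_add_le)
    also have "\<dots> = 2 * ennreal ((norm (f x))\<^sup>2) + 2 * ennreal ((norm (g x))\<^sup>2)"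
      by (simp add: ennreal_plus ennreal_mult)
    finally show "ennreal ((norm (f x + g x))\<^sup>2) \<le> 2 * ennreal ((norm (f x))\<^sup>2) + 2 * ennreal ((norm (g x))\<^sup>2)" .
  qed
  also have "\<dots> = 2 * (\<integral>\<^sup>+x. ennreal ((norm (f x))\<^sup>2) \<partial>M) + 2 * (\<integral>\<^sup>+x. ennreal ((norm (g x))\<^sup>2) \<partial>M)"
    by (simp add: nn_integral_add nn_integral_cmult)
  finally show ?thesis .
qed

text \<open>Riesz-Fischer. A rapidly Cauchy subsequence converges almost everywhere, and Fatou along
  it bounds the distance of every late \<open>f n\<close> from the limit, so that the whole sequence
  converges.\<close>

lemma L2_complete:
  fixes f :: "nat \<Rightarrow> 'a \<Rightarrow> real"
  assumes "finite_measure M" "\<And>n. f n \<in> L2 M"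
    and Cauchy: "\<And>\<epsilon>. \<epsilon> > 0 \<Longrightarrow> \<exists>N. \<forall>m\<ge>N. \<forall>n\<ge>N. (\<integral>x. (f m x - f n x)\<^sup>2 \<partial>M) < \<epsilon>"
  shows "\<exists>g. L2_tendsto M f g"
proof -
  interpret finite_measure M by fact
  have [measurable]: "f n \<in> borel_measurable M" for n using assms(2)[of n] by (simp add: L2_def)
  have int2: "integrable M (\<lambda>x. (f m x - f n x)\<^sup>2)" for m n
    using L2_integrable[OF L2_diff[OF assms(2)[of m] assms(2)[of n]]] by simp
  have "\<exists>N. \<forall>k. \<forall>m\<ge>N k. \<forall>n\<ge>N k. (\<integral>x. (f m x - f n x)\<^sup>2 \<partial>M) < (1/4)^k"
    using Cauchy by (intro choice allI) auto
  then obtain N where N: "\<And>k m n. m \<ge> N k \<Longrightarrow> n \<ge> N k \<Longrightarrow> (\<integral>x. (f m x - f n x)\<^sup>2 \<partial>M) < (1/4)^k"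
    by blast
  \<comment> \<open>Summing all \<open>N j\<close> makes \<open>r\<close> monotone and keeps it
    above each \<open>N k\<close>; the summand \<open>k\<close> sends it to infinity.\<close>
  define r where "r k = (\<Sum>j\<le>k. N j) + k" for k
  have rN: "N k \<le> r k" for k unfolding r_def by (simp add: member_le_sum trans_le_add1)
  have rk: "k \<le> r k" "r k \<le> r (Suc k)" for k by (auto simp: r_def)
  define D where "D k x = \<bar>f (r (Suc k)) x - f (r k) x\<bar>" for k x
  have [measurable]: "D k \<in> borel_measurable M" for k unfolding D_def by measurable
  have iD: "integrable M (D k)" for k
    unfolding D_def by (rule integrable_abs, rule square_integrable_imp_integrable) (use int2 in auto)
  have D: "(\<integral>x. D k x \<partial>M) \<le> (1/2)^k * (measure M (space M) + 1)" for k
  proof -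
    \<comment> \<open>Values of \<open>D k\<close> above \<open>?c\<close> are at most their square
      divided by \<open>?c\<close>. This trades the L2 bound \<open>(1/4)^k\<close> for an L1 bound
      of order \<open>(1/2)^k\<close>, at the cost of the finite total mass.\<close>
    let ?c = "(1/2)^k :: real"
    have "D k x \<le> ?c + (D k x)\<^sup>2 / ?c" for x
    proof (cases "D k x \<le> ?c")
      case False
      then have "D k x * ?c \<le> D k x * D k x" by (intro mult_left_mono) (auto simp: D_def)
      then have "D k x \<le> (D k x)\<^sup>2 / ?c" by (simp add: field_simps power2_eq_square)
      then show ?thesis by (simp add: add_increasing)
    next
      case True then show ?thesis by (simp add: add_increasing2)
    qed
    then have "(\<integral>x. D k x \<partial>M) \<le> (\<integral>x. ?c + (D k x)\<^sup>2 / ?c \<partial>M)"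
      using int2 by (intro integral_mono iD) (auto simp: D_def)
    also have "\<dots> = ?c * measure M (space M) + (\<integral>x. (D k x)\<^sup>2 \<partial>M) / ?c"
      using int2 by (subst Bochner_Integration.integral_add) (auto simp: D_def)
    also have "(\<integral>x. (D k x)\<^sup>2 \<partial>M) \<le> (1/4)^k"
      using N[of k "r (Suc k)" "r k"] rN[of k] rk(2)[of k] by (auto simp: D_def)
    then have "?c * measure M (space M) + (\<integral>x. (D k x)\<^sup>2 \<partial>M) / ?c \<le> ?c * measure M (space M) + (1/4)^k / ?c"
      by (intro add_left_mono divide_right_mono) auto
    also have "(1/4)^k / ?c = ?c" by (simp add: power_divide[symmetric])
    finally show ?thesis by (simp add: algebra_simps)
  qed
  have "(\<integral>\<^sup>+x. (\<Sum>k. ennreal (D k x)) \<partial>M) = (\<Sum>k. \<integral>\<^sup>+x. ennreal (D k x) \<partial>M)"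
    by (rule nn_integral_suminf) simp
  also have "\<dots> = (\<Sum>k. ennreal (\<integral>x. D k x \<partial>M))"
    by (intro suminf_cong nn_integral_eq_integral iD) (auto simp: D_def)
  also have "\<dots> \<le> (\<Sum>k. ennreal ((1/2)^k * (measure M (space M) + 1)))"
    by (intro suminf_le ennreal_leI D) auto
  also have "\<dots> < \<infinity>"
    by (subst suminf_ennreal2) (auto intro!: summable_mult2)
  finally have "AE x in M. (\<Sum>k. ennreal (D k x)) \<noteq> \<infinity>"
    by (intro nn_integral_PInf_AE) auto
  then have conv: "AE x in M. convergent (\<lambda>k. f (r k) x)"
  proof (rule eventually_mono)
    fix x assume "(\<Sum>k. ennreal (D k x)) \<noteq> \<infinity>"
    then have "summable (\<lambda>k. D k x)"
      by (intro summable_suminf_not_top) (auto simp: D_def)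
    then have "summable (\<lambda>k. f (r (Suc k)) x - f (r k) x)"
      unfolding D_def by (rule summable_rabs_cancel)
    then have "(\<lambda>n. \<Sum>k<n. f (r (Suc k)) x - f (r k) x) \<longlonglongrightarrow> (\<Sum>k. f (r (Suc k)) x - f (r k) x)"
      by (simp add: summable_LIMSEQ)
    then have "(\<lambda>n. f (r n) x - f (r 0) x) \<longlonglongrightarrow> (\<Sum>k. f (r (Suc k)) x - f (r k) x)"
      by (simp add: sum_lessThan_telescope[of "\<lambda>k. f (r k) x"])
    then have "(\<lambda>n. (f (r n) x - f (r 0) x) + f (r 0) x) \<longlonglongrightarrow> (\<Sum>k. f (r (Suc k)) x - f (r k) x) + f (r 0) x"
      by (intro tendsto_add tendsto_const)
    then show "convergent (\<lambda>k. f (r k) x)" by (auto simp: convergent_def)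
  qed
  define g where "g x = lim (\<lambda>k. f (r k) x)" for x
  have [measurable]: "g \<in> borel_measurable M" unfolding g_def by measurable
  have lim: "AE x in M. (\<lambda>k. f (r k) x) \<longlonglongrightarrow> g x"
    using conv by (auto simp: g_def convergent_LIMSEQ_iff elim!: eventually_mono)
  have fat: "(\<integral>\<^sup>+x. ennreal ((f n x - g x)\<^sup>2) \<partial>M) \<le> ennreal ((1/4)^k)" if "n \<ge> N k" for n k
  proof -
    have "(\<integral>\<^sup>+x. ennreal ((f n x - g x)\<^sup>2) \<partial>M) \<le> (\<integral>\<^sup>+x. liminf (\<lambda>j. ennreal ((f n x - f (r j) x)\<^sup>2)) \<partial>M)"
    proof (rule nn_integral_mono_AE, use lim in eventually_elim)
      fix x assume "(\<lambda>k. f (r k) x) \<longlonglongrightarrow> g x"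
      then have "(\<lambda>j. ennreal ((f n x - f (r j) x)\<^sup>2)) \<longlonglongrightarrow> ennreal ((f n x - g x)\<^sup>2)"
        by (intro tendsto_intros)
      from lim_imp_Liminf[OF sequentially_bot this]
      show "ennreal ((f n x - g x)\<^sup>2) \<le> liminf (\<lambda>j. ennreal ((f n x - f (r j) x)\<^sup>2))"
        by (simp only: order_refl)
    qed
    also have "\<dots> \<le> liminf (\<lambda>j. \<integral>\<^sup>+x. ennreal ((f n x - f (r j) x)\<^sup>2) \<partial>M)"
      by (rule nn_integral_liminf) simp
    also have "\<dots> \<le> ennreal ((1/4)^k)"
    proof (rule Liminf_le[OF _ eventually_sequentiallyI[of "r k"]])
      fix j assume "r k \<le> j"
      then have "N k \<le> r j" using rN[of k] rk(1)[of j] by linarith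
      then have "(\<integral>x. (f n x - f (r j) x)\<^sup>2 \<partial>M) < (1/4)^k" using N that by blast
      moreover have "(\<integral>\<^sup>+x. ennreal ((f n x - f (r j) x)\<^sup>2) \<partial>M) = ennreal (\<integral>x. (f n x - f (r j) x)\<^sup>2 \<partial>M)"
        using int2 by (intro nn_integral_eq_integral) auto
      ultimately show "(\<integral>\<^sup>+x. ennreal ((f n x - f (r j) x)\<^sup>2) \<partial>M) \<le> ennreal ((1/4)^k)"
        by (simp add: ennreal_leI)
    qed simp
    finally show ?thesis .
  qed
  have "(\<lambda>x. f (N 0) x - g x) \<in> L2 M"
    using fat[of 0 "N 0"] by (auto simp: L2_def integrable_iff_bounded intro: le_less_trans)
  then have g: "g \<in> L2 M" using L2_diff[OF assms(2)[of "N 0"]] by fastforce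
  have "(\<lambda>n. \<integral>\<^sup>+x. ennreal ((norm (f n x - g x))\<^sup>2) \<partial>M) \<longlonglongrightarrow> 0"
  proof (rule tendsto_0_if_Limsup_eq_0_ennreal)
    have "Limsup sequentially (\<lambda>n. \<integral>\<^sup>+x. ennreal ((norm (f n x - g x))\<^sup>2) \<partial>M) \<le> ennreal ((1/4)^k)" for k
      by (rule Limsup_bounded[OF eventually_sequentiallyI[of "N k"]]) (use fat in auto)
    moreover have "(\<lambda>k. ennreal ((1/4)^k)) \<longlonglongrightarrow> ennreal 0"
      by (intro tendsto_ennrealI LIMSEQ_power_zero) auto
    ultimately have "Limsup sequentially (\<lambda>n. \<integral>\<^sup>+x. ennreal ((norm (f n x - g x))\<^sup>2) \<partial>M) \<le> ennreal 0"
      by (intro LIMSEQ_le_const) auto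
    then show "Limsup sequentially (\<lambda>n. \<integral>\<^sup>+x. ennreal ((norm (f n x - g x))\<^sup>2) \<partial>M) = 0" by simp
  qed
  with assms(2) g show ?thesis by (auto simp: L2_tendsto_def)
qed

section \<open>Fourier transforms and normal densities\<close>

lemma integrable_norm_le_1:
  fixes f g :: "'a \<Rightarrow> 'b::{banach, second_countable_topology, real_normed_algebra}"
  assumes "integrable M f" "g \<in> borel_measurable M" "\<And>x. norm (g x) \<le> 1"
  shows "integrable M (\<lambda>x. f x * g x)"
proof (rule integrable_bound_pointwise[OF assms(1)])
  show "(\<lambda>x. f x * g x) \<in> borel_measurable M" using assms by simp
  show "norm (f x * g x) \<le> norm (f x)" for x
  proof -
    have "norm (f x * g x) \<le> norm (f x) * norm (g x)" by (rule norm_mult_ineq)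
    also have "\<dots> \<le> norm (f x) * 1" by (intro mult_left_mono assms) simp
    finally show ?thesis by simp
  qed
qed

section \<open>Vanishing integrals from vanishing Fourier transforms\<close>

definition weighted_law :: "'a measure \<Rightarrow> ('a \<Rightarrow> real) \<Rightarrow> ('a \<Rightarrow> real) \<Rightarrow> real measure" where
  "weighted_law M p X = distr (density M (\<lambda>x. ennreal (p x))) borel X"

context
  fixes M :: "'a measure" and p X :: "'a \<Rightarrow> real"
  assumes p: "integrable M p" "\<And>x. 0 \<le> p x" "(\<integral>x. p x \<partial>M) = 1" and X [measurable]: "X \<in> borel_measurable M"
begin

lemma weight_measurable [measurable]: "p \<in> borel_measurable M"
  using p(1) by simp

lemma real_distribution_weighted_law: "real_distribution (weighted_law M p X)"
proof -
  have "emeasure (density M (\<lambda>x. ennreal (p x))) (space M) = (\<integral>\<^sup>+x. ennreal (p x) \<partial>M)"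
    by (subst emeasure_density) (auto intro!: nn_integral_cong)
  also have "\<dots> = 1" using nn_integral_eq_integral[OF p(1)] p(2,3) by simp
  finally have "prob_space (density M (\<lambda>x. ennreal (p x)))"
    by (intro prob_spaceI) simp
  then have "prob_space (weighted_law M p X)"
    unfolding weighted_law_def by (rule prob_space.prob_space_distr) simp
  then show ?thesis
    by (simp add: real_distribution_def real_distribution_axioms_def weighted_law_def)
qed

lemma char_weighted_law: "char (weighted_law M p X) u = (\<integral>x. complex_of_real (p x) * iexp (u * X x) \<partial>M)"
  unfolding char_def weighted_law_def using p(2)
  by (subst integral_distr) (auto simp: integral_density scaleR_conv_of_real)

lemma measure_weighted_law:
  assumes [measurable]: "B \<in> sets borel"
  shows "measure (weighted_law M p X) B = (\<integral>x. p x * indicator B (X x) \<partial>M)"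
proof -
  interpret real_distribution "weighted_law M p X" by (rule real_distribution_weighted_law)
  have "measure (weighted_law M p X) B = (\<integral>x. indicator B x \<partial>weighted_law M p X)"
    by (simp add: weighted_law_def)
  also have "\<dots> = (\<integral>x. p x * indicator B (X x) \<partial>M)"
    unfolding weighted_law_def using p(2) by (subst integral_distr) (auto simp: integral_density)
  finally show ?thesis .
qed

end

text \<open>Levy uniqueness concerns probability laws, so the signed weight \<open>D\<close> is
  split into its positive and negative part. At \<open>u = 0\<close> the hypothesis says that both
  have the same mass \<open>m\<close>; dividing by it makes them densities under which
  \<open>X\<close> has the same characteristic function, hence the same law.\<close>

lemma integral_indicator_eq_0_of_char:
  fixes D X :: "'a \<Rightarrow> real"
  assumes D: "integrable M D" and X [measurable]: "X \<in> borel_measurable M"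
    and char: "\<And>u. (\<integral>x. complex_of_real (D x) * iexp (u * X x) \<partial>M) = 0"
    and B [measurable]: "B \<in> sets borel"
  shows "(\<integral>x. D x * indicator B (X x) \<partial>M) = 0"
proof -
  have [measurable]: "D \<in> borel_measurable M" using D by simp
  define P where "P x = max 0 (D x)" for x
  define N where "N x = max 0 (- D x)" for x
  have iP: "integrable M P" and iN: "integrable M N"
    using D by (auto simp: P_def[abs_def] N_def[abs_def])
  note [measurable] = borel_measurable_integrable[OF iP] borel_measurable_integrable[OF iN]
  have DPN: "D x = P x - N x" for x by (auto simp: P_def N_def)
  have nn: "0 \<le> P x" "0 \<le> N x" for x by (auto simp: P_def N_def)
  have iE: "integrable M (\<lambda>x. complex_of_real (P x) * iexp (u * X x))"
    "integrable M (\<lambda>x. complex_of_real (N x) * iexp (u * X x))" for u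
    using iP iN by (auto intro!: integrable_norm_le_1)
  have charPN: "(\<integral>x. complex_of_real (P x) * iexp (u * X x) \<partial>M) = (\<integral>x. complex_of_real (N x) * iexp (u * X x) \<partial>M)" for u
    using char[of u] iE[of u] by (simp add: DPN left_diff_distrib)
  define m where "m = (\<integral>x. P x \<partial>M)"
  have "complex_of_real m = complex_of_real (\<integral>x. N x \<partial>M)"
    unfolding m_def using charPN[of 0] by simp
  then have mN: "m = (\<integral>x. N x \<partial>M)" by (simp only: of_real_eq_iff)
  have iI: "integrable M (\<lambda>x. P x * indicator B (X x))" "integrable M (\<lambda>x. N x * indicator B (X x))"
    using iP iN by (auto intro!: integrable_norm_le_1 simp: indicator_def)
  have "(\<integral>x. P x * indicator B (X x) \<partial>M) = (\<integral>x. N x * indicator B (X x) \<partial>M)"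
  \<comment> \<open>Mass zero cannot be normalized, but then both parts vanish almost
    everywhere.\<close>
  proof (cases "m = 0")
    case True
    have "AE x in M. P x = 0" "AE x in M. N x = 0"
      using True mN m_def integral_nonneg_eq_0_iff_AE[OF iP] integral_nonneg_eq_0_iff_AE[OF iN] nn by auto
    then have "AE x in M. P x * indicator B (X x) = N x * indicator B (X x)" by auto
    then show ?thesis by (intro integral_cong_AE) auto
  next
    case False
    moreover have "0 \<le> m" unfolding m_def using nn by simp
    ultimately have m: "0 < m" by simp
    let ?P = "\<lambda>x. P x / m" and ?N = "\<lambda>x. N x / m"
    have hP: "integrable M ?P" "\<And>x. 0 \<le> ?P x" "(\<integral>x. ?P x \<partial>M) = 1"
      using iP nn m by (auto simp: m_def)
    have hN: "integrable M ?N" "\<And>x. 0 \<le> ?N x" "(\<integral>x. ?N x \<partial>M) = 1"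
      using iN nn m by (auto simp: mN)
    have "char (weighted_law M ?P X) u = char (weighted_law M ?N X) u" for u
    proof -
      have "(\<integral>x. complex_of_real (P x / m) * iexp (u * X x) \<partial>M) = (\<integral>x. complex_of_real (P x) * iexp (u * X x) \<partial>M) / m"
        by (simp flip: integral_divide_zero)
      also have "\<dots> = (\<integral>x. complex_of_real (N x) * iexp (u * X x) \<partial>M) / m" by (simp only: charPN)
      also have "\<dots> = (\<integral>x. complex_of_real (N x / m) * iexp (u * X x) \<partial>M)"
        by (simp flip: integral_divide_zero)
      finally show ?thesis by (simp only: char_weighted_law[OF hP X] char_weighted_law[OF hN X])
    qed
    then have "weighted_law M ?P X = weighted_law M ?N X"
      by (intro Levy_uniqueness real_distribution_weighted_law hP hN X) auto
    then have "(\<integral>x. ?P x * indicator B (X x) \<partial>M) = (\<integral>x. ?N x * indicator B (X x) \<partial>M)"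
      by (simp only: measure_weighted_law[OF hP X B, symmetric] measure_weighted_law[OF hN X B, symmetric])
    then show ?thesis using m by auto
  qed
  then show ?thesis using iI by (simp add: DPN left_diff_distrib)
qed

text \<open>Reduction to the real weights \<open>Re (z * D)\<close>. Their transforms involve that
  of \<open>cnj D\<close>, which vanishes as well, being the conjugate of the transform of
  \<open>D\<close> at \<open>- u\<close>. The choices \<open>z = 1\<close> and
  \<open>z = - \<i>\<close> then give real and imaginary part.\<close>

lemma integral_indicator_eq_0_of_char_complex:
  fixes D :: "'a \<Rightarrow> complex" and X :: "'a \<Rightarrow> real"
  assumes D: "integrable M D" and X [measurable]: "X \<in> borel_measurable M"
    and char: "\<And>u. (\<integral>x. D x * iexp (u * X x) \<partial>M) = 0"
    and B [measurable]: "B \<in> sets borel"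
  shows "(\<integral>x. D x * indicator B (X x) \<partial>M) = 0"
proof -
  have [measurable]: "D \<in> borel_measurable M" using D by simp
  have i: "integrable M (\<lambda>x. D x * iexp (u * X x))" for u
    using D by (auto intro!: integrable_norm_le_1)
  have i': "integrable M (\<lambda>x. cnj (D x) * iexp (u * X x))" for u
    using D by (auto intro!: integrable_norm_le_1)
  have c: "(\<integral>x. cnj (D x) * iexp (u * X x) \<partial>M) = 0" for u
  proof -
    have "(\<integral>x. cnj (D x) * iexp (u * X x) \<partial>M) = (\<integral>x. cnj (D x * iexp (- u * X x)) \<partial>M)"
      by (intro Bochner_Integration.integral_cong) (auto simp: exp_cnj)
    also have "\<dots> = cnj (\<integral>x. D x * iexp (- u * X x) \<partial>M)" by (rule Bochner_Integration.integral_cnj)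
    finally show ?thesis by (simp only: char complex_cnj_zero)
  qed
  have R: "(\<integral>x. Re (z * D x) * indicator B (X x) \<partial>M) = 0" for z
  proof (rule integral_indicator_eq_0_of_char)
    fix u
    have "(\<integral>x. complex_of_real (Re (z * D x)) * iexp (u * X x) \<partial>M) =
       (\<integral>x. (z * (D x * iexp (u * X x)) + cnj z * (cnj (D x) * iexp (u * X x))) / 2 \<partial>M)"
    proof (rule Bochner_Integration.integral_cong[OF refl])
      have "complex_of_real (Re y) * w = (y * w + cnj y * w) / 2" for y w
        by (simp only: distrib_right[symmetric] complex_add_cnj) simp
      from this[of "z * D x" "iexp (u * X x)" for x]
      show "complex_of_real (Re (z * D x)) * iexp (u * X x) =
          (z * (D x * iexp (u * X x)) + cnj z * (cnj (D x) * iexp (u * X x))) / 2" for x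
        by (simp only: complex_cnj_mult mult.assoc)
    qed
    also have "\<dots> = 0" using i[of u] i'[of u] char[of u] c[of u] by simp
    finally show "(\<integral>x. complex_of_real (Re (z * D x)) * iexp (u * X x) \<partial>M) = 0" .
  qed (use D in auto)
  have j: "integrable M (\<lambda>x. D x * indicator B (X x))"
    using D by (auto intro!: integrable_norm_le_1 simp: indicator_def)
  have "Re (\<integral>x. D x * indicator B (X x) \<partial>M) = (\<integral>x. Re (D x) * indicator B (X x) \<partial>M)"
    unfolding integral_Re[OF j, symmetric]
    by (intro Bochner_Integration.integral_cong) (auto simp: indicator_def)
  moreover have "Im (\<integral>x. D x * indicator B (X x) \<partial>M) = (\<integral>x. Im (D x) * indicator B (X x) \<partial>M)"
    unfolding integral_Im[OF j, symmetric]
    by (intro Bochner_Integration.integral_cong) (auto simp: indicator_def)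
  ultimately show ?thesis using R[of 1] R[of "- \<i>"] by (simp add: complex_eq_iff)
qed

section \<open>From single random variables to the sigma-algebra of a linear family\<close>

definition generated_sets :: "'a measure \<Rightarrow> ('a \<Rightarrow> real) set \<Rightarrow> 'a set set" where
  "generated_sets M \<V> = sigma_sets (space M)
     ({V -` B \<inter> space M | V B. V \<in> \<V> \<and> B \<in> sets borel} \<union> null_sets M)"

lemma generated_sets_subset:
  assumes "\<V> \<subseteq> borel_measurable M"
  shows "generated_sets M \<V> \<subseteq> sets M"
  unfolding generated_sets_def using assms
  by (intro sets.sigma_sets_subset) (auto intro: measurable_sets)

text \<open>In the spirit of Cramer-Wold: exponentials of linear combinations of finitely many
  members of \<open>\<V>\<close> are converted into indicators, one variable at a time. The
  resulting cylinder sets, together with the null sets, form an intersection-stable generator, and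
  Dynkin's theorem does the rest. Closure under combinations is asked only almost everywhere, since
  the noise offers no more.\<close>

lemma integral_indicator_eq_0_of_generated:
  fixes D :: "'a \<Rightarrow> real"
  assumes D: "integrable M D" and meas: "\<V> \<subseteq> borel_measurable M" and ne: "\<V> \<noteq> {}"
    and lin: "\<And>V W u. V \<in> \<V> \<Longrightarrow> W \<in> \<V> \<Longrightarrow> \<exists>U\<in>\<V>. AE x in M. U x = V x + u * W x"
    and char: "\<And>V. V \<in> \<V> \<Longrightarrow> (\<integral>x. complex_of_real (D x) * iexp (V x) \<partial>M) = 0"
    and E: "E \<in> generated_sets M \<V>"
  shows "(\<integral>x. D x * indicator E x \<partial>M) = 0"
proof -
  have [measurable]: "D \<in> borel_measurable M" using D by simp
  have [measurable]: "V \<in> \<V> \<Longrightarrow> V \<in> borel_measurable M" for V using meas by auto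
  define A where "A ps = {x \<in> space M. \<forall>(V, B)\<in>set ps. V x \<in> B}" for ps :: "(('a \<Rightarrow> real) \<times> real set) list"
  define ok where "ok ps \<longleftrightarrow> (\<forall>(V, B)\<in>set ps. V \<in> \<V> \<and> B \<in> sets borel)" for ps :: "(('a \<Rightarrow> real) \<times> real set) list"
  have A_Cons: "A ((V, B) # ps) = (V -` B \<inter> space M) \<inter> A ps" for V B ps
    by (auto simp: A_def)
  have A_sets [measurable]: "A ps \<in> sets M" if "ok ps" for ps
    using that
  proof (induction ps)
    case Nil then show ?case by (simp add: A_def)
  next
    case (Cons p ps)
    obtain V B where p: "p = (V, B)" by (cases p)
    have "V -` B \<inter> space M \<in> sets M" using Cons(2) by (auto simp: p ok_def intro: measurable_sets)
    then show ?case using Cons by (simp add: p A_Cons ok_def)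
  qed
  \<comment> \<open>The factor \<open>iexp (W x)\<close> makes the induction run: the frequency
    \<open>u * V\<close> of the variable being converted merges with \<open>W\<close> into another
    member of \<open>\<V>\<close>, to which the hypothesis for the shorter list applies.\<close>
  have step: "(\<integral>x. complex_of_real (D x) * indicator (A ps) x * iexp (W x) \<partial>M) = 0" if "ok ps" "W \<in> \<V>" for ps W
    using that
  proof (induction ps arbitrary: W)
    case Nil
    have "(\<integral>x. complex_of_real (D x) * indicator (A []) x * iexp (W x) \<partial>M) = (\<integral>x. complex_of_real (D x) * iexp (W x) \<partial>M)"
      by (intro Bochner_Integration.integral_cong) (auto simp: A_def)
    then show ?case using char Nil by simp
  next
    case (Cons p ps)
    obtain V B where p: "p = (V, B)" by (cases p)
    have VB [measurable]: "V \<in> \<V>" "B \<in> sets borel" and ok: "ok ps" using Cons(2) by (auto simp: p ok_def)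
    note [measurable] = A_sets[OF ok] Cons(3)
    have "(\<integral>x. (complex_of_real (D x) * indicator (A ps) x * iexp (W x)) * indicator B (V x) \<partial>M) = 0"
    proof (rule integral_indicator_eq_0_of_char_complex)
      show "integrable M (\<lambda>x. complex_of_real (D x) * indicator (A ps) x * iexp (W x))"
        using D by (intro integrable_norm_le_1) (auto simp: indicator_def)
      fix u
      obtain U where U: "U \<in> \<V>" "AE x in M. U x = W x + u * V x" using lin[OF Cons(3) VB(1)] by blast
      note [measurable] = U(1)
      have "(\<integral>x. complex_of_real (D x) * indicator (A ps) x * iexp (W x) * iexp (u * V x) \<partial>M) =
        (\<integral>x. complex_of_real (D x) * indicator (A ps) x * iexp (U x) \<partial>M)"
      proof (rule integral_cong_AE)
        show "AE x in M. complex_of_real (D x) * indicator (A ps) x * iexp (W x) * iexp (u * V x) =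
           complex_of_real (D x) * indicator (A ps) x * iexp (U x)"
          using U(2) by eventually_elim (auto simp: exp_add distrib_left)
      qed measurable
      then show "(\<integral>x. complex_of_real (D x) * indicator (A ps) x * iexp (W x) * iexp (u * V x) \<partial>M) = 0"
        using Cons.IH[OF ok U(1)] by simp
    qed (use VB in auto)
    also have "(\<integral>x. (complex_of_real (D x) * indicator (A ps) x * iexp (W x)) * indicator B (V x) \<partial>M) =
       (\<integral>x. complex_of_real (D x) * indicator (A (p # ps)) x * iexp (W x) \<partial>M)"
      by (intro Bochner_Integration.integral_cong) (auto simp: p A_Cons indicator_def)
    finally show ?case .
  qed
  have zero: "(\<integral>x. D x * indicator (A ps) x \<partial>M) = 0" if ok: "ok ps" for ps
  proof -
    obtain W where W: "W \<in> \<V>" using ne by auto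
    \<comment> \<open>A member that is almost surely zero turns the remaining exponential into
      \<open>1\<close>.\<close>
    obtain U where U: "U \<in> \<V>" "AE x in M. U x = W x + (-1) * W x" using lin[OF W W] by blast
    note [measurable] = A_sets[OF ok] U(1)
    have "complex_of_real (\<integral>x. D x * indicator (A ps) x \<partial>M) = (\<integral>x. complex_of_real (D x * indicator (A ps) x) \<partial>M)"
      by (simp only: integral_complex_of_real)
    also have "\<dots> = (\<integral>x. complex_of_real (D x) * indicator (A ps) x * iexp (U x) \<partial>M)"
    proof (rule integral_cong_AE)
      show "AE x in M. complex_of_real (D x * indicator (A ps) x) = complex_of_real (D x) * indicator (A ps) x * iexp (U x)"
        using U(2) by eventually_elim (auto simp: indicator_def)
    qed measurable
    also have "\<dots> = 0" by (rule step[OF ok U(1)])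
    finally show ?thesis by simp
  qed
  define G where "G = {A ps | ps. ok ps} \<union> null_sets M"
  have Gsub: "G \<subseteq> Pow (space M)" "G \<subseteq> sets M" using A_sets sets.sets_into_space by (auto simp: G_def A_def)
  have AA: "A ps \<inter> A qs = A (ps @ qs)" for ps qs by (auto simp: A_def)
  have okapp: "ok ps \<Longrightarrow> ok qs \<Longrightarrow> ok (ps @ qs)" for ps qs by (auto simp: ok_def)
  have Gint: "Int_stable G"
  proof (rule Int_stableI)
    fix a b assume ab: "a \<in> G" "b \<in> G"
    show "a \<inter> b \<in> G"
    proof (cases "a \<in> null_sets M \<or> b \<in> null_sets M")
      case True
      moreover have "a \<in> sets M" "b \<in> sets M" using ab Gsub(2) by auto
      ultimately have "a \<inter> b \<in> null_sets M" by (auto intro: null_set_Int1 null_set_Int2)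
      then show ?thesis by (simp add: G_def)
    next
      case False
      then obtain ps qs where "a = A ps" "ok ps" "b = A qs" "ok qs" using ab by (auto simp: G_def)
      then show ?thesis using AA okapp by (auto simp: G_def)
    qed
  qed
  have "generated_sets M \<V> \<subseteq> sigma_sets (space M) G"
    unfolding generated_sets_def
  proof (rule sigma_sets_mono, safe)
    fix V B assume VB: "V \<in> \<V>" "B \<in> sets (borel :: real measure)"
    then have "ok [(V, B)]" "V -` B \<inter> space M = A [(V, B)]" by (auto simp: ok_def A_def)
    then show "V -` B \<inter> space M \<in> sigma_sets (space M) G" by (auto simp: G_def intro!: sigma_sets.Basic)
  next
    fix E assume "E \<in> null_sets M" then show "E \<in> sigma_sets (space M) G" by (auto simp: G_def)
  qed
  with E have E': "E \<in> sigma_sets (space M) G" by auto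
  have sigG: "sigma_sets (space M) G \<subseteq> sets M" by (rule sets.sigma_sets_subset[OF Gsub(2)])
  have iD: "integrable M (\<lambda>x. D x * indicator E x)" if "E \<in> sets M" for E
    using D that by (auto intro!: integrable_norm_le_1 simp: indicator_def)
  from Gint Gsub(1) E' show ?thesis
  proof (induction rule: sigma_sets_induct_disjoint)
    case (basic a)
    show ?case
    proof (cases "a \<in> null_sets M")
      case True
      then have "AE x in M. x \<notin> a" by (rule AE_not_in)
      then have "AE x in M. D x * indicator a x = 0" by eventually_elim simp
      then show ?thesis by (rule integral_eq_zero_AE)
    next
      case False
      then show ?thesis using basic zero by (auto simp: G_def)
    qed
  next
    case empty show ?case by simp
  next
    case (compl a)
    then have a: "a \<in> sets M" using sigG by auto
    have "(\<integral>x. D x * indicator (space M - a) x \<partial>M) = (\<integral>x. D x - D x * indicator a x \<partial>M)"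
      by (intro Bochner_Integration.integral_cong) (auto simp: indicator_def)
    also have "\<dots> = (\<integral>x. D x \<partial>M)" using D iD[OF a] compl by simp
    \<comment> \<open>The whole space is the cylinder without conditions, so the total integral is
      covered by the same argument.\<close>
    also have "\<dots> = (\<integral>x. D x * indicator (A []) x \<partial>M)"
      by (intro Bochner_Integration.integral_cong) (auto simp: A_def)
    also have "\<dots> = 0" by (rule zero) (simp add: ok_def)
    finally show ?case .
  next
    case (union a)
    have sa: "a i \<in> sets M" for i using union(2) sigG by auto
    have "(LINT x:(\<Union>i. a i)|M. D x) = (\<Sum>i. (LINT x:(a i)|M. D x))"
    proof (rule lebesgue_integral_countable_add)
      show "set_integrable M (\<Union>i. a i) D"
        using iD[of "\<Union>i. a i"] sa by (auto simp: set_integrable_def mult.commute)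
    qed (use sa union(1) in \<open>auto simp: disjoint_family_on_def\<close>)
    then show ?case using union(3) by (simp add: set_lebesgue_integral_def mult.commute)
  qed
qed

section \<open>The normal density against functions of polynomial growth\<close>

lemma has_derivative_normal_density:
  assumes "0 < \<sigma>"
  shows "(normal_density 0 \<sigma> has_real_derivative (- x / \<sigma>\<^sup>2 * normal_density 0 \<sigma> x)) (at x)"
  unfolding normal_density_def[abs_def] using assms
  by (auto intro!: derivative_eq_intros simp: field_simps power2_eq_square)

lemma integrable_normal_density_poly:
  assumes \<sigma>: "0 < \<sigma>" and g [measurable]: "g \<in> borel_measurable borel"
    and b: "\<And>n. \<bar>g n\<bar> \<le> C * (1 + \<bar>n\<bar>) ^ k"
  shows "integrable lborel (\<lambda>n. normal_density 0 \<sigma> n * g n)"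
proof -
  have "integrable lborel (\<lambda>n. C * 2 ^ k * (normal_density 0 \<sigma> n * \<bar>n - 0\<bar> ^ 0 + normal_density 0 \<sigma> n * \<bar>n - 0\<bar> ^ k))"
    by (intro integrable_mult_right Bochner_Integration.integrable_add integrable_normal_moment_abs \<sigma>)
  then show ?thesis
  proof (rule integrable_bound_pointwise)
    have C: "0 \<le> C" using b[of 0] by simp
    show "norm (normal_density 0 \<sigma> n * g n) \<le> norm (C * 2 ^ k * (normal_density 0 \<sigma> n * \<bar>n - 0\<bar> ^ 0 + normal_density 0 \<sigma> n * \<bar>n - 0\<bar> ^ k))" for n
    proof -
      have "(1 + \<bar>n\<bar>) ^ k \<le> (2 * max 1 \<bar>n\<bar>) ^ k" by (intro power_mono) auto
      also have "\<dots> = 2 ^ k * max 1 \<bar>n\<bar> ^ k" by (simp add: power_mult_distrib)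
      also have "\<dots> \<le> 2 ^ k * (1 + \<bar>n\<bar> ^ k)" by (intro mult_left_mono) (auto simp: max_def)
      finally have "C * (1 + \<bar>n\<bar>) ^ k \<le> C * (2 ^ k * (1 + \<bar>n\<bar> ^ k))" using C by (intro mult_left_mono)
      with b[of n] have "\<bar>g n\<bar> \<le> C * 2 ^ k * (1 + \<bar>n\<bar> ^ k)" by simp
      then have "normal_density 0 \<sigma> n * \<bar>g n\<bar> \<le> normal_density 0 \<sigma> n * (C * 2 ^ k * (1 + \<bar>n\<bar> ^ k))"
        by (intro mult_left_mono) auto
      then show ?thesis using C by (simp add: abs_mult algebra_simps)
    qed
  qed simp
qed


lemma normal_density_poly_tendsto_0:
  assumes \<sigma>: "0 < \<sigma>" and b: "\<And>n. \<bar>g n\<bar> \<le> C * (1 + \<bar>n\<bar>) ^ k"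
  shows "((\<lambda>n. normal_density 0 \<sigma> n * g n) \<longlongrightarrow> 0) at_infinity"
proof -
  have C: "0 \<le> C" using b[of 0] by simp
  \<comment> \<open>Completing the square gives \<open>n\<^sup>2 / (2 * \<sigma>\<^sup>2) \<ge>
    \<bar>n\<bar> - \<sigma>\<^sup>2 / 2\<close>, which compares the Gaussian with
    \<open>exp (- \<bar>n\<bar>)\<close> at the price of the factor
    \<open>exp (\<sigma>\<^sup>2 / 2)\<close>. The power \<open>2 ^ k\<close> comes from
    \<open>1 + \<bar>n\<bar> \<le> 2 * \<bar>n\<bar>\<close>, valid once
    \<open>\<bar>n\<bar> \<ge> 1\<close>.\<close>
  let ?c = "1 / sqrt (2 * pi * \<sigma>\<^sup>2) * exp (\<sigma>\<^sup>2 / 2) * C * 2 ^ k"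
  have "filterlim (\<lambda>n::real. norm n) at_top at_infinity"
    by (rule filterlim_norm_at_top)
  from filterlim_compose[OF tendsto_power_div_exp_0 this]
  have "((\<lambda>n::real. ?c * (\<bar>n\<bar> ^ k / exp \<bar>n\<bar>)) \<longlongrightarrow> ?c * 0) at_infinity"
    by (intro tendsto_mult tendsto_const) (simp add: o_def)
  then have lim: "((\<lambda>n::real. ?c * (\<bar>n\<bar> ^ k / exp \<bar>n\<bar>)) \<longlongrightarrow> 0) at_infinity" by simp
  have le: "norm (normal_density 0 \<sigma> n * g n) \<le> ?c * (\<bar>n\<bar> ^ k / exp \<bar>n\<bar>)" if "1 \<le> norm n" for n :: real
  proof -
    have "0 \<le> (\<bar>n\<bar> - \<sigma>\<^sup>2)\<^sup>2 / (2 * \<sigma>\<^sup>2)" by simp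
    also have "(\<bar>n\<bar> - \<sigma>\<^sup>2)\<^sup>2 / (2 * \<sigma>\<^sup>2) = n\<^sup>2 / (2 * \<sigma>\<^sup>2) - \<bar>n\<bar> + \<sigma>\<^sup>2 / 2"
      using \<sigma> by (simp add: power2_diff field_simps power2_eq_square)
    finally have "exp (- (n\<^sup>2 / (2 * \<sigma>\<^sup>2))) \<le> exp (\<sigma>\<^sup>2 / 2) * (1 / exp \<bar>n\<bar>)"
      by (simp flip: exp_minus exp_add add: inverse_eq_divide[symmetric])
    then have 1: "normal_density 0 \<sigma> n \<le> 1 / sqrt (2 * pi * \<sigma>\<^sup>2) * (exp (\<sigma>\<^sup>2 / 2) * (1 / exp \<bar>n\<bar>))"
      unfolding normal_density_def by (intro mult_left_mono) auto
    have "(1 + \<bar>n\<bar>) ^ k \<le> (2 * \<bar>n\<bar>) ^ k" using that by (intro power_mono) auto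
    then have "C * (1 + \<bar>n\<bar>) ^ k \<le> C * (2 * \<bar>n\<bar>) ^ k" using C by (intro mult_left_mono)
    then have 2: "\<bar>g n\<bar> \<le> C * (2 ^ k * \<bar>n\<bar> ^ k)" using b[of n] by (simp add: power_mult_distrib)
    have "norm (normal_density 0 \<sigma> n * g n) = normal_density 0 \<sigma> n * \<bar>g n\<bar>" by (simp add: abs_mult)
    also have "\<dots> \<le> (1 / sqrt (2 * pi * \<sigma>\<^sup>2) * (exp (\<sigma>\<^sup>2 / 2) * (1 / exp \<bar>n\<bar>))) * (C * (2 ^ k * \<bar>n\<bar> ^ k))"
      by (rule mult_mono[OF 1 2]) (auto intro!: mult_nonneg_nonneg)
    finally show ?thesis by (simp add: field_simps)
  qed
  have ev: "eventually (\<lambda>n::real. 1 \<le> norm n) at_infinity" by (auto simp: eventually_at_infinity)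
  show ?thesis
    by (rule Lim_null_comparison[OF eventually_mono[OF ev le] lim])
qed

text \<open>The density \<open>p\<close> satisfies
  \<open>p' n = - n / \<sigma>\<^sup>2 * p n\<close>, so the derivative of \<open>p * g\<close> is
  the right integrand minus \<open>1 / \<sigma>\<^sup>2\<close> times the left one. Its integral is
  zero because \<open>p * g\<close> vanishes at both ends; polynomial growth secures this as well as
  separate integrability.\<close>

lemma Stein_normal_density:
  assumes \<sigma>: "0 < \<sigma>" and g: "\<And>n. (g has_real_derivative g' n) (at n)" and g': "continuous_on UNIV g'"
    and b: "\<And>n. \<bar>g n\<bar> \<le> C * (1 + \<bar>n\<bar>) ^ k" "\<And>n. \<bar>g' n\<bar> \<le> C' * (1 + \<bar>n\<bar>) ^ k'"
  shows "(\<integral>n. normal_density 0 \<sigma> n * (g n * n) \<partial>lborel) = \<sigma>\<^sup>2 * (\<integral>n. normal_density 0 \<sigma> n * g' n \<partial>lborel)"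
proof -
  have cg: "continuous_on UNIV g"
    using g by (intro continuous_at_imp_continuous_on) (auto intro: DERIV_isCont)
  have [measurable]: "g \<in> borel_measurable borel" "g' \<in> borel_measurable borel"
    using cg g' by (auto intro: borel_measurable_continuous_onI)
  have C: "0 \<le> C" using b(1)[of 0] by simp
  have i1: "integrable lborel (\<lambda>n. normal_density 0 \<sigma> n * (g n * n))"
  proof (rule integrable_normal_density_poly[OF \<sigma>])
    show "\<bar>g n * n\<bar> \<le> C * (1 + \<bar>n\<bar>) ^ Suc k" for n
    proof -
      have "\<bar>g n * n\<bar> \<le> (C * (1 + \<bar>n\<bar>) ^ k) * (1 + \<bar>n\<bar>)"
        unfolding abs_mult by (rule mult_mono[OF b(1)]) (use C in auto)
      then show ?thesis by (simp add: algebra_simps)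
    qed
  qed measurable
  have i2: "integrable lborel (\<lambda>n. normal_density 0 \<sigma> n * g' n)"
    by (rule integrable_normal_density_poly[OF \<sigma> _ b(2)]) measurable
  let ?h = "\<lambda>n. normal_density 0 \<sigma> n * g n"
  let ?h' = "\<lambda>n. normal_density 0 \<sigma> n * g' n - 1 / \<sigma>\<^sup>2 * (normal_density 0 \<sigma> n * (g n * n))"
  have lim: "(?h \<longlongrightarrow> 0) at_top" "(?h \<longlongrightarrow> 0) at_bot"
    using normal_density_poly_tendsto_0[OF \<sigma> b(1)] at_top_le_at_infinity at_bot_le_at_infinity
    by (auto intro: tendsto_mono)
  have cn: "continuous_on UNIV (normal_density 0 \<sigma>)"
    using has_derivative_normal_density[OF \<sigma>] by (intro continuous_at_imp_continuous_on) (auto intro: DERIV_isCont)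
  have ih': "integrable lborel ?h'"
    using i1 i2 by (intro Bochner_Integration.integrable_diff integrable_mult_right)
  have "(LBINT n=-\<infinity>..\<infinity>. ?h' n) = 0 - 0"
  proof (rule interval_integral_FTC_integrable[where F="?h"])
    fix n :: real
    have "(?h has_real_derivative ?h' n) (at n)"
      using \<sigma> by (auto intro!: derivative_eq_intros has_derivative_normal_density g simp: field_simps)
    then show "(?h has_vector_derivative ?h' n) (at n)" by (simp add: has_real_derivative_iff_has_vector_derivative)
    have "continuous_on UNIV ?h'" by (intro continuous_intros cn cg g')
    then show "isCont ?h' n" by (simp add: continuous_on_eq_continuous_at)
  next
    show "set_integrable lborel (einterval (-\<infinity>) \<infinity>) ?h'" using ih' by (simp add: set_integrable_def)
    show "((?h \<circ> real_of_ereal) \<longlongrightarrow> 0) (at_right (-\<infinity>))" "((?h \<circ> real_of_ereal) \<longlongrightarrow> 0) (at_left \<infinity>)"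
      using lim by (simp_all add: ereal_tendsto_simps)
  qed simp
  then have "(\<integral>n. ?h' n \<partial>lborel) = 0"
    by (simp add: interval_lebesgue_integral_def set_lebesgue_integral_def)
  then have "(\<integral>n. normal_density 0 \<sigma> n * g' n \<partial>lborel) = 1 / \<sigma>\<^sup>2 * (\<integral>n. normal_density 0 \<sigma> n * (g n * n) \<partial>lborel)"
    by (subst (asm) Bochner_Integration.integral_diff[OF i2 integrable_mult_right[OF i1]]) simp
  then show ?thesis using \<sigma> by simp
qed

text \<open>The chain rule for a function known only through its partial derivatives, on a space
  with a product topology and no norm. Coordinates are moved one at a time; the mean value theorem
  turns each move into a partial derivative at a nearby point, and continuity of that derivative
  identifies the limit.\<close>

lemma DERIV_along_line:
  fixes f :: "(nat \<Rightarrow> real) \<Rightarrow> real"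
  assumes dep: "\<And>x y. (\<And>i. i < m \<Longrightarrow> x i = y i) \<Longrightarrow> f x = f y"
    and diff: "\<And>i x. i < m \<Longrightarrow> (\<lambda>r. f (x(i := r))) differentiable (at (x i))"
    and cont: "\<And>i. i < m \<Longrightarrow> continuous_on UNIV (coord_deriv i f)"
  shows "((\<lambda>s. f (\<lambda>i. y i + \<alpha> i * s)) has_real_derivative (\<Sum>i<m. \<alpha> i * coord_deriv i f (\<lambda>i. y i + \<alpha> i * r))) (at r)"
proof -
  define p where "p = (\<lambda>i. y i + \<alpha> i * r)"
  \<comment> \<open>\<open>X n s\<close> has moved the first \<open>n\<close> coordinates and keeps
    the others at \<open>p\<close>; all these curves pass through \<open>p\<close> at
    \<open>s = r\<close>, so the increments in \<open>n\<close> can be differentiated there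
    separately.\<close>
  define X where "X n s = (\<lambda>i. if i < n then y i + \<alpha> i * s else p i)" for n s
  have "((\<lambda>s. f (X n s)) has_real_derivative (\<Sum>i<n. \<alpha> i * coord_deriv i f p)) (at r)" if "n \<le> m" for n
    using that
  proof (induction n)
    case 0 then show ?case by (simp add: X_def)
  next
    case (Suc n)
    then have n: "n < m" by simp
    have upd: "X (Suc n) s = (X n s)(n := p n + \<alpha> n * (s - r))" for s
      by (auto simp: X_def p_def algebra_simps less_Suc_eq)
    have Xn: "X n s n = p n" for s by (simp add: X_def)
    have d: "((\<lambda>u. f (x(n := u))) has_real_derivative coord_deriv n f (x(n := u))) (at u)" for x u
      using diff[OF n, of "x(n := u)"] by (simp add: coord_deriv_def DERIV_deriv_iff_real_differentiable)
    have "\<exists>u. \<bar>u - p n\<bar> \<le> \<bar>\<alpha> n\<bar> * \<bar>s - r\<bar> \<and>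
        f (X (Suc n) s) - f (X n s) = (\<alpha> n * (s - r)) * coord_deriv n f ((X n s)(n := u))" for s
    proof -
      define b where "b = p n + \<alpha> n * (s - r)"
      have bp: "\<bar>b - p n\<bar> = \<bar>\<alpha> n\<bar> * \<bar>s - r\<bar>" "b - p n = \<alpha> n * (s - r)" by (simp_all add: b_def abs_mult)
      have fX: "f (X n s) = f ((X n s)(n := p n))" using Xn[of s] by (metis fun_upd_triv)
      consider "b = p n" | "p n < b" | "b < p n" by linarith
      then show ?thesis
      proof cases
        case 1 then show ?thesis
          using fX by (intro exI[of _ "p n"]) (auto simp: upd b_def)
      next
        case 2
        from MVT2[OF 2 d[of "X n s"]] obtain z where z: "p n < z" "z < b"
          "f ((X n s)(n := b)) - f ((X n s)(n := p n)) = (b - p n) * coord_deriv n f ((X n s)(n := z))" by blast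
        have "\<bar>z - p n\<bar> \<le> \<bar>b - p n\<bar>" using z by simp
        then show ?thesis using z fX unfolding bp(1) by (intro exI[of _ z]) (simp add: upd bp(2) flip: b_def)
      next
        case 3
        from MVT2[OF 3 d[of "X n s"]] obtain z where z: "b < z" "z < p n"
          "f ((X n s)(n := p n)) - f ((X n s)(n := b)) = (p n - b) * coord_deriv n f ((X n s)(n := z))" by blast
        have "\<bar>z - p n\<bar> \<le> \<bar>b - p n\<bar>" using z by simp
        moreover have "f ((X n s)(n := b)) - f ((X n s)(n := p n)) = (b - p n) * coord_deriv n f ((X n s)(n := z))"
          using z(3) by (simp add: algebra_simps)
        ultimately show ?thesis using fX unfolding bp(1) by (intro exI[of _ z]) (simp add: upd bp(2) flip: b_def)
      qed
    qed
    then obtain u where u: "\<And>s. \<bar>u s - p n\<bar> \<le> \<bar>\<alpha> n\<bar> * \<bar>s - r\<bar>"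
      "\<And>s. f (X (Suc n) s) - f (X n s) = (\<alpha> n * (s - r)) * coord_deriv n f ((X n s)(n := u s))" by metis
    have "(u \<longlongrightarrow> p n) (at r)"
    proof (rule LIM_zero_cancel, rule Lim_null_comparison)
      show "\<forall>\<^sub>F s in at r. norm (u s - p n) \<le> \<bar>\<alpha> n\<bar> * \<bar>s - r\<bar>" using u(1) by simp
      show "((\<lambda>s. \<bar>\<alpha> n\<bar> * \<bar>s - r\<bar>) \<longlongrightarrow> 0) (at r)" by (auto intro!: tendsto_eq_intros)
    qed
    moreover have "((\<lambda>s. X n s i) \<longlongrightarrow> p i) (at r)" for i
      by (cases "i < n") (auto simp: X_def p_def intro!: tendsto_eq_intros)
    ultimately have "((\<lambda>s. ((X n s)(n := u s)) i) \<longlongrightarrow> p i) (at r)" for i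
      by (cases "i = n") simp_all
    then have "((\<lambda>s. (X n s)(n := u s)) \<longlongrightarrow> p) (at r)"
      using limitin_componentwise[of "\<lambda>_. euclidean" UNIV "\<lambda>s. (X n s)(n := u s)" p "at r"]
      by (simp add: euclidean_product_topology)
    moreover have "isCont (coord_deriv n f) p" using cont[OF n] by (simp add: continuous_on_eq_continuous_at)
    ultimately have "((\<lambda>s. coord_deriv n f ((X n s)(n := u s))) \<longlongrightarrow> coord_deriv n f p) (at r)"
      by (rule isCont_tendsto_compose[rotated])
    then have "((\<lambda>s. \<alpha> n * coord_deriv n f ((X n s)(n := u s))) \<longlongrightarrow> \<alpha> n * coord_deriv n f p) (at r)"
      by (intro tendsto_intros)
    moreover have "\<forall>\<^sub>F s in at r. \<alpha> n * coord_deriv n f ((X n s)(n := u s)) =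
      ((f (X (Suc n) s) - f (X n s)) - (f (X (Suc n) r) - f (X n r))) / (s - r)"
      unfolding u(2) by (auto simp: eventually_at_filter)
    ultimately have "((\<lambda>s. f (X (Suc n) s) - f (X n s)) has_real_derivative \<alpha> n * coord_deriv n f p) (at r)"
      unfolding has_field_derivative_iff by (rule Lim_transform_eventually)
    from DERIV_add[OF Suc.IH this] Suc.prems show ?case by (simp add: add.commute)
  qed
  from this[of m] have "((\<lambda>s. f (X m s)) has_real_derivative (\<Sum>i<m. \<alpha> i * coord_deriv i f p)) (at r)" by simp
  moreover have "f (X m s) = f (\<lambda>i. y i + \<alpha> i * s)" for s by (rule dep) (simp add: X_def)
  ultimately show ?thesis by (simp add: p_def)
qed

section \<open>Isonormal Gaussian noise\<close>

lemma (in prob_space) centered_gaussian_cases: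
  assumes "centered_gaussian M X"
  obtains "AE \<omega> in M. X \<omega> = 0" "X \<in> borel_measurable M"
  | \<sigma> where "0 < \<sigma>" "distributed M lborel X (\<lambda>x. ennreal (normal_density 0 \<sigma> x))"
      "expectation (\<lambda>\<omega>. (X \<omega>)\<^sup>2) = \<sigma>\<^sup>2" "X \<in> borel_measurable M"
proof -
  have X: "X \<in> borel_measurable M" using assms by (simp add: centered_gaussian_def)
  consider "AE \<omega> in M. X \<omega> = 0"
    | \<sigma> where "0 < \<sigma>" "distributed M lborel X (\<lambda>x. ennreal (normal_density 0 \<sigma> x))"
    using assms by (auto simp: centered_gaussian_def)
  then show ?thesis
  proof cases
    case 1 then show ?thesis using that(1) X by auto
  next
    case 2
    have "variance X = \<sigma>\<^sup>2" "expectation X = 0"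
      using normal_distributed_variance[OF 2] normal_distributed_expectation[OF 2] by auto
    then show ?thesis using that(2)[OF 2] X by simp
  qed
qed

lemma (in prob_space) centered_gaussian_char:
  assumes "centered_gaussian M X"
  shows "(\<integral>\<omega>. iexp (u * X \<omega>) \<partial>M) = complex_of_real (exp (- (u\<^sup>2 * expectation (\<lambda>\<omega>. (X \<omega>)\<^sup>2)) / 2))"
  using assms
proof (cases rule: centered_gaussian_cases)
  case 1
  note [measurable] = 1(2)
  have "(\<integral>\<omega>. iexp (u * X \<omega>) \<partial>M) = (\<integral>\<omega>. 1 \<partial>M)"
    by (rule integral_cong_AE) (use 1(1) in \<open>auto elim!: eventually_mono\<close>)
  moreover have "expectation (\<lambda>\<omega>. (X \<omega>)\<^sup>2) = 0"
    by (rule integral_eq_zero_AE) (use 1(1) in \<open>auto elim!: eventually_mono\<close>)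
  ultimately show ?thesis by (simp add: prob_space)
next
  case (2 \<sigma>)
  note [measurable] = 2(4)
  have D: "distributed M lborel (\<lambda>\<omega>. X \<omega> / \<sigma>) (\<lambda>x. ennreal (std_normal_density x))"
    using normal_standard_normal_convert[OF 2(1), of X 0] 2(2) by simp
  have "(\<integral>\<omega>. iexp (u * X \<omega>) \<partial>M) = (\<integral>\<omega>. iexp ((u * \<sigma>) * (X \<omega> / \<sigma>)) \<partial>M)"
    using 2(1) by simp
  also have "\<dots> = (\<integral>x. iexp ((u * \<sigma>) * x) \<partial>distr M lborel (\<lambda>\<omega>. X \<omega> / \<sigma>))"
    by (subst integral_distr) auto
  also have "\<dots> = char std_normal_distribution (u * \<sigma>)"
    unfolding distributed_distr_eq_density[OF D] char_def by simp
  also have "\<dots> = complex_of_real (exp (- (u\<^sup>2 * expectation (\<lambda>\<omega>. (X \<omega>)\<^sup>2)) / 2))"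
    using 2(3) by (simp add: char_std_normal_distribution power_mult_distrib)
  finally show ?thesis .
qed

lemma (in prob_space) centered_gaussian_moment:
  assumes "centered_gaussian M X"
  shows "integrable M (\<lambda>\<omega>. \<bar>X \<omega>\<bar> ^ k)"
  using assms
proof (cases rule: centered_gaussian_cases)
  case 1
  note [measurable] = 1(2)
  have "integrable M (\<lambda>\<omega>. (0::real) ^ k)" by simp
  then show ?thesis
    by (subst integrable_cong_AE[where g = "\<lambda>_. 0 ^ k"]) (use 1(1) in \<open>auto elim!: eventually_mono\<close>)
next
  case (2 \<sigma>)
  have "integrable lborel (\<lambda>x. normal_density 0 \<sigma> x * \<bar>x - 0\<bar> ^ k)"
    by (rule integrable_normal_moment_abs[OF 2(1)])
  then show ?thesis
    using distributed_integrable[OF 2(2), of "\<lambda>x. \<bar>x\<bar> ^ k"] by simp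
qed

lemma power_add_le:
  fixes a b :: real
  assumes "0 \<le> a" "0 \<le> b"
  shows "(a + b) ^ k \<le> 2 ^ k * (a ^ k + b ^ k)"
proof -
  have "(a + b) ^ k \<le> (2 * max a b) ^ k" using assms by (intro power_mono) auto
  also have "\<dots> = 2 ^ k * max a b ^ k" by (simp add: power_mult_distrib)
  also have "\<dots> \<le> 2 ^ k * (a ^ k + b ^ k)" using assms by (intro mult_left_mono) (auto simp: max_def)
  finally show ?thesis .
qed

lemma (in prob_space) centered_gaussian_poly_integrable:
  assumes "\<And>i. i < (m::nat) \<Longrightarrow> centered_gaussian M (V i)"
  shows "integrable M (\<lambda>\<omega>. (1 + (\<Sum>i<m. \<bar>V i \<omega>\<bar>)) ^ k)"
  using assms
proof (induction m)
  case 0 then show ?case by simp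
next
  case (Suc m)
  have [measurable]: "V i \<in> borel_measurable M" if "i < Suc m" for i
    using Suc(2)[OF that] by (simp add: centered_gaussian_def)
  have "integrable M (\<lambda>\<omega>. 2 ^ k * ((1 + (\<Sum>i<m. \<bar>V i \<omega>\<bar>)) ^ k + \<bar>V m \<omega>\<bar> ^ k))"
    using Suc by (intro integrable_mult_right Bochner_Integration.integrable_add centered_gaussian_moment) auto
  then show ?case
  proof (rule integrable_bound_pointwise)
    show "norm ((1 + (\<Sum>i<Suc m. \<bar>V i \<omega>\<bar>)) ^ k) \<le> norm (2 ^ k * ((1 + (\<Sum>i<m. \<bar>V i \<omega>\<bar>)) ^ k + \<bar>V m \<omega>\<bar> ^ k))" for \<omega>
      using power_add_le[of "1 + (\<Sum>i<m. \<bar>V i \<omega>\<bar>)" "\<bar>V m \<omega>\<bar>" k]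
      by (simp add: sum_nonneg add_nonneg_nonneg power_abs add.assoc)
  qed measurable
qed

text \<open>Integration by parts involves first derivatives only. In this form it also covers the
  coordinate function, which yields the isometry, without a discussion of higher
  derivatives.\<close>

definition C1_poly_growth :: "nat \<Rightarrow> ((nat \<Rightarrow> real) \<Rightarrow> real) \<Rightarrow> bool" where
  "C1_poly_growth m f \<longleftrightarrow>
     (\<forall>x y. (\<forall>i<m. x i = y i) \<longrightarrow> f x = f y) \<and> continuous_on UNIV f \<and>
     (\<exists>C (k::nat). \<forall>x. \<bar>f x\<bar> \<le> C * (1 + (\<Sum>i<m. \<bar>x i\<bar>)) ^ k) \<and>
     (\<forall>i<m. continuous_on UNIV (coord_deriv i f) \<and>
        (\<forall>x. (\<lambda>r. f (x(i := r))) differentiable (at (x i))) \<and>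
        (\<exists>C (k::nat). \<forall>x. \<bar>coord_deriv i f x\<bar> \<le> C * (1 + (\<Sum>i<m. \<bar>x i\<bar>)) ^ k))"

lemma smooth_poly_growth_C1:
  assumes "smooth_poly_growth m f"
  shows "C1_poly_growth m f"
proof -
  have h: "continuous_on UNIV (foldr coord_deriv is f) \<and>
        (\<forall>i<m. \<forall>x. (\<lambda>r. foldr coord_deriv is f (x(i := r))) differentiable (at (x i))) \<and>
        (\<exists>C (k::nat). \<forall>x. \<bar>foldr coord_deriv is f x\<bar> \<le> C * (1 + (\<Sum>i<m. \<bar>x i\<bar>)) ^ k)"
    if "set is \<subseteq> {..<m}" for "is"
    using assms that by (simp add: smooth_poly_growth_def)
  show ?thesis
    unfolding C1_poly_growth_def using h[of "[]"] h[of "[i]" for i] assms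
    by (auto simp: smooth_poly_growth_def)
qed

text \<open>Freezing \<open>y\<close> leaves growth in one real variable. The new constant may
  depend on \<open>y\<close>, because the one-dimensional formula is applied for each frozen
  \<open>y\<close> separately.\<close>

lemma poly_growth_along_line:
  fixes g :: "(nat \<Rightarrow> real) \<Rightarrow> real"
  assumes "\<And>x. \<bar>g x\<bar> \<le> C * (1 + (\<Sum>i<m. \<bar>x i\<bar>)) ^ k"
  shows "\<bar>g (\<lambda>i. y i + \<alpha> i * n)\<bar> \<le> (C * (1 + (\<Sum>i<m. \<bar>y i\<bar> + \<bar>\<alpha> i\<bar>)) ^ k) * (1 + \<bar>n\<bar>) ^ k"
proof -
  have C: "0 \<le> C" using assms[of "\<lambda>_. 0"] by simp
  have "(\<Sum>i<m. \<bar>y i + \<alpha> i * n\<bar>) \<le> (\<Sum>i<m. (\<bar>y i\<bar> + \<bar>\<alpha> i\<bar>) * (1 + \<bar>n\<bar>))"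
  proof (rule sum_mono)
    fix i
    have "\<bar>y i + \<alpha> i * n\<bar> \<le> \<bar>y i\<bar> + \<bar>\<alpha> i\<bar> * \<bar>n\<bar>" using abs_triangle_ineq[of "y i" "\<alpha> i * n"] by (simp add: abs_mult)
    also have "\<dots> \<le> (\<bar>y i\<bar> + \<bar>\<alpha> i\<bar>) * (1 + \<bar>n\<bar>)" by (simp add: algebra_simps)
    finally show "\<bar>y i + \<alpha> i * n\<bar> \<le> (\<bar>y i\<bar> + \<bar>\<alpha> i\<bar>) * (1 + \<bar>n\<bar>)" .
  qed
  then have "1 + (\<Sum>i<m. \<bar>y i + \<alpha> i * n\<bar>) \<le> (1 + (\<Sum>i<m. \<bar>y i\<bar> + \<bar>\<alpha> i\<bar>)) * (1 + \<bar>n\<bar>)"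
    unfolding sum_distrib_right[symmetric] by (simp only: distrib_right mult_1)
  then have "(1 + (\<Sum>i<m. \<bar>y i + \<alpha> i * n\<bar>)) ^ k \<le> ((1 + (\<Sum>i<m. \<bar>y i\<bar> + \<bar>\<alpha> i\<bar>)) * (1 + \<bar>n\<bar>)) ^ k"
    by (intro power_mono) (auto intro!: add_nonneg_nonneg sum_nonneg)
  then have "C * (1 + (\<Sum>i<m. \<bar>y i + \<alpha> i * n\<bar>)) ^ k \<le> C * ((1 + (\<Sum>i<m. \<bar>y i\<bar> + \<bar>\<alpha> i\<bar>)) ^ k * (1 + \<bar>n\<bar>) ^ k)"
    unfolding power_mult_distrib using C by (rule mult_left_mono)
  with assms[of "\<lambda>i. y i + \<alpha> i * n"] show ?thesis by (simp add: mult.assoc)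
qed

lemma poly_bound_sum:
  fixes g :: "nat \<Rightarrow> real \<Rightarrow> real"
  assumes "\<And>i. i < m \<Longrightarrow> \<exists>C (k::nat). \<forall>n. \<bar>g i n\<bar> \<le> C * (1 + \<bar>n\<bar>) ^ k"
  shows "\<exists>C (k::nat). \<forall>n. \<bar>\<Sum>i<m. \<alpha> i * g i n\<bar> \<le> C * (1 + \<bar>n\<bar>) ^ k"
  using assms
proof (induction m)
  case 0 then show ?case by (intro exI[of _ 0]) simp
next
  case (Suc m)
  obtain C k where 1: "\<And>n. \<bar>\<Sum>i<m. \<alpha> i * g i n\<bar> \<le> C * (1 + \<bar>n\<bar>) ^ k" using Suc by fastforce
  obtain C' k' where 2: "\<And>n. \<bar>g m n\<bar> \<le> C' * (1 + \<bar>n\<bar>) ^ k'" using Suc(2)[of m] by blast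
  have C: "0 \<le> C" "0 \<le> C'" using 1[of 0] 2[of 0] by auto
  have "\<bar>\<Sum>i<Suc m. \<alpha> i * g i n\<bar> \<le> (C + \<bar>\<alpha> m\<bar> * C') * (1 + \<bar>n\<bar>) ^ (k + k')" for n
  proof -
    have p: "(1 + \<bar>n\<bar>) ^ k \<le> (1 + \<bar>n\<bar>) ^ (k + k')" "(1 + \<bar>n\<bar>) ^ k' \<le> (1 + \<bar>n\<bar>) ^ (k + k')"
      by (intro power_increasing; simp)+
    have "\<bar>\<Sum>i<Suc m. \<alpha> i * g i n\<bar> \<le> \<bar>\<Sum>i<m. \<alpha> i * g i n\<bar> + \<bar>\<alpha> m\<bar> * \<bar>g m n\<bar>"
      by (simp add: abs_mult[symmetric] abs_triangle_ineq)
    also have "\<dots> \<le> C * (1 + \<bar>n\<bar>) ^ k + \<bar>\<alpha> m\<bar> * (C' * (1 + \<bar>n\<bar>) ^ k')"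
      by (intro add_mono mult_left_mono 1 2) auto
    also have "\<dots> \<le> C * (1 + \<bar>n\<bar>) ^ (k + k') + \<bar>\<alpha> m\<bar> * (C' * (1 + \<bar>n\<bar>) ^ (k + k'))"
      by (intro add_mono mult_left_mono p) (use C in auto)
    finally show ?thesis by (simp add: algebra_simps)
  qed
  then show ?case by blast
qed

section \<open>The noise \<open>F\<close> and its part orthogonal to a given direction\<close>

locale gaussian_noise = prob_space M for M :: "'w measure" +
  fixes T :: real and F :: "(real \<Rightarrow> 'h::{real_inner,banach,second_countable_topology}) \<Rightarrow> 'w \<Rightarrow> real"
  assumes iso: "isonormal M T F"
begin

abbreviation ip :: "(real \<Rightarrow> 'h) \<Rightarrow> (real \<Rightarrow> 'h) \<Rightarrow> real" where
  "ip \<phi> \<psi> \<equiv> (\<integral>s. \<phi> s \<bullet> \<psi> s \<partial>time T)"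

lemma F_gaussian: "\<phi> \<in> L2 (time T) \<Longrightarrow> centered_gaussian M (F \<phi>)"
  using iso[unfolded isonormal_def, THEN conjunct1, rule_format, of "{\<phi>}" "\<lambda>_. 1"] by simp

lemma F_measurable [measurable_dest]: "\<phi> \<in> L2 (time T) \<Longrightarrow> F \<phi> \<in> borel_measurable M"
  using F_gaussian by (auto simp: centered_gaussian_def)

lemma F_cov: "\<phi> \<in> L2 (time T) \<Longrightarrow> \<psi> \<in> L2 (time T) \<Longrightarrow> (\<integral>\<omega>. F \<phi> \<omega> * F \<psi> \<omega> \<partial>M) = ip \<phi> \<psi>"
  using iso by (simp add: isonormal_def)

lemma F_L2: "\<phi> \<in> L2 (time T) \<Longrightarrow> F \<phi> \<in> L2 M"
  using centered_gaussian_moment[OF F_gaussian, of \<phi> 2] by (simp add: L2_def F_measurable)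

lemma F_var: "\<phi> \<in> L2 (time T) \<Longrightarrow> (\<integral>\<omega>. (F \<phi> \<omega>)\<^sup>2 \<partial>M) = ip \<phi> \<phi>"
  using F_cov[of \<phi> \<phi>] by (simp add: power2_eq_square)

lemma ip_lin_left:
  assumes "\<phi> \<in> L2 (time T)" "\<psi> \<in> L2 (time T)" "\<theta> \<in> L2 (time T)"
  shows "ip (\<lambda>s. \<phi> s + c *\<^sub>R \<psi> s) \<theta> = ip \<phi> \<theta> + c * ip \<psi> \<theta>"
  using assms by (simp add: inner_add_left L2_inner_integrable)

lemma ip_commute: "ip \<phi> \<psi> = ip \<psi> \<phi>"
  by (simp add: inner_commute)

lemma ip_lin_right:
  assumes "\<phi> \<in> L2 (time T)" "\<psi> \<in> L2 (time T)" "\<theta> \<in> L2 (time T)"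
  shows "ip \<theta> (\<lambda>s. \<phi> s + c *\<^sub>R \<psi> s) = ip \<theta> \<phi> + c * ip \<theta> \<psi>"
  using assms by (simp add: inner_add_right L2_inner_integrable)

text \<open>\<open>isonormal\<close> prescribes covariances and Gaussian laws, not linearity. The
  expected square of the defect consists of covariances, which cancel by bilinearity of the inner
  product; hence the defect is zero, but only almost surely.\<close>

lemma F_lin:
  assumes \<phi>: "\<phi> \<in> L2 (time T)" and \<psi>: "\<psi> \<in> L2 (time T)"
  shows "AE \<omega> in M. F (\<lambda>s. \<phi> s + c *\<^sub>R \<psi> s) \<omega> = F \<phi> \<omega> + c * F \<psi> \<omega>"
proof -
  let ?\<theta> = "\<lambda>s. \<phi> s + c *\<^sub>R \<psi> s"
  have \<theta>: "?\<theta> \<in> L2 (time T)" using assms by (rule L2_lin)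
  note i = L2_mult_integrable[OF F_L2 F_L2]
  have d: "(\<lambda>\<omega>. F ?\<theta> \<omega> - (F \<phi> \<omega> + c * F \<psi> \<omega>)) \<in> L2 M"
    using L2_diff[OF F_L2[OF \<theta>] L2_lin[OF F_L2[OF \<phi>] F_L2[OF \<psi>], of c]] by simp
  have "(\<integral>\<omega>. (F ?\<theta> \<omega> - (F \<phi> \<omega> + c * F \<psi> \<omega>))\<^sup>2 \<partial>M) =
    (\<integral>\<omega>. F ?\<theta> \<omega> * F ?\<theta> \<omega> + F \<phi> \<omega> * F \<phi> \<omega> + c\<^sup>2 * (F \<psi> \<omega> * F \<psi> \<omega>) - 2 * (F ?\<theta> \<omega> * F \<phi> \<omega>)
       - 2 * c * (F ?\<theta> \<omega> * F \<psi> \<omega>) + 2 * c * (F \<phi> \<omega> * F \<psi> \<omega>) \<partial>M)"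
    by (intro Bochner_Integration.integral_cong) (auto simp: power2_eq_square algebra_simps)
  also have "\<dots> = ip ?\<theta> ?\<theta> + ip \<phi> \<phi> + c\<^sup>2 * ip \<psi> \<psi> - 2 * ip ?\<theta> \<phi> - 2 * c * ip ?\<theta> \<psi> + 2 * c * ip \<phi> \<psi>"
    using i[OF \<theta> \<theta>] i[OF \<phi> \<phi>] i[OF \<psi> \<psi>] i[OF \<theta> \<phi>] i[OF \<theta> \<psi>] i[OF \<phi> \<psi>]
    by (simp add: F_cov[OF \<theta> \<theta>] F_cov[OF \<phi> \<phi>] F_cov[OF \<psi> \<psi>] F_cov[OF \<theta> \<phi>] F_cov[OF \<theta> \<psi>] F_cov[OF \<phi> \<psi>]
        del: inner_add_left inner_add_right)
  also have "\<dots> = 0"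
    unfolding ip_lin_left[OF \<phi> \<psi> \<theta>] ip_lin_left[OF \<phi> \<psi> \<phi>] ip_lin_left[OF \<phi> \<psi> \<psi>]
      ip_lin_right[OF \<phi> \<psi> \<phi>] ip_lin_right[OF \<phi> \<psi> \<psi>] ip_commute[of \<psi> \<phi>]
    by (simp add: power2_eq_square algebra_simps)
  finally have "(\<integral>\<omega>. (F ?\<theta> \<omega> - (F \<phi> \<omega> + c * F \<psi> \<omega>))\<^sup>2 \<partial>M) = 0" .
  then have "AE \<omega> in M. (F ?\<theta> \<omega> - (F \<phi> \<omega> + c * F \<psi> \<omega>))\<^sup>2 = 0"
    using integral_nonneg_eq_0_iff_AE[of M "\<lambda>\<omega>. (F ?\<theta> \<omega> - (F \<phi> \<omega> + c * F \<psi> \<omega>))\<^sup>2"] L2_integrable[OF d] by simp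
  then show ?thesis by (rule eventually_mono) simp
qed

lemma F_char:
  "\<phi> \<in> L2 (time T) \<Longrightarrow> (\<integral>\<omega>. iexp (F \<phi> \<omega>) \<partial>M) = complex_of_real (exp (- ip \<phi> \<phi> / 2))"
  using centered_gaussian_char[OF F_gaussian, of \<phi> 1] by (simp add: F_var)

definition orth :: "(real \<Rightarrow> 'h) \<Rightarrow> ('w \<Rightarrow> real) set" where
  "orth \<psi> = {F \<theta> | \<theta>. \<theta> \<in> L2 (time T) \<and> ip \<theta> \<psi> = 0}"

text \<open>The null sets are included because the augmented filtration has to lie below this
  sigma-algebra.\<close>

definition orth_sigma :: "(real \<Rightarrow> 'h) \<Rightarrow> 'w measure" where
  "orth_sigma \<psi> = sigma (space M) ({V -` B \<inter> space M | V B. V \<in> orth \<psi> \<and> B \<in> sets borel} \<union> null_sets M)"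

lemma orth_measurable: "orth \<psi> \<subseteq> borel_measurable M"
  by (auto simp: orth_def F_measurable)

lemma space_orth_sigma [simp]: "space (orth_sigma \<psi>) = space M"
  unfolding orth_sigma_def by (rule space_measure_of) (auto dest: null_setsD2 sets.sets_into_space)

lemma sets_orth_sigma: "sets (orth_sigma \<psi>) = generated_sets M (orth \<psi>)"
  unfolding orth_sigma_def generated_sets_def
  by (rule sets_measure_of) (auto dest: null_setsD2 sets.sets_into_space)

lemma orth_sigma_subset: "sets (orth_sigma \<psi>) \<subseteq> sets M"
  unfolding sets_orth_sigma by (rule generated_sets_subset[OF orth_measurable])

lemma subalgebra_orth_sigma: "subalgebra M (orth_sigma \<psi>)"
  unfolding subalgebra_def by (intro conjI space_orth_sigma orth_sigma_subset)

lemmas measurable_orth_sigma_imp = measurable_from_subalg[OF subalgebra_orth_sigma]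

lemma F_orth_measurable:
  assumes "\<theta> \<in> L2 (time T)" "ip \<theta> \<psi> = 0"
  shows "F \<theta> \<in> borel_measurable (orth_sigma \<psi>)"
proof (rule measurableI)
  fix B :: "real set" assume "B \<in> sets borel"
  then have "F \<theta> -` B \<inter> space M \<in> {V -` B \<inter> space M | V B. V \<in> orth \<psi> \<and> B \<in> sets borel}"
    using assms by (auto simp: orth_def)
  then show "F \<theta> -` B \<inter> space (orth_sigma \<psi>) \<in> sets (orth_sigma \<psi>)"
    unfolding sets_orth_sigma generated_sets_def space_orth_sigma by (intro sigma_sets.Basic UnI1)
qed simp

lemma zero_L2: "(\<lambda>_. 0 :: 'h) \<in> L2 (time T)" by simp

text \<open>Zero covariance yields independence through joint Gaussianity, which enters as the
  characteristic function of the noise at \<phi> + u \<psi>: for orthogonal \<phi> and \<psi> the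
  exponent has no mixed term, and the function factorizes.\<close>

lemma orth_indep:
  assumes \<psi> [measurable]: "\<psi> \<in> L2 (time T)" and E: "E \<in> sets (orth_sigma \<psi>)" and B [measurable]: "B \<in> sets borel"
  shows "prob (E \<inter> (F \<psi> -` B \<inter> space M)) = prob E * prob (F \<psi> -` B \<inter> space M)"
proof -
  note [measurable] = F_measurable[OF \<psi>]
  let ?p = "prob (F \<psi> -` B \<inter> space M)"
  \<comment> \<open>Independence of \<open>E\<close> and the event that \<open>F \<psi>\<close> lies
    in \<open>B\<close> says that this centered indicator integrates to zero over \<open>E\<close>,
    which is the form that the Fourier criterion can deliver.\<close>
  let ?D = "\<lambda>\<omega>. indicator B (F \<psi> \<omega>) - ?p"
  have pI: "(\<integral>\<omega>. indicator B (F \<psi> \<omega>) \<partial>M) = ?p"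
  proof -
    have "(\<integral>\<omega>. indicator B (F \<psi> \<omega>) \<partial>M) = (\<integral>\<omega>. indicat_real (F \<psi> -` B \<inter> space M) \<omega> \<partial>M)"
      by (intro Bochner_Integration.integral_cong) (auto simp: indicator_def)
    then show ?thesis by simp
  qed
  have iB: "integrable M (\<lambda>\<omega>. indicator B (F \<psi> \<omega>) :: real)"
    by (rule integrable_const_bound[of _ 1]) (auto simp: indicator_def)
  have D: "integrable M ?D" using iB by simp
  have EM: "E \<in> sets M" using E orth_sigma_subset by auto
  have "(\<integral>\<omega>. ?D \<omega> * indicator E \<omega> \<partial>M) = 0"
  proof (rule integral_indicator_eq_0_of_generated[OF D orth_measurable, of \<psi>])
    show "orth \<psi> \<noteq> {}" using zero_L2 by (auto simp: orth_def intro!: exI[of _ "\<lambda>_. 0"])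
    show "E \<in> generated_sets M (orth \<psi>)" using E sets_orth_sigma by simp
    show "\<exists>U\<in>orth \<psi>. AE x in M. U x = V x + u * W x" if VW: "V \<in> orth \<psi>" "W \<in> orth \<psi>" for V W u
    proof -
      obtain \<phi> \<theta> where \<phi>: "V = F \<phi>" "\<phi> \<in> L2 (time T)" "ip \<phi> \<psi> = 0" and \<theta>: "W = F \<theta>" "\<theta> \<in> L2 (time T)" "ip \<theta> \<psi> = 0"
        using VW by (auto simp: orth_def)
      then have "F (\<lambda>s. \<phi> s + u *\<^sub>R \<theta> s) \<in> orth \<psi>"
        unfolding orth_def using \<psi>
        by (auto intro!: exI[of _ "\<lambda>s. \<phi> s + u *\<^sub>R \<theta> s"] L2_lin simp: ip_lin_left simp del: inner_add_left)
      moreover have "AE x in M. F (\<lambda>s. \<phi> s + u *\<^sub>R \<theta> s) x = V x + u * W x"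
        unfolding \<phi> \<theta> by (rule F_lin[OF \<phi>(2) \<theta>(2)])
      ultimately show ?thesis by blast
    qed
  next
    fix V assume "V \<in> orth \<psi>"
    then obtain \<phi> where \<phi>: "V = F \<phi>" "\<phi> \<in> L2 (time T)" "ip \<phi> \<psi> = 0" by (auto simp: orth_def)
    note [measurable] = F_measurable[OF \<phi>(2)]
    let ?c = "\<integral>\<omega>. iexp (F \<phi> \<omega>) \<partial>M"
    have ie: "integrable M (\<lambda>\<omega>. iexp (F \<phi> \<omega>))" by (rule integrable_const_bound[of _ 1]) auto
    \<comment> \<open>The roles change for this inner application: the centered exponential of
      \<open>F \<phi>\<close> is now the weight, and the indicator of \<open>F \<psi>\<close> is
      reached by testing against all frequencies \<open>u\<close>.\<close>
    have "(\<integral>\<omega>. (iexp (F \<phi> \<omega>) - ?c) * indicator B (F \<psi> \<omega>) \<partial>M) = 0"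
    proof (rule integral_indicator_eq_0_of_char_complex)
      show "integrable M (\<lambda>\<omega>. iexp (F \<phi> \<omega>) - ?c)" using ie by simp
      fix u
      have u\<psi>: "(\<lambda>s. 0 + u *\<^sub>R \<psi> s) \<in> L2 (time T)" by (rule L2_lin[OF zero_L2 \<psi>])
      have iu: "integrable M (\<lambda>\<omega>. iexp (u * F \<psi> \<omega>))" by (rule integrable_const_bound[of _ 1]) auto
      have iu2: "integrable M (\<lambda>\<omega>. iexp (F \<phi> \<omega>) * iexp (u * F \<psi> \<omega>))"
        using ie by (rule integrable_norm_le_1) auto
      have cu: "(\<integral>\<omega>. iexp (u * F \<psi> \<omega>) \<partial>M) = complex_of_real (exp (- (u\<^sup>2 * ip \<psi> \<psi>) / 2))"
        using centered_gaussian_char[OF F_gaussian[OF \<psi>], of u] by (simp add: F_var[OF \<psi>])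
      have l: "(\<lambda>s. \<phi> s + u *\<^sub>R \<psi> s) \<in> L2 (time T)" by (rule L2_lin[OF \<phi>(2) \<psi>])
      note [measurable] = F_measurable[OF l]
      have "(\<integral>\<omega>. iexp (F \<phi> \<omega>) * iexp (u * F \<psi> \<omega>) \<partial>M) = (\<integral>\<omega>. iexp (F (\<lambda>s. \<phi> s + u *\<^sub>R \<psi> s) \<omega>) \<partial>M)"
      proof (rule integral_cong_AE)
        show "AE \<omega> in M. iexp (F \<phi> \<omega>) * iexp (u * F \<psi> \<omega>) = iexp (F (\<lambda>s. \<phi> s + u *\<^sub>R \<psi> s) \<omega>)"
          using F_lin[OF \<phi>(2) \<psi>, of u] by eventually_elim (simp add: exp_add distrib_left)
      qed measurable
      also have "\<dots> = complex_of_real (exp (- ip (\<lambda>s. \<phi> s + u *\<^sub>R \<psi> s) (\<lambda>s. \<phi> s + u *\<^sub>R \<psi> s) / 2))"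
        by (rule F_char[OF l])
      also have "ip (\<lambda>s. \<phi> s + u *\<^sub>R \<psi> s) (\<lambda>s. \<phi> s + u *\<^sub>R \<psi> s) = ip \<phi> \<phi> + u\<^sup>2 * ip \<psi> \<psi>"
        unfolding ip_lin_left[OF \<phi>(2) \<psi> l] ip_lin_right[OF \<phi>(2) \<psi> \<phi>(2)] ip_lin_right[OF \<phi>(2) \<psi> \<psi>]
        using \<phi>(3) ip_commute[of \<psi> \<phi>] by (simp add: power2_eq_square)
      also have "complex_of_real (exp (- (ip \<phi> \<phi> + u\<^sup>2 * ip \<psi> \<psi>) / 2)) = ?c * (\<integral>\<omega>. iexp (u * F \<psi> \<omega>) \<partial>M)"
        unfolding cu F_char[OF \<phi>(2)] by (simp only: of_real_mult[symmetric] exp_add[symmetric]) (simp add: field_simps)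
      finally have "(\<integral>\<omega>. iexp (F \<phi> \<omega>) * iexp (u * F \<psi> \<omega>) \<partial>M) = ?c * (\<integral>\<omega>. iexp (u * F \<psi> \<omega>) \<partial>M)" .
      then show "(\<integral>\<omega>. (iexp (F \<phi> \<omega>) - ?c) * iexp (u * F \<psi> \<omega>) \<partial>M) = 0"
        using iu iu2 by (simp add: left_diff_distrib)
    qed measurable
    moreover have "integrable M (\<lambda>\<omega>. iexp (F \<phi> \<omega>) * indicator B (F \<psi> \<omega>))"
      using ie by (rule integrable_norm_le_1) (auto simp: indicator_def)
    moreover have "integrable M (\<lambda>\<omega>. ?c * indicator B (F \<psi> \<omega>))"
      by (intro integrable_mult_right integrable_const_bound[of _ 1]) (auto simp: indicator_def)
    ultimately have "(\<integral>\<omega>. iexp (F \<phi> \<omega>) * indicator B (F \<psi> \<omega>) \<partial>M) = ?c * (\<integral>\<omega>. indicator B (F \<psi> \<omega>) \<partial>M)"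
      by (simp add: left_diff_distrib)
    also have "(\<integral>\<omega>. indicator B (F \<psi> \<omega>) \<partial>M) = complex_of_real (\<integral>\<omega>. indicator B (F \<psi> \<omega>) \<partial>M)"
      unfolding integral_complex_of_real[symmetric]
      by (intro Bochner_Integration.integral_cong) (auto simp: indicator_def)
    finally have eq: "(\<integral>\<omega>. iexp (F \<phi> \<omega>) * indicator B (F \<psi> \<omega>) \<partial>M) = ?c * complex_of_real ?p"
      by (simp only: pI)
    have "(\<integral>\<omega>. complex_of_real (?D \<omega>) * iexp (V \<omega>) \<partial>M) =
       (\<integral>\<omega>. iexp (F \<phi> \<omega>) * indicator B (F \<psi> \<omega>) - iexp (F \<phi> \<omega>) * complex_of_real ?p \<partial>M)"
      by (intro Bochner_Integration.integral_cong) (auto simp: \<phi>(1) indicator_def algebra_simps)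
    also have "\<dots> = 0"
      using eq ie \<open>integrable M (\<lambda>\<omega>. iexp (F \<phi> \<omega>) * indicator B (F \<psi> \<omega>))\<close> by simp
    finally show "(\<integral>\<omega>. complex_of_real (?D \<omega>) * iexp (V \<omega>) \<partial>M) = 0" .
  qed
  moreover have "(\<integral>\<omega>. ?D \<omega> * indicator E \<omega> \<partial>M) =
     (\<integral>\<omega>. indicator (E \<inter> (F \<psi> -` B \<inter> space M)) \<omega> - ?p * indicator E \<omega> \<partial>M)"
    by (intro Bochner_Integration.integral_cong) (auto simp: indicator_def)
  moreover have "\<dots> = prob (E \<inter> (F \<psi> -` B \<inter> space M)) - ?p * prob E"
  proof -
    have "F \<psi> -` B \<inter> space M \<in> sets M" by measurable
    with EM have "E \<inter> (F \<psi> -` B \<inter> space M) \<in> sets M" by auto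
    then show ?thesis using EM by (subst Bochner_Integration.integral_diff) (auto simp: less_top[symmetric])
  qed
  ultimately show ?thesis by simp
qed

end

section \<open>Gaussian integration by parts\<close>

context gaussian_noise begin

lemma orth_sigma_ident: "(\<lambda>\<omega>. \<omega>) \<in> M \<rightarrow>\<^sub>M orth_sigma \<psi>"
proof (rule measurableI)
  fix A assume "A \<in> sets (orth_sigma \<psi>)"
  then have "A \<in> sets M" using orth_sigma_subset by auto
  then show "(\<lambda>\<omega>. \<omega>) -` A \<inter> space M \<in> sets M" by (metis sets.Int_space_eq2 vimage_ident)
qed simp

text \<open>The freezing lemma for independent data: the joint law of \<omega>, seen through the
  smaller sigma-algebra, and of \<open>F \<psi>\<close> is a product measure, so \<omega> can be
  held fixed while \<open>F \<psi>\<close> is integrated out.\<close>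

lemma orth_fubini:
  fixes H :: "'w \<times> real \<Rightarrow> real"
  assumes \<psi>: "\<psi> \<in> L2 (time T)" and H [measurable]: "H \<in> borel_measurable (orth_sigma \<psi> \<Otimes>\<^sub>M borel)"
    and int: "integrable M (\<lambda>\<omega>. H (\<omega>, F \<psi> \<omega>))"
  shows "(\<integral>\<omega>. H (\<omega>, F \<psi> \<omega>) \<partial>M) = (\<integral>\<omega>. (\<integral>\<omega>'. H (\<omega>, F \<psi> \<omega>') \<partial>M) \<partial>M)"
proof -
  let ?\<Sigma> = "orth_sigma \<psi>"
  note [measurable] = F_measurable[OF \<psi>]
  note id = orth_sigma_ident[of \<psi>]
  interpret P1: prob_space "distr M ?\<Sigma> (\<lambda>\<omega>. \<omega>)" by (rule prob_space_distr[OF id])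
  interpret P2: prob_space "distr M borel (F \<psi>)" by (rule prob_space_distr) measurable
  interpret pair_sigma_finite "distr M ?\<Sigma> (\<lambda>\<omega>. \<omega>)" "distr M borel (F \<psi>)" ..
  have pm [measurable]: "(\<lambda>\<omega>. (\<omega>, F \<psi> \<omega>)) \<in> M \<rightarrow>\<^sub>M ?\<Sigma> \<Otimes>\<^sub>M borel"
    using id by (intro measurable_Pair) auto
  have joint: "distr M ?\<Sigma> (\<lambda>\<omega>. \<omega>) \<Otimes>\<^sub>M distr M borel (F \<psi>) = distr M (?\<Sigma> \<Otimes>\<^sub>M borel) (\<lambda>\<omega>. (\<omega>, F \<psi> \<omega>))"
  proof (rule pair_measure_eqI)
    fix A B assume "A \<in> sets (distr M ?\<Sigma> (\<lambda>\<omega>. \<omega>))" "B \<in> sets (distr M borel (F \<psi>))"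
    then have AB: "A \<in> sets ?\<Sigma>" "B \<in> sets borel" by auto
    have A: "A \<subseteq> space M" using sets.sets_into_space[OF AB(1)] by simp
    have "emeasure M (A \<inter> (F \<psi> -` B \<inter> space M)) = emeasure M A * emeasure M (F \<psi> -` B \<inter> space M)"
      using orth_indep[OF \<psi> AB] by (simp add: emeasure_eq_measure ennreal_mult')
    moreover have "(\<lambda>\<omega>. (\<omega>, F \<psi> \<omega>)) -` (A \<times> B) \<inter> space M = A \<inter> (F \<psi> -` B \<inter> space M)" by auto
    moreover have "(\<lambda>\<omega>. \<omega>) -` A \<inter> space M = A" using A by auto
    ultimately show "emeasure (distr M ?\<Sigma> (\<lambda>\<omega>. \<omega>)) A * emeasure (distr M borel (F \<psi>)) B =
        emeasure (distr M (?\<Sigma> \<Otimes>\<^sub>M borel) (\<lambda>\<omega>. (\<omega>, F \<psi> \<omega>))) (A \<times> B)"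
      using AB pm id by (simp add: emeasure_distr)
  qed (auto intro: P1.sigma_finite_measure_axioms P2.sigma_finite_measure_axioms sets_pair_measure_cong)
  have "integrable (distr M (?\<Sigma> \<Otimes>\<^sub>M borel) (\<lambda>\<omega>. (\<omega>, F \<psi> \<omega>))) H"
    by (subst integrable_distr_eq[OF pm H]) (rule int)
  then have iH: "integrable (distr M ?\<Sigma> (\<lambda>\<omega>. \<omega>) \<Otimes>\<^sub>M distr M borel (F \<psi>)) H" by (simp only: joint)
  have "(\<integral>\<omega>. H (\<omega>, F \<psi> \<omega>) \<partial>M) = (\<integral>p. H p \<partial>distr M (?\<Sigma> \<Otimes>\<^sub>M borel) (\<lambda>\<omega>. (\<omega>, F \<psi> \<omega>)))"
    by (subst integral_distr[OF pm H]) simp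
  also have "\<dots> = (\<integral>p. H p \<partial>(distr M ?\<Sigma> (\<lambda>\<omega>. \<omega>) \<Otimes>\<^sub>M distr M borel (F \<psi>)))"
    by (simp only: joint)
  also have "\<dots> = (\<integral>\<omega>. (\<integral>n. H (\<omega>, n) \<partial>distr M borel (F \<psi>)) \<partial>distr M ?\<Sigma> (\<lambda>\<omega>. \<omega>))"
    by (rule integral_fst'[symmetric, OF iH])
  also have "\<dots> = (\<integral>\<omega>. (\<integral>n. H (\<omega>, n) \<partial>distr M borel (F \<psi>)) \<partial>M)"
    by (rule integral_distr[OF id]) measurable
  also have "\<dots> = (\<integral>\<omega>. (\<integral>\<omega>'. H (\<omega>, F \<psi> \<omega>') \<partial>M) \<partial>M)"
  proof (rule Bochner_Integration.integral_cong[OF refl])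
    fix \<omega> assume "\<omega> \<in> space M"
    then have "(\<lambda>n. H (\<omega>, n)) \<in> borel_measurable borel" using H by (intro measurable_Pair2[OF H]) simp
    then show "(\<integral>n. H (\<omega>, n) \<partial>distr M borel (F \<psi>)) = (\<integral>\<omega>'. H (\<omega>, F \<psi> \<omega>') \<partial>M)"
      by (rule integral_distr[OF F_measurable[OF \<psi>]])
  qed
  finally show ?thesis .
qed

lemma poly_growth_L2:
  fixes m :: nat
  assumes \<phi>: "\<And>i. i < m \<Longrightarrow> \<phi> i \<in> L2 (time T)"
    and g: "(\<lambda>\<omega>. g (\<lambda>i. F (\<phi> i) \<omega>)) \<in> borel_measurable M"
    and b: "\<And>x. \<bar>g x\<bar> \<le> C * (1 + (\<Sum>i<m. \<bar>x i\<bar>)) ^ k"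
  shows "(\<lambda>\<omega>. g (\<lambda>i. F (\<phi> i) \<omega>)) \<in> L2 M"
proof -
  have "integrable M (\<lambda>\<omega>. C\<^sup>2 * (1 + (\<Sum>i<m. \<bar>F (\<phi> i) \<omega>\<bar>)) ^ (k * 2))"
    using centered_gaussian_poly_integrable[OF F_gaussian[OF \<phi>], of m "\<lambda>i. i" "k * 2"]
    by (intro integrable_mult_right) auto
  then have "integrable M (\<lambda>\<omega>. (norm (g (\<lambda>i. F (\<phi> i) \<omega>)))\<^sup>2)"
  proof (rule integrable_bound_pointwise)
    show "norm ((norm (g (\<lambda>i. F (\<phi> i) \<omega>)))\<^sup>2) \<le> norm (C\<^sup>2 * (1 + (\<Sum>i<m. \<bar>F (\<phi> i) \<omega>\<bar>)) ^ (k * 2))" for \<omega>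
    proof -
      have "\<bar>g (\<lambda>i. F (\<phi> i) \<omega>)\<bar>\<^sup>2 \<le> (C * (1 + (\<Sum>i<m. \<bar>F (\<phi> i) \<omega>\<bar>)) ^ k)\<^sup>2"
        by (intro power_mono b) simp
      then show ?thesis by (simp add: power_mult_distrib power_mult)
    qed
  qed (use g in measurable)
  with g show ?thesis by (simp add: L2_def)
qed

lemma coord_deriv_dep:
  assumes "\<And>x y. (\<forall>i<m. x i = y i) \<Longrightarrow> f x = f y" "\<forall>i<m. x i = y i" "j < m"
  shows "coord_deriv j f x = coord_deriv j f y"
proof -
  have "(\<lambda>r. f (x(j := r))) = (\<lambda>r. f (y(j := r)))"
    using assms by (intro ext assms(1)) auto
  then show ?thesis using assms(2,3) by (simp add: coord_deriv_def)
qed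

lemma cylinder_measurable:
  fixes g :: "(nat \<Rightarrow> real) \<Rightarrow> real"
  assumes \<phi>: "\<And>i. i < m \<Longrightarrow> \<phi> i \<in> L2 (time T)" and g: "continuous_on UNIV g"
    and dep: "\<And>x y. (\<forall>i<m. x i = y i) \<Longrightarrow> g x = g y"
  shows "(\<lambda>\<omega>. g (\<lambda>i. F (\<phi> i) \<omega>)) \<in> borel_measurable M"
proof -
  have [measurable]: "g \<in> borel_measurable borel" using g by (rule borel_measurable_continuous_onI)
  \<comment> \<open>Nothing is known about \<open>F (\<phi> i)\<close> for \<open>i \<ge> m\<close>,
    so the sequence is truncated; \<open>g\<close> cannot notice.\<close>
  have [measurable]: "(\<lambda>\<omega>. (\<lambda>i. if i < m then F (\<phi> i) \<omega> else 0)) \<in> borel_measurable M"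
  proof (rule measurable_coordinatewise_then_product)
    show "(\<lambda>\<omega>. if i < m then F (\<phi> i) \<omega> else 0) \<in> borel_measurable M" for i
      using F_measurable[OF \<phi>[of i]] by (cases "i < m") auto
  qed
  have "(\<lambda>\<omega>. g (\<lambda>i. F (\<phi> i) \<omega>)) = (\<lambda>\<omega>. g (\<lambda>i. if i < m then F (\<phi> i) \<omega> else 0))"
    by (intro ext dep) simp
  then show ?thesis by simp
qed

lemma C1_poly_growth_L2:
  assumes f: "C1_poly_growth m f" and \<phi>: "\<And>i. i < m \<Longrightarrow> \<phi> i \<in> L2 (time T)"
  shows "(\<lambda>\<omega>. f (\<lambda>i. F (\<phi> i) \<omega>)) \<in> L2 M"
    and "j < m \<Longrightarrow> (\<lambda>\<omega>. coord_deriv j f (\<lambda>i. F (\<phi> i) \<omega>)) \<in> L2 M"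
proof -
  have dep: "\<And>x y. (\<forall>i<m. x i = y i) \<Longrightarrow> f x = f y" using f by (auto simp: C1_poly_growth_def)
  obtain C k where "\<And>x. \<bar>f x\<bar> \<le> C * (1 + (\<Sum>i<m. \<bar>x i\<bar>)) ^ k" using f by (auto simp: C1_poly_growth_def)
  then show "(\<lambda>\<omega>. f (\<lambda>i. F (\<phi> i) \<omega>)) \<in> L2 M"
    using f by (intro poly_growth_L2[OF \<phi>] cylinder_measurable[OF \<phi>] dep) (auto simp: C1_poly_growth_def)
  assume j: "j < m"
  have "\<exists>C (k::nat). \<forall>x. \<bar>coord_deriv j f x\<bar> \<le> C * (1 + (\<Sum>i<m. \<bar>x i\<bar>)) ^ k"
    using f j unfolding C1_poly_growth_def by blast
  then obtain C k where "\<And>x. \<bar>coord_deriv j f x\<bar> \<le> C * (1 + (\<Sum>i<m. \<bar>x i\<bar>)) ^ k" by blast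
  then show "(\<lambda>\<omega>. coord_deriv j f (\<lambda>i. F (\<phi> i) \<omega>)) \<in> L2 M"
    using f j by (intro poly_growth_L2[OF \<phi>] cylinder_measurable[OF \<phi>] coord_deriv_dep[OF dep]) (auto simp: C1_poly_growth_def)
qed

lemma bounded_mult_L2:
  fixes X Y :: "'w \<Rightarrow> real"
  assumes "Y \<in> L2 M" "bounded_rv M X"
  shows "(\<lambda>\<omega>. X \<omega> * Y \<omega>) \<in> L2 M"
proof -
  have [measurable]: "X \<in> borel_measurable M" "Y \<in> borel_measurable M" using assms by (auto simp: L2_def bounded_rv_def)
  obtain C where C: "\<And>\<omega>. \<omega> \<in> space M \<Longrightarrow> \<bar>X \<omega>\<bar> \<le> C" using assms by (auto simp: bounded_rv_def)
  have "(\<lambda>\<omega>. 0 + C *\<^sub>R Y \<omega>) \<in> L2 M" using assms(1) by (intro L2_lin L2_zero)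
  then show ?thesis
  proof (rule L2_bound)
    show "AE \<omega> in M. norm (X \<omega> * Y \<omega>) \<le> norm (0 + C *\<^sub>R Y \<omega>)"
    proof (rule AE_I2)
      fix \<omega> assume "\<omega> \<in> space M"
      then have "\<bar>X \<omega>\<bar> \<le> \<bar>C\<bar>" using C by fastforce
      then show "norm (X \<omega> * Y \<omega>) \<le> norm (0 + C *\<^sub>R Y \<omega>)" by (simp add: abs_mult mult_right_mono)
    qed
  qed measurable
qed

lemma gaussian_ibp_nondegenerate:
  assumes \<psi>: "\<psi> \<in> L2 (time T)" and \<phi>: "\<And>i. i < m \<Longrightarrow> \<phi> i \<in> L2 (time T)"
    and X: "X \<in> borel_measurable (orth_sigma \<psi>)" and Xb: "bounded_rv M X"
    and f: "C1_poly_growth m f" and nd: "ip \<psi> \<psi> \<noteq> 0"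
  shows "(\<integral>\<omega>. X \<omega> * f (\<lambda>i. F (\<phi> i) \<omega>) * F \<psi> \<omega> \<partial>M) =
     (\<integral>\<omega>. X \<omega> * (\<Sum>i<m. ip (\<phi> i) \<psi> * coord_deriv i f (\<lambda>i. F (\<phi> i) \<omega>)) \<partial>M)"
proof -
  note [measurable] = F_measurable[OF \<psi>] X
  have XM [measurable]: "X \<in> borel_measurable M" using Xb by (simp add: bounded_rv_def)
  have dep: "\<And>x y. (\<forall>i<m. x i = y i) \<Longrightarrow> f x = f y" using f by (auto simp: C1_poly_growth_def)
  have cont: "\<And>i. i < m \<Longrightarrow> continuous_on UNIV (coord_deriv i f)" "continuous_on UNIV f"
    and diff: "\<And>i x. i < m \<Longrightarrow> (\<lambda>r. f (x(i := r))) differentiable (at (x i))"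
    using f by (auto simp: C1_poly_growth_def)
  have fm [measurable]: "f \<in> borel_measurable borel" using cont(2) by (rule borel_measurable_continuous_onI)
  have cm [measurable]: "coord_deriv i f \<in> borel_measurable borel" if "i < m" for i
    using cont(1)[OF that] by (rule borel_measurable_continuous_onI)
  \<comment> \<open>\<open>\<alpha> i\<close> is the regression coefficient of
    \<open>F (\<phi> i)\<close> on \<open>F \<psi>\<close>, and \<open>Y i\<close> is the residual,
    whose kernel is orthogonal to \<psi>. Padding by zero beyond \<open>m\<close> keeps every
    \<open>Y i\<close> measurable.\<close>
  define \<alpha> where "\<alpha> i = ip (\<phi> i) \<psi> / ip \<psi> \<psi>" for i
  define Y where "Y i = (if i < m then F (\<lambda>s. \<phi> i s + (- \<alpha> i) *\<^sub>R \<psi> s) else (\<lambda>_. 0))" for i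
  have Ym [measurable]: "Y i \<in> borel_measurable (orth_sigma \<psi>)" for i
  proof (cases "i < m")
    case True
    have "ip (\<lambda>s. \<phi> i s + (- \<alpha> i) *\<^sub>R \<psi> s) \<psi> = 0"
      unfolding ip_lin_left[OF \<phi>[OF True] \<psi> \<psi>] using nd by (simp add: \<alpha>_def)
    moreover have "(\<lambda>s. \<phi> i s + (- \<alpha> i) *\<^sub>R \<psi> s) \<in> L2 (time T)" by (rule L2_lin[OF \<phi>[OF True] \<psi>])
    ultimately show ?thesis using True unfolding Y_def by (simp only: if_True) (rule F_orth_measurable)
  qed (simp add: Y_def)
  have W: "AE \<omega> in M. \<forall>i<m. F (\<phi> i) \<omega> = Y i \<omega> + \<alpha> i * F \<psi> \<omega>"
  proof -
    have "AE \<omega> in M. i < m \<longrightarrow> F (\<phi> i) \<omega> = Y i \<omega> + \<alpha> i * F \<psi> \<omega>" for i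
    proof (cases "i < m")
      case True
      from F_lin[OF \<phi>[OF True] \<psi>, of "- \<alpha> i"] show ?thesis by eventually_elim (simp add: Y_def)
    qed simp
    then show ?thesis by (simp add: AE_all_countable)
  qed
  let ?H1 = "\<lambda>(\<omega>, n). X \<omega> * f (\<lambda>i. Y i \<omega> + \<alpha> i * n) * n"
  let ?H2 = "\<lambda>(\<omega>, n). X \<omega> * (\<Sum>i<m. ip (\<phi> i) \<psi> * coord_deriv i f (\<lambda>i. Y i \<omega> + \<alpha> i * n))"
  have lm [measurable]: "(\<lambda>p. (\<lambda>i. Y i (fst p) + \<alpha> i * snd p)) \<in> borel_measurable (orth_sigma \<psi> \<Otimes>\<^sub>M borel)"
    by (intro measurable_coordinatewise_then_product) measurable
  have H1 [measurable]: "?H1 \<in> borel_measurable (orth_sigma \<psi> \<Otimes>\<^sub>M borel)"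
    unfolding split_beta' by measurable
  have H2 [measurable]: "?H2 \<in> borel_measurable (orth_sigma \<psi> \<Otimes>\<^sub>M borel)"
    unfolding split_beta' by measurable
  have pm [measurable]: "(\<lambda>\<omega>. (\<omega>, F \<psi> \<omega>)) \<in> M \<rightarrow>\<^sub>M orth_sigma \<psi> \<Otimes>\<^sub>M borel"
    by (intro measurable_Pair orth_sigma_ident F_measurable \<psi>)
  have f_eq: "AE \<omega> in M. f (\<lambda>i. F (\<phi> i) \<omega>) = f (\<lambda>i. Y i \<omega> + \<alpha> i * F \<psi> \<omega>)"
    using W by eventually_elim (auto intro!: dep)
  have c_eq: "AE \<omega> in M. \<forall>j<m. coord_deriv j f (\<lambda>i. F (\<phi> i) \<omega>) = coord_deriv j f (\<lambda>i. Y i \<omega> + \<alpha> i * F \<psi> \<omega>)"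
    using W by eventually_elim (auto intro!: coord_deriv_dep[OF dep])
  note fL2 = C1_poly_growth_L2[OF f \<phi>]
  have i1: "integrable M (\<lambda>\<omega>. X \<omega> * f (\<lambda>i. F (\<phi> i) \<omega>) * F \<psi> \<omega>)"
    by (intro L2_mult_integrable bounded_mult_L2 fL2 F_L2 \<psi> Xb) auto
  have i2: "integrable M (\<lambda>\<omega>. X \<omega> * (\<Sum>i<m. ip (\<phi> i) \<psi> * coord_deriv i f (\<lambda>i. F (\<phi> i) \<omega>)))"
  proof -
    have "X \<in> L2 M" using bounded_mult_L2[of "\<lambda>_. 1" X] Xb by (simp add: L2_def)
    then have "integrable M (\<lambda>\<omega>. \<Sum>i<m. ip (\<phi> i) \<psi> * (X \<omega> * coord_deriv i f (\<lambda>i. F (\<phi> i) \<omega>)))"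
      by (intro Bochner_Integration.integrable_sum integrable_mult_right L2_mult_integrable fL2) auto
    then show ?thesis by (simp add: sum_distrib_left mult.left_commute)
  qed
  have e1: "AE \<omega> in M. X \<omega> * f (\<lambda>i. F (\<phi> i) \<omega>) * F \<psi> \<omega> = ?H1 (\<omega>, F \<psi> \<omega>)"
    using f_eq by eventually_elim simp
  have e2: "AE \<omega> in M. X \<omega> * (\<Sum>i<m. ip (\<phi> i) \<psi> * coord_deriv i f (\<lambda>i. F (\<phi> i) \<omega>)) = ?H2 (\<omega>, F \<psi> \<omega>)"
    using c_eq by eventually_elim simp
  have m1: "(\<lambda>\<omega>. ?H1 (\<omega>, F \<psi> \<omega>)) \<in> borel_measurable M" by (rule measurable_compose[OF pm H1])
  have m2: "(\<lambda>\<omega>. ?H2 (\<omega>, F \<psi> \<omega>)) \<in> borel_measurable M" by (rule measurable_compose[OF pm H2])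
  have j1: "integrable M (\<lambda>\<omega>. ?H1 (\<omega>, F \<psi> \<omega>))"
    using i1 integrable_cong_AE[OF borel_measurable_integrable[OF i1] m1 e1] by blast
  have j2: "integrable M (\<lambda>\<omega>. ?H2 (\<omega>, F \<psi> \<omega>))"
    using i2 integrable_cong_AE[OF borel_measurable_integrable[OF i2] m2 e2] by blast
  have inner: "(\<integral>\<omega>'. ?H1 (\<omega>, F \<psi> \<omega>') \<partial>M) = (\<integral>\<omega>'. ?H2 (\<omega>, F \<psi> \<omega>') \<partial>M)" for \<omega>
    using F_gaussian[OF \<psi>]
  proof (cases rule: centered_gaussian_cases)
    case 1
    have "ip \<psi> \<psi> = 0" unfolding F_var[OF \<psi>, symmetric]
      by (rule integral_eq_zero_AE) (use 1(1) in \<open>auto elim!: eventually_mono\<close>)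
    with nd show ?thesis by simp
  next
    case (2 \<sigma>)
    have s2: "\<sigma>\<^sup>2 = ip \<psi> \<psi>" using 2(3) F_var[OF \<psi>] by simp
    let ?g = "\<lambda>n. f (\<lambda>i. Y i \<omega> + \<alpha> i * n)"
    let ?g' = "\<lambda>n. \<Sum>i<m. \<alpha> i * coord_deriv i f (\<lambda>i. Y i \<omega> + \<alpha> i * n)"
    have lin: "continuous_on UNIV (\<lambda>n. (\<lambda>i. Y i \<omega> + \<alpha> i * n))"
      by (intro continuous_on_coordinatewise_then_product continuous_intros)
    have cg': "continuous_on UNIV (\<lambda>n. coord_deriv i f (\<lambda>i. Y i \<omega> + \<alpha> i * n))" if "i < m" for i
      by (rule continuous_on_compose2[OF cont(1)[OF that] lin]) simp
    have g'c: "continuous_on UNIV ?g'" using cg' by (intro continuous_intros) auto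
    have gc: "continuous_on UNIV ?g" by (rule continuous_on_compose2[OF cont(2) lin]) simp
    have [measurable]: "?g \<in> borel_measurable borel" "?g' \<in> borel_measurable borel"
      using gc g'c by (auto intro: borel_measurable_continuous_onI)
    obtain C k where b: "\<And>x. \<bar>f x\<bar> \<le> C * (1 + (\<Sum>i<m. \<bar>x i\<bar>)) ^ k" using f by (auto simp: C1_poly_growth_def)
    have "\<exists>C (k::nat). \<forall>n. \<bar>?g' n\<bar> \<le> C * (1 + \<bar>n\<bar>) ^ k"
    proof (rule poly_bound_sum)
      fix i assume "i < m"
      then have "\<exists>C (k::nat). \<forall>x. \<bar>coord_deriv i f x\<bar> \<le> C * (1 + (\<Sum>i<m. \<bar>x i\<bar>)) ^ k"
        using f unfolding C1_poly_growth_def by blast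
      then obtain C k where "\<And>x. \<bar>coord_deriv i f x\<bar> \<le> C * (1 + (\<Sum>i<m. \<bar>x i\<bar>)) ^ k" by blast
      from poly_growth_along_line[of "coord_deriv i f", OF this]
      show "\<exists>C (k::nat). \<forall>n. \<bar>coord_deriv i f (\<lambda>i. Y i \<omega> + \<alpha> i * n)\<bar> \<le> C * (1 + \<bar>n\<bar>) ^ k"
        by (intro exI allI)
    qed
    then obtain C' k' where b': "\<And>n. \<bar>?g' n\<bar> \<le> C' * (1 + \<bar>n\<bar>) ^ k'" by blast
    have dg: "(?g has_real_derivative ?g' n) (at n)" for n
      by (rule DERIV_along_line[OF dep diff cont(1)]) blast+
    have S: "(\<integral>n. normal_density 0 \<sigma> n * (?g n * n) \<partial>lborel) = \<sigma>\<^sup>2 * (\<integral>n. normal_density 0 \<sigma> n * ?g' n \<partial>lborel)"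
      by (rule Stein_normal_density[OF 2(1) dg g'c poly_growth_along_line[of f, OF b] b'])
    have "(\<integral>\<omega>'. ?H1 (\<omega>, F \<psi> \<omega>') \<partial>M) = X \<omega> * (\<integral>\<omega>'. ?g (F \<psi> \<omega>') * F \<psi> \<omega>' \<partial>M)"
      by (simp add: mult.assoc)
    also have "(\<integral>\<omega>'. ?g (F \<psi> \<omega>') * F \<psi> \<omega>' \<partial>M) = (\<integral>n. normal_density 0 \<sigma> n * (?g n * n) \<partial>lborel)"
      by (rule distributed_integral[OF 2(2), symmetric]) auto
    also have "\<dots> = \<sigma>\<^sup>2 * (\<integral>\<omega>'. ?g' (F \<psi> \<omega>') \<partial>M)"
      unfolding S by (subst distributed_integral[OF 2(2)]) auto
    also have "\<dots> = (\<integral>\<omega>'. \<sigma>\<^sup>2 * ?g' (F \<psi> \<omega>') \<partial>M)" by simp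
    also have "\<dots> = (\<integral>\<omega>'. (\<Sum>i<m. ip (\<phi> i) \<psi> * coord_deriv i f (\<lambda>i. Y i \<omega> + \<alpha> i * F \<psi> \<omega>')) \<partial>M)"
      unfolding sum_distrib_left s2 \<alpha>_def using nd by (simp add: mult.assoc[symmetric])
    also have "X \<omega> * \<dots> = (\<integral>\<omega>'. ?H2 (\<omega>, F \<psi> \<omega>') \<partial>M)" by simp
    finally show ?thesis .
  qed
  have "(\<integral>\<omega>. X \<omega> * f (\<lambda>i. F (\<phi> i) \<omega>) * F \<psi> \<omega> \<partial>M) = (\<integral>\<omega>. ?H1 (\<omega>, F \<psi> \<omega>) \<partial>M)"
    by (rule integral_cong_AE[OF borel_measurable_integrable[OF i1] m1 e1])
  also have "\<dots> = (\<integral>\<omega>. (\<integral>\<omega>'. ?H1 (\<omega>, F \<psi> \<omega>') \<partial>M) \<partial>M)" by (rule orth_fubini[OF \<psi> H1 j1])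
  also have "\<dots> = (\<integral>\<omega>. (\<integral>\<omega>'. ?H2 (\<omega>, F \<psi> \<omega>') \<partial>M) \<partial>M)" by (simp only: inner)
  also have "\<dots> = (\<integral>\<omega>. ?H2 (\<omega>, F \<psi> \<omega>) \<partial>M)" by (rule orth_fubini[OF \<psi> H2 j2, symmetric])
  also have "\<dots> = (\<integral>\<omega>. X \<omega> * (\<Sum>i<m. ip (\<phi> i) \<psi> * coord_deriv i f (\<lambda>i. F (\<phi> i) \<omega>)) \<partial>M)"
    by (rule integral_cong_AE[OF borel_measurable_integrable[OF i2] m2 e2, symmetric])
  finally show ?thesis .
qed

text \<open>The regression coefficients are meaningless when \<psi> has norm zero; but then
  \<open>F \<psi>\<close> is almost surely zero, all covariances with it vanish, and both sides are
  zero.\<close>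

lemma gaussian_ibp:
  assumes \<psi>: "\<psi> \<in> L2 (time T)" and \<phi>: "\<And>i. i < m \<Longrightarrow> \<phi> i \<in> L2 (time T)"
    and X: "X \<in> borel_measurable (orth_sigma \<psi>)" and Xb: "bounded_rv M X"
    and f: "C1_poly_growth m f"
  shows "(\<integral>\<omega>. X \<omega> * f (\<lambda>i. F (\<phi> i) \<omega>) * F \<psi> \<omega> \<partial>M) =
     (\<integral>\<omega>. X \<omega> * (\<Sum>i<m. ip (\<phi> i) \<psi> * coord_deriv i f (\<lambda>i. F (\<phi> i) \<omega>)) \<partial>M)"
proof (cases "ip \<psi> \<psi> = 0")
  case False
  then show ?thesis by (intro gaussian_ibp_nondegenerate assms)
next
  case True
  then have "(\<integral>\<omega>. (F \<psi> \<omega>)\<^sup>2 \<partial>M) = 0" by (simp add: F_var[OF \<psi>])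
  then have z: "AE \<omega> in M. F \<psi> \<omega> = 0"
    using integral_nonneg_eq_0_iff_AE[of M "\<lambda>\<omega>. (F \<psi> \<omega>)\<^sup>2"] L2_integrable[OF F_L2[OF \<psi>]] by simp
  have "ip (\<phi> i) \<psi> = 0" if "i < m" for i
    unfolding F_cov[OF \<phi>[OF that] \<psi>, symmetric]
    by (rule integral_eq_zero_AE) (use z in \<open>auto elim!: eventually_mono\<close>)
  moreover have "(\<integral>\<omega>. X \<omega> * f (\<lambda>i. F (\<phi> i) \<omega>) * F \<psi> \<omega> \<partial>M) = 0"
    by (rule integral_eq_zero_AE) (use z in \<open>auto elim!: eventually_mono\<close>)
  ultimately show ?thesis by simp
qed

text \<open>Integration by parts for the coordinate function, whose derivative is \<open>1\<close>.
  Only \<psi> is tied to \<open>X\<close>; \<phi> is arbitrary, which later allows factors that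
  start at different times.\<close>

lemma F_isometry_term:
  assumes "\<phi> \<in> L2 (time T)" "\<psi> \<in> L2 (time T)" "X \<in> borel_measurable (orth_sigma \<psi>)" "bounded_rv M X"
  shows "(\<integral>\<omega>. X \<omega> * F \<phi> \<omega> * F \<psi> \<omega> \<partial>M) = ip \<phi> \<psi> * (\<integral>\<omega>. X \<omega> \<partial>M)"
proof -
  let ?f = "\<lambda>x :: nat \<Rightarrow> real. x 0"
  have cd: "coord_deriv 0 ?f = (\<lambda>_. 1)" by (simp add: coord_deriv_def fun_eq_iff)
  have "C1_poly_growth 1 ?f"
    unfolding C1_poly_growth_def
  proof (intro conjI allI impI)
    show "\<exists>C (k::nat). \<forall>x::nat \<Rightarrow> real. \<bar>x 0\<bar> \<le> C * (1 + (\<Sum>i<1. \<bar>x i\<bar>)) ^ k"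
      by (intro exI[of _ 1] exI[of _ "1::nat"]) simp
    fix i :: nat assume "i < 1"
    then have i: "i = 0" by simp
    show "continuous_on UNIV (coord_deriv i ?f)" unfolding i cd by simp
    show "(\<lambda>r. (x(i := r)) 0) differentiable at (x i)" for x :: "nat \<Rightarrow> real" by (simp add: i)
    show "\<exists>C (k::nat). \<forall>x. \<bar>coord_deriv i ?f x\<bar> \<le> C * (1 + (\<Sum>i<1. \<bar>x i\<bar>)) ^ k"
      unfolding i cd by (intro exI[of _ 1] exI[of _ "0::nat"]) simp
  qed (auto intro: continuous_on_product_coordinates)
  from gaussian_ibp[OF assms(2) _ assms(3,4) this, of "\<lambda>_. \<phi>"] assms(1)
  show ?thesis by (simp add: cd mult.commute)
qed

end

section \<open>Stochastic integral and divergence\<close>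

lemma time_finite: "finite_measure (time T)"
  by (rule finite_measureI) (simp add: space_restrict_space emeasure_restrict_space emeasure_lborel_Icc_eq)

context gaussian_noise begin

abbreviation M\<^sub>T :: "('w \<times> real) measure" where
  "M\<^sub>T \<equiv> M \<Otimes>\<^sub>M time T"

sublocale time: finite_measure "time T" by (rule time_finite)

sublocale MT: pair_sigma_finite M "time T" ..

lemma indicator_L2:
  fixes h :: 'h
  assumes [measurable]: "A \<in> sets borel"
  shows "(\<lambda>s. indicat_real A s *\<^sub>R h) \<in> L2 (time T)"
proof -
  have m: "(\<lambda>s. indicat_real A s *\<^sub>R h) \<in> borel_measurable (time T)"
    by (rule measurable_restrict_space1) measurable
  have "(\<lambda>_. h) \<in> L2 (time T)" by (simp add: L2_def)
  then show ?thesis by (rule L2_bound[OF _ m]) (auto simp: indicator_def)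
qed

lemma integrable_snd:
  fixes g :: "real \<Rightarrow> real"
  assumes "integrable (time T) g"
  shows "integrable M\<^sub>T (\<lambda>p. g (snd p))"
proof (rule integrableI_bounded)
  have [measurable]: "g \<in> borel_measurable (time T)" using assms by simp
  show "(\<lambda>p. g (snd p)) \<in> borel_measurable M\<^sub>T" by measurable
  have "(\<integral>\<^sup>+p. ennreal (norm (g (snd p))) \<partial>M\<^sub>T) = (\<integral>\<^sup>+\<omega>. (\<integral>\<^sup>+s. ennreal (norm (g s)) \<partial>time T) \<partial>M)"
    by (subst time.nn_integral_fst[symmetric]) auto
  also have "\<dots> = (\<integral>\<^sup>+s. ennreal (norm (g s)) \<partial>time T)"
    by (simp add: emeasure_space_1)
  also have "\<dots> < \<infinity>" using assms unfolding integrable_iff_bounded by blast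
  finally show "(\<integral>\<^sup>+p. ennreal (norm (g (snd p))) \<partial>M\<^sub>T) < \<infinity>" .
qed

lemma bounded_tensor_L2:
  assumes X: "bounded_rv M X" and \<psi>: "\<psi> \<in> L2 (time T)"
  shows "(\<lambda>(\<omega>, s). X \<omega> *\<^sub>R \<psi> s) \<in> L2 M\<^sub>T"
proof -
  have [measurable]: "X \<in> borel_measurable M" "\<psi> \<in> borel_measurable (time T)"
    using assms by (auto simp: L2_def bounded_rv_def)
  obtain C where C: "\<And>\<omega>. \<omega> \<in> space M \<Longrightarrow> \<bar>X \<omega>\<bar> \<le> C" using X by (auto simp: bounded_rv_def)
  have "integrable M\<^sub>T (\<lambda>p. (norm (C *\<^sub>R \<psi> (snd p)))\<^sup>2)"
    using integrable_snd[OF integrable_mult_right[OF L2_integrable[OF \<psi>], of "C\<^sup>2"]]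
    by (simp add: power_mult_distrib)
  then have "(\<lambda>p. C *\<^sub>R \<psi> (snd p)) \<in> L2 M\<^sub>T" by (simp add: L2_def)
  then show ?thesis
  proof (rule L2_bound)
    show "AE p in M\<^sub>T. norm (case p of (\<omega>, s) \<Rightarrow> X \<omega> *\<^sub>R \<psi> s) \<le> norm (C *\<^sub>R \<psi> (snd p))"
    proof (rule AE_I2)
      fix p assume "p \<in> space M\<^sub>T"
      then have "\<bar>X (fst p)\<bar> \<le> C" using C by (auto simp: space_pair_measure)
      then show "norm (case p of (\<omega>, s) \<Rightarrow> X \<omega> *\<^sub>R \<psi> s) \<le> norm (C *\<^sub>R \<psi> (snd p))"
        by (auto simp: split_beta' intro!: mult_right_mono)
    qed
  qed measurable
qed

end

text \<open>The filtration enters only through the inclusion \<open>\<FF>_orth\<close>, which makes \<open>\<FF> c\<close> independent of the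
  noise after \<open>c\<close>.\<close>

locale noise_filtration = gaussian_noise +
  fixes \<FF> :: "real \<Rightarrow> 'a measure"
  assumes space_\<FF>: "space (\<FF> c) = space M"
    and \<FF>_mono: "c \<le> c' \<Longrightarrow> sets (\<FF> c) \<subseteq> sets (\<FF> c')"
    and \<FF>_orth: "\<psi> \<in> L2 (time T) \<Longrightarrow> (\<And>s. s \<le> c \<Longrightarrow> \<psi> s = 0) \<Longrightarrow> sets (\<FF> c) \<subseteq> sets (orth_sigma \<psi>)"
begin

lemma bounded_rv_mono:
  assumes "bounded_rv (\<FF> c) X" "c \<le> c'"
  shows "bounded_rv (\<FF> c') X"
proof -
  have "subalgebra (\<FF> c') (\<FF> c)" unfolding subalgebra_def space_\<FF> by (intro conjI refl \<FF>_mono assms)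
  from measurable_from_subalg[OF this] assms(1) show ?thesis
    unfolding bounded_rv_def space_\<FF> by blast
qed

lemma measurable_\<FF>_orth:
  assumes "bounded_rv (\<FF> c) X" "\<psi> \<in> L2 (time T)" "\<And>s. s \<le> c \<Longrightarrow> \<psi> s = 0"
  shows "X \<in> borel_measurable (orth_sigma \<psi>)"
proof (rule measurable_from_subalg)
  show "subalgebra (orth_sigma \<psi>) (\<FF> c)"
    unfolding subalgebra_def space_\<FF> space_orth_sigma by (intro conjI refl \<FF>_orth assms)
  show "X \<in> borel_measurable (\<FF> c)" using assms(1) unfolding bounded_rv_def by blast
qed

lemma bounded_rv_M:
  assumes "bounded_rv (\<FF> c) X"
  shows "bounded_rv M X"
proof -
  \<comment> \<open>The zero function vanishes up to every \<open>c\<close>, so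
    \<open>\<FF> c\<close> lies below its \<open>orth_sigma\<close> and thereby below
    \<open>M\<close>.\<close>
  have "X \<in> borel_measurable M"
    by (rule measurable_orth_sigma_imp[OF measurable_\<FF>_orth[OF assms zero_L2 refl]])
  with assms show ?thesis unfolding bounded_rv_def space_\<FF> by blast
qed

lemma bounded_rv_mult:
  assumes "bounded_rv N X" "bounded_rv N Y"
  shows "bounded_rv N (\<lambda>\<omega>. X \<omega> * Y \<omega>)"
proof -
  obtain C C' where C: "\<And>\<omega>. \<omega> \<in> space N \<Longrightarrow> \<bar>X \<omega>\<bar> \<le> C" "\<And>\<omega>. \<omega> \<in> space N \<Longrightarrow> \<bar>Y \<omega>\<bar> \<le> C'"
    using assms unfolding bounded_rv_def by blast
  have "\<forall>\<omega>\<in>space N. \<bar>X \<omega> * Y \<omega>\<bar> \<le> C * C'"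
    unfolding abs_mult
  proof
    fix \<omega> assume w: "\<omega> \<in> space N"
    have "0 \<le> C" using C(1)[OF w] by linarith
    then show "\<bar>X \<omega>\<bar> * \<bar>Y \<omega>\<bar> \<le> C * C'" by (intro mult_mono C w) auto
  qed
  moreover have "(\<lambda>\<omega>. X \<omega> * Y \<omega>) \<in> borel_measurable N"
    using assms unfolding bounded_rv_def by (intro borel_measurable_times) blast+
  ultimately show ?thesis unfolding bounded_rv_def by blast
qed

text \<open>Arbitrary deterministic \<open>\<psi>\<close> after the time \<open>c\<close> cover the elementary integrals against every
  \<open>W\<^sup>k\<close> stopped at \<open>t\<close>, without splitting time intervals.\<close>

inductive ito :: "('a \<times> real \<Rightarrow> 'b) \<Rightarrow> ('a \<Rightarrow> real) \<Rightarrow> bool" where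
  base: "bounded_rv (\<FF> c) X \<Longrightarrow> \<psi> \<in> L2 (time T) \<Longrightarrow> (\<And>s. s \<le> c \<Longrightarrow> \<psi> s = 0) \<Longrightarrow>
     ito (\<lambda>(\<omega>, s). X \<omega> *\<^sub>R \<psi> s) (\<lambda>\<omega>. X \<omega> * F \<psi> \<omega>)"
| lin: "ito u Y \<Longrightarrow> ito u' Y' \<Longrightarrow> ito (\<lambda>p. u p + r *\<^sub>R u' p) (\<lambda>\<omega>. Y \<omega> + r *\<^sub>R Y' \<omega>)"
| lim: "(\<And>n. ito (us n) (Ys n)) \<Longrightarrow> L2_tendsto M\<^sub>T us u \<Longrightarrow> L2_tendsto M Ys Y \<Longrightarrow> ito u Y"

lemma ito_L2: "ito u Y \<Longrightarrow> u \<in> L2 M\<^sub>T \<and> Y \<in> L2 M"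
proof (induction rule: ito.induct)
  case (base c X \<psi>)
  then show ?case by (auto intro!: bounded_tensor_L2 bounded_mult_L2 F_L2 bounded_rv_M)
next
  case (lin u Y u' Y' r)
  then show ?case using L2_lin[of u M\<^sub>T u' r] L2_lin[of Y M Y' r] by auto
next
  case (lim us Ys u Y)
  then show ?case by (auto simp: L2_tendsto_def)
qed

text \<open>Both sides are linear and L2-continuous in the pair \<open>(u, Y)\<close>, so it is
  enough to check the generating products. With a second pair of the relation for \<open>A\<close>
  and \<open>B\<close> this becomes the isometry; with a smooth variable and its derivative, the
  duality that defines the divergence.\<close>

lemma ito_dual:
  assumes A: "A \<in> L2 M" and B: "B \<in> L2 M\<^sub>T"
    and base: "\<And>c X \<psi>. bounded_rv (\<FF> c) X \<Longrightarrow> \<psi> \<in> L2 (time T) \<Longrightarrow> (\<And>s. s \<le> c \<Longrightarrow> \<psi> s = 0) \<Longrightarrow>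
       (\<integral>\<omega>. A \<omega> * (X \<omega> * F \<psi> \<omega>) \<partial>M) = (\<integral>(\<omega>, s). B (\<omega>, s) \<bullet> (X \<omega> *\<^sub>R \<psi> s) \<partial>M\<^sub>T)"
    and ito: "ito u Y"
  shows "(\<integral>\<omega>. A \<omega> * Y \<omega> \<partial>M) = (\<integral>p. B p \<bullet> u p \<partial>M\<^sub>T)"
  using ito
proof (induction rule: ito.induct)
  case (base c X \<psi>)
  then show ?case using assms(3)[of c X \<psi>] by (simp add: split_beta')
next
  case (lin u Y u' Y' r)
  have L: "u \<in> L2 M\<^sub>T" "Y \<in> L2 M" "u' \<in> L2 M\<^sub>T" "Y' \<in> L2 M"
    using ito_L2 lin by auto
  have "(\<integral>\<omega>. A \<omega> * (Y \<omega> + r *\<^sub>R Y' \<omega>) \<partial>M) = (\<integral>\<omega>. A \<omega> * Y \<omega> + r * (A \<omega> * Y' \<omega>) \<partial>M)"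
    by (simp add: algebra_simps)
  also have "\<dots> = (\<integral>\<omega>. A \<omega> * Y \<omega> \<partial>M) + r * (\<integral>\<omega>. A \<omega> * Y' \<omega> \<partial>M)"
    using L2_mult_integrable[OF A L(2)] L2_mult_integrable[OF A L(4)] by simp
  also have "\<dots> = (\<integral>p. B p \<bullet> u p + r * (B p \<bullet> u' p) \<partial>M\<^sub>T)"
    using L2_inner_integrable[OF B L(1)] L2_inner_integrable[OF B L(3)] lin.IH by simp
  finally show ?case by (simp add: inner_add_right)
next
  case (lim us Ys u Y)
  have "(\<lambda>n. \<integral>\<omega>. Ys n \<omega> \<bullet> A \<omega> \<partial>M) \<longlonglongrightarrow> (\<integral>\<omega>. Y \<omega> \<bullet> A \<omega> \<partial>M)"
    by (rule L2_tendsto_inner[OF lim.hyps(3) A])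
  moreover have "(\<lambda>n. \<integral>p. us n p \<bullet> B p \<partial>M\<^sub>T) \<longlonglongrightarrow> (\<integral>p. u p \<bullet> B p \<partial>M\<^sub>T)"
    by (rule L2_tendsto_inner[OF lim.hyps(2) B])
  moreover have "(\<integral>\<omega>. Ys n \<omega> \<bullet> A \<omega> \<partial>M) = (\<integral>p. us n p \<bullet> B p \<partial>M\<^sub>T)" for n
    using lim.IH[of n] by (simp add: inner_commute mult.commute)
  ultimately have "(\<integral>\<omega>. Y \<omega> \<bullet> A \<omega> \<partial>M) = (\<integral>p. u p \<bullet> B p \<partial>M\<^sub>T)"
    by (auto intro: LIMSEQ_unique)
  then show ?case by (simp add: inner_commute mult.commute)
qed

lemma integral_tensor:
  assumes X: "bounded_rv M X" "bounded_rv M X'" and \<psi>: "\<psi> \<in> L2 (time T)" "\<psi>' \<in> L2 (time T)"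
  shows "(\<integral>(\<omega>, s). (X \<omega> *\<^sub>R \<psi> s) \<bullet> (X' \<omega> *\<^sub>R \<psi>' s) \<partial>M\<^sub>T) = ip \<psi> \<psi>' * (\<integral>\<omega>. X \<omega> * X' \<omega> \<partial>M)"
proof -
  have eq: "(\<lambda>p. (case p of (\<omega>, s) \<Rightarrow> X \<omega> *\<^sub>R \<psi> s) \<bullet> (case p of (\<omega>, s) \<Rightarrow> X' \<omega> *\<^sub>R \<psi>' s)) =
      (\<lambda>(\<omega>, s). (X \<omega> * X' \<omega>) * (\<psi> s \<bullet> \<psi>' s))"
    by (auto simp: fun_eq_iff)
  have "integrable M\<^sub>T (\<lambda>(\<omega>, s). (X \<omega> * X' \<omega>) * (\<psi> s \<bullet> \<psi>' s))"
    using L2_inner_integrable[OF bounded_tensor_L2[OF X(1) \<psi>(1)] bounded_tensor_L2[OF X(2) \<psi>(2)]]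
    unfolding eq .
  from MT.integral_fst'[OF this]
  have "(\<integral>(\<omega>, s). (X \<omega> * X' \<omega>) * (\<psi> s \<bullet> \<psi>' s) \<partial>M\<^sub>T) = ip \<psi> \<psi>' * (\<integral>\<omega>. X \<omega> * X' \<omega> \<partial>M)"
    by (simp add: mult.commute)
  moreover have "(\<lambda>(\<omega>, s). (X \<omega> *\<^sub>R \<psi> s) \<bullet> (X' \<omega> *\<^sub>R \<psi>' s)) = (\<lambda>(\<omega>, s). (X \<omega> * X' \<omega>) * (\<psi> s \<bullet> \<psi>' s))"
    by (auto simp: fun_eq_iff)
  ultimately show ?thesis by simp
qed

text \<open>The later of the two noises is the one integrated by parts: at its starting time both
  bounded factors are known, and its kernel vanishes up to then. The case of the opposite order
  follows by symmetry.\<close>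

lemma ito_isometry_term:
  assumes "bounded_rv (\<FF> c) X" "\<psi> \<in> L2 (time T)" "\<And>s. s \<le> c \<Longrightarrow> \<psi> s = 0"
    and "bounded_rv (\<FF> c') X'" "\<psi>' \<in> L2 (time T)" "\<And>s. s \<le> c' \<Longrightarrow> \<psi>' s = 0"
  shows "(\<integral>\<omega>. (X \<omega> * F \<psi> \<omega>) * (X' \<omega> * F \<psi>' \<omega>) \<partial>M) = ip \<psi> \<psi>' * (\<integral>\<omega>. X \<omega> * X' \<omega> \<partial>M)"
proof -
  have *: "(\<integral>\<omega>. (X \<omega> * F \<psi> \<omega>) * (X' \<omega> * F \<psi>' \<omega>) \<partial>M) = ip \<psi> \<psi>' * (\<integral>\<omega>. X \<omega> * X' \<omega> \<partial>M)"
    if "c \<le> c'" and X: "bounded_rv (\<FF> c) X" "\<psi> \<in> L2 (time T)"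
      and X': "bounded_rv (\<FF> c') X'" "\<psi>' \<in> L2 (time T)" "\<And>s. s \<le> c' \<Longrightarrow> \<psi>' s = 0"
    for c c' X X' \<psi> \<psi>'
  proof -
    have b: "bounded_rv (\<FF> c') (\<lambda>\<omega>. X \<omega> * X' \<omega>)"
      by (intro bounded_rv_mult bounded_rv_mono[OF X(1) that(1)] X')
    have "(\<integral>\<omega>. (X \<omega> * F \<psi> \<omega>) * (X' \<omega> * F \<psi>' \<omega>) \<partial>M) = (\<integral>\<omega>. (X \<omega> * X' \<omega>) * F \<psi> \<omega> * F \<psi>' \<omega> \<partial>M)"
      by (simp add: ac_simps)
    also have "\<dots> = ip \<psi> \<psi>' * (\<integral>\<omega>. X \<omega> * X' \<omega> \<partial>M)"
      by (rule F_isometry_term[OF X(2) X'(2) measurable_\<FF>_orth[OF b X'(2,3)] bounded_rv_M[OF b]])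
    finally show ?thesis .
  qed
  show ?thesis
  proof (cases "c \<le> c'")
    case True then show ?thesis by (rule *) (use assms in auto)
  next
    case False
    then have "(\<integral>\<omega>. (X' \<omega> * F \<psi>' \<omega>) * (X \<omega> * F \<psi> \<omega>) \<partial>M) = ip \<psi>' \<psi> * (\<integral>\<omega>. X' \<omega> * X \<omega> \<partial>M)"
      by (intro *[of c' c]) (use assms in auto)
    then show ?thesis by (simp add: mult.commute inner_commute)
  qed
qed

text \<open>The duality principle is applied once for each argument: the outer use reduces
  \<open>(u', Y')\<close> to a generating product, the inner one then reduces \<open>(u, Y)\<close>
  as well.\<close>

lemma ito_isometry:
  assumes "ito u Y" "ito u' Y'"
  shows "(\<integral>\<omega>. Y \<omega> * Y' \<omega> \<partial>M) = (\<integral>p. u p \<bullet> u' p \<partial>M\<^sub>T)"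
proof (rule ito_dual[OF _ _ _ assms(2)])
  show "Y \<in> L2 M" "u \<in> L2 M\<^sub>T" using ito_L2 assms by auto
  fix c X and \<psi> :: "real \<Rightarrow> 'b" assume t: "bounded_rv (\<FF> c) X" "\<psi> \<in> L2 (time T)" "\<And>s. s \<le> c \<Longrightarrow> \<psi> s = 0"
  have "(\<integral>\<omega>. (X \<omega> * F \<psi> \<omega>) * Y \<omega> \<partial>M) = (\<integral>p. (case p of (\<omega>, s) \<Rightarrow> X \<omega> *\<^sub>R \<psi> s) \<bullet> u p \<partial>M\<^sub>T)"
  proof (rule ito_dual[OF _ _ _ assms(1)])
    show "(\<lambda>\<omega>. X \<omega> * F \<psi> \<omega>) \<in> L2 M" "(\<lambda>(\<omega>, s). X \<omega> *\<^sub>R \<psi> s) \<in> L2 M\<^sub>T"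
      using ito_L2[OF ito.base[OF t]] by auto
    fix c' X' and \<psi>' :: "real \<Rightarrow> 'b" assume t': "bounded_rv (\<FF> c') X'" "\<psi>' \<in> L2 (time T)" "\<And>s. s \<le> c' \<Longrightarrow> \<psi>' s = 0"
    show "(\<integral>\<omega>. X \<omega> * F \<psi> \<omega> * (X' \<omega> * F \<psi>' \<omega>) \<partial>M) =
      (\<integral>(\<omega>, s). (case (\<omega>, s) of (\<omega>, s) \<Rightarrow> X \<omega> *\<^sub>R \<psi> s) \<bullet> (X' \<omega> *\<^sub>R \<psi>' s) \<partial>M\<^sub>T)"
      using ito_isometry_term[OF t t'] integral_tensor[OF bounded_rv_M[OF t(1)] bounded_rv_M[OF t'(1)] t(2) t'(2)]
      by simp
  qed
  then show "(\<integral>\<omega>. Y \<omega> * (X \<omega> * F \<psi> \<omega>) \<partial>M) = (\<integral>(\<omega>, s). u (\<omega>, s) \<bullet> (X \<omega> *\<^sub>R \<psi> s) \<partial>M\<^sub>T)"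
    by (simp add: mult.commute inner_commute split_beta')
qed

lemma ito_norm: "ito u Y \<Longrightarrow> (\<integral>\<omega>. (Y \<omega>)\<^sup>2 \<partial>M) = (\<integral>p. (norm (u p))\<^sup>2 \<partial>M\<^sub>T)"
  using ito_isometry[of u Y u Y] by (simp add: power2_eq_square[of "_ :: real"] power2_norm_eq_inner[symmetric])

lemma ito_diff: "ito u Y \<Longrightarrow> ito u' Y' \<Longrightarrow> ito (\<lambda>p. u p - u' p) (\<lambda>\<omega>. Y \<omega> - Y' \<omega>)"
  using ito.lin[of u Y u' Y' "-1"] by simp

lemma ito_zero: "ito (\<lambda>_. 0) (\<lambda>_. 0)"
proof -
  have "bounded_rv (\<FF> 0) (\<lambda>_. 0)" by (auto simp: bounded_rv_def)
  from ito.base[OF this zero_L2 refl] show ?thesis by (simp add: split_beta')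
qed

lemma ito_sum:
  assumes "finite I" "\<And>i. i \<in> I \<Longrightarrow> ito (u i) (Y i)"
  shows "ito (\<lambda>p. \<Sum>i\<in>I. u i p) (\<lambda>\<omega>. \<Sum>i\<in>I. Y i \<omega>)"
  using assms
proof (induction I rule: finite_induct)
  case empty then show ?case by (simp add: ito_zero)
next
  case (insert i I)
  then show ?case using ito.lin[of "u i" "Y i" "\<lambda>p. \<Sum>i\<in>I. u i p" "\<lambda>\<omega>. \<Sum>i\<in>I. Y i \<omega>" 1] by simp
qed

text \<open>A constant sequence converges to each of its almost everywhere modifications, so closure
  under L2 limits already contains this invariance.\<close>

lemma ito_AE_cong:
  assumes "ito u Y" "u' \<in> borel_measurable M\<^sub>T" "AE p in M\<^sub>T. u p = u' p"
    and "Y' \<in> borel_measurable M" "AE \<omega> in M. Y \<omega> = Y' \<omega>"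
  shows "ito u' Y'"
  by (rule ito.lim[of "\<lambda>_. u" "\<lambda>_. Y"]) (use assms ito_L2[OF assms(1)] in \<open>auto intro!: L2_tendsto_const\<close>)

text \<open>By the isometry the integrals of a convergent sequence of integrands are Cauchy.
  Existence of all stochastic integrals below comes from here.\<close>

lemma ito_lim_exists:
  assumes "\<And>n. ito (us n) (Ys n)" "L2_tendsto M\<^sub>T us u"
  shows "\<exists>Y. L2_tendsto M Ys Y \<and> ito u Y"
proof -
  have us: "\<And>n. us n \<in> L2 M\<^sub>T" and u: "u \<in> L2 M\<^sub>T"
    and lim: "(\<lambda>n. \<integral>p. (norm (us n p - u p))\<^sup>2 \<partial>M\<^sub>T) \<longlonglongrightarrow> 0"
    using assms(2) by (auto simp: L2_tendsto_iff)
  let ?d = "\<lambda>n. \<integral>p. (norm (us n p - u p))\<^sup>2 \<partial>M\<^sub>T"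
  have "\<exists>Y. L2_tendsto M Ys Y"
  proof (rule L2_complete)
    show "finite_measure M" by unfold_locales
    show "Ys n \<in> L2 M" for n using ito_L2 assms(1) by blast
    fix \<epsilon> :: real assume \<epsilon>: "0 < \<epsilon>"
    have le: "(\<integral>\<omega>. (Ys m \<omega> - Ys n \<omega>)\<^sup>2 \<partial>M) \<le> 2 * ?d m + 2 * ?d n" for m n
    proof -
      have "(\<integral>\<omega>. (Ys m \<omega> - Ys n \<omega>)\<^sup>2 \<partial>M) = (\<integral>p. (norm (us m p - us n p))\<^sup>2 \<partial>M\<^sub>T)"
        by (rule ito_norm[OF ito_diff[OF assms(1) assms(1)]])
      also have "\<dots> \<le> (\<integral>p. 2 * (norm (us m p - u p))\<^sup>2 + 2 * (norm (us n p - u p))\<^sup>2 \<partial>M\<^sub>T)"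
      proof (rule integral_mono)
        show "integrable M\<^sub>T (\<lambda>p. (norm (us m p - us n p))\<^sup>2)"
          by (intro L2_integrable L2_diff us)
        show "integrable M\<^sub>T (\<lambda>p. 2 * (norm (us m p - u p))\<^sup>2 + 2 * (norm (us n p - u p))\<^sup>2)"
          by (intro Bochner_Integration.integrable_add integrable_mult_right L2_integrable L2_diff us u)
        show "(norm (us m p - us n p))\<^sup>2 \<le> 2 * (norm (us m p - u p))\<^sup>2 + 2 * (norm (us n p - u p))\<^sup>2" for p
          using sq_norm_add_le[of "us m p - u p" "u p - us n p"] by (simp add: norm_minus_commute)
      qed
      also have "\<dots> = 2 * ?d m + 2 * ?d n"
        using L2_integrable[OF L2_diff[OF us u]] by simp
      finally show ?thesis .
    qed
    obtain N where N: "\<And>n. n \<ge> N \<Longrightarrow> ?d n < \<epsilon> / 4"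
      using order_tendstoD(2)[OF lim, of "\<epsilon> / 4"] \<epsilon> by (auto simp: eventually_sequentially)
    have "(\<integral>\<omega>. (Ys m \<omega> - Ys n \<omega>)\<^sup>2 \<partial>M) < \<epsilon>" if "m \<ge> N" "n \<ge> N" for m n
      using le[of m n] N[OF that(1)] N[OF that(2)] by linarith
    then show "\<exists>N. \<forall>m\<ge>N. \<forall>n\<ge>N. (\<integral>\<omega>. (Ys m \<omega> - Ys n \<omega>)\<^sup>2 \<partial>M) < \<epsilon>" by blast
  qed
  then show ?thesis using ito.lim[OF assms] by blast
qed

text \<open>On a generating product, integrating in time first turns the pairing with the derivative
  into the coefficients \<open>ip (\<phi> i) \<psi>\<close> of the integration by parts
  formula.\<close>

lemma smooth_rv_dual:
  assumes "smooth_rv_deriv T F G U" "G \<in> L2 M" "U \<in> L2 M\<^sub>T" "ito u Y"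
  shows "(\<integral>\<omega>. G \<omega> * Y \<omega> \<partial>M) = (\<integral>p. U p \<bullet> u p \<partial>M\<^sub>T)"
proof (rule ito_dual[OF assms(2,3) _ assms(4)])
  obtain m f \<phi> where f: "smooth_poly_growth m f" and \<phi>: "\<And>i. i < m \<Longrightarrow> \<phi> i \<in> L2 (time T)"
    and G: "G = (\<lambda>\<omega>. f (\<lambda>i. F (\<phi> i) \<omega>))"
    and U: "U = (\<lambda>(\<omega>, s). \<Sum>i<m. coord_deriv i f (\<lambda>j. F (\<phi> j) \<omega>) *\<^sub>R \<phi> i s)"
    using assms(1) by (auto simp: smooth_rv_deriv_def)
  fix c X and \<psi> :: "real \<Rightarrow> 'b" assume t: "bounded_rv (\<FF> c) X" "\<psi> \<in> L2 (time T)" "\<And>s. s \<le> c \<Longrightarrow> \<psi> s = 0"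
  have "integrable M\<^sub>T (\<lambda>(\<omega>, s). U (\<omega>, s) \<bullet> (X \<omega> *\<^sub>R \<psi> s))"
    using L2_inner_integrable[OF assms(3) bounded_tensor_L2[OF bounded_rv_M[OF t(1)] t(2)]]
    by (simp add: split_beta')
  from MT.integral_fst'[OF this]
  have "(\<integral>(\<omega>, s). U (\<omega>, s) \<bullet> (X \<omega> *\<^sub>R \<psi> s) \<partial>M\<^sub>T) =
     (\<integral>\<omega>. (\<integral>s. X \<omega> * (\<Sum>i<m. coord_deriv i f (\<lambda>j. F (\<phi> j) \<omega>) * (\<phi> i s \<bullet> \<psi> s)) \<partial>time T) \<partial>M)"
    by (simp add: U inner_sum_left)
  also have "\<dots> = (\<integral>\<omega>. X \<omega> * (\<Sum>i<m. ip (\<phi> i) \<psi> * coord_deriv i f (\<lambda>j. F (\<phi> j) \<omega>)) \<partial>M)"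
    using L2_inner_integrable[OF \<phi> t(2)] by (simp add: mult.commute)
  also have "\<dots> = (\<integral>\<omega>. X \<omega> * f (\<lambda>i. F (\<phi> i) \<omega>) * F \<psi> \<omega> \<partial>M)"
    by (rule gaussian_ibp[OF t(2) \<phi> measurable_\<FF>_orth[OF t] bounded_rv_M[OF t(1)] smooth_poly_growth_C1[OF f], symmetric])
  finally show "(\<integral>\<omega>. G \<omega> * (X \<omega> * F \<psi> \<omega>) \<partial>M) = (\<integral>(\<omega>, s). U (\<omega>, s) \<bullet> (X \<omega> *\<^sub>R \<psi> s) \<partial>M\<^sub>T)"
    by (simp add: G ac_simps)
qed

text \<open>The divergence is tested against the closure of the derivative operator; both sides of
  the duality are continuous along the approximating smooth variables.\<close>

lemma ito_has_divergence:
  assumes "ito u Y"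
  shows "has_divergence M T F u Y"
  unfolding has_divergence_def
proof (intro conjI allI impI)
  show u: "u \<in> L2 M\<^sub>T" and Y: "Y \<in> L2 M" using ito_L2[OF assms] by auto
  fix G U assume "has_malliavin_deriv M T F G U"
  then obtain Gs Us where *: "\<And>n. smooth_rv_deriv T F (Gs n) (Us n)" "L2_tendsto M Gs G" "L2_tendsto M\<^sub>T Us U"
    by (auto simp: has_malliavin_deriv_def)
  have "Gs n \<in> L2 M" "Us n \<in> L2 M\<^sub>T" for n using * by (auto simp: L2_tendsto_def)
  then have "(\<integral>\<omega>. Gs n \<omega> \<bullet> Y \<omega> \<partial>M) = (\<integral>p. Us n p \<bullet> u p \<partial>M\<^sub>T)" for n
    using smooth_rv_dual[OF *(1) _ _ assms] by simp
  with L2_tendsto_inner[OF *(2) Y] L2_tendsto_inner[OF *(3) u]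
  show "(\<integral>\<omega>. G \<omega> * Y \<omega> \<partial>M) = (\<integral>p. U p \<bullet> u p \<partial>M\<^sub>T)"
    by (auto intro: LIMSEQ_unique)
qed

end

section \<open>Trigonometric functions of the noise as test variables\<close>

lemma iterated_coord_deriv_cos:
  "set is \<subseteq> {..<1} \<Longrightarrow> foldr coord_deriv is (\<lambda>x. cos (x 0 + a)) = (\<lambda>x. cos (x 0 + (a + real (length is) * (pi / 2))))"
proof (induction "is")
  case (Cons i "is")
  then have i: "i = 0" and IH: "foldr coord_deriv is (\<lambda>x. cos (x 0 + a)) = (\<lambda>x. cos (x 0 + (a + real (length is) * (pi / 2))))"
    by auto
  \<comment> \<open>Each differentiation shifts the phase by \<open>pi / 2\<close>. Hence the family
    reproduces itself, all derivatives are bounded by \<open>1\<close>, and the sine is included as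
    the phase \<open>- pi / 2\<close>.\<close>
  have d: "deriv (\<lambda>r. cos (r + b)) y = cos (y + (b + pi / 2))" for b y :: real
    by (rule DERIV_imp_deriv)
       (auto intro!: derivative_eq_intros simp: minus_sin_cos_eq add.assoc)
  have "foldr coord_deriv (i # is) (\<lambda>x. cos (x 0 + a)) = coord_deriv 0 (\<lambda>x. cos (x 0 + (a + real (length is) * (pi / 2))))"
    using IH by (simp add: i)
  also have "\<dots> = (\<lambda>x. cos (x 0 + (a + real (length (i # is)) * (pi / 2))))"
    by (rule ext) (simp add: coord_deriv_def d algebra_simps add_divide_distrib)
  finally show ?case .
qed simp

lemma smooth_poly_growth_cos: "smooth_poly_growth 1 (\<lambda>x. cos (x 0 + a))"
  unfolding smooth_poly_growth_def
proof (intro conjI allI impI)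
  fix "is" :: "nat list" assume is1: "set is \<subseteq> {..<1}"
  note eq = iterated_coord_deriv_cos[OF is1, of a]
  show "continuous_on UNIV (foldr coord_deriv is (\<lambda>x. cos (x 0 + a)))"
    unfolding eq by (intro continuous_intros continuous_on_product_coordinates)
  show "(\<lambda>r. foldr coord_deriv is (\<lambda>x. cos (x 0 + a)) (x(i := r))) differentiable at (x i)" if "i < 1" for i x
    unfolding eq using that
    by (auto intro!: derivative_eq_intros simp: real_differentiable_def)
  show "\<exists>C (k::nat). \<forall>x. \<bar>foldr coord_deriv is (\<lambda>x. cos (x 0 + a)) x\<bar> \<le> C * (1 + (\<Sum>i<1. \<bar>x i\<bar>)) ^ k"
    unfolding eq by (intro exI[of _ 1] exI[of _ 0]) simp
qed simp

context gaussian_noise begin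

lemma malliavin_cos:
  assumes \<phi>: "\<phi> \<in> L2 (time T)"
  shows "\<exists>U. has_malliavin_deriv M T F (\<lambda>\<omega>. cos (F \<phi> \<omega> + a)) U"
proof -
  let ?f = "\<lambda>x. cos (x 0 + a)"
  have c: "coord_deriv 0 ?f = (\<lambda>x. cos (x 0 + (a + pi / 2)))"
    using iterated_coord_deriv_cos[of "[0]" a] by simp
  let ?U = "\<lambda>(\<omega>, s). \<Sum>i<1. coord_deriv i ?f (\<lambda>j. F \<phi> \<omega>) *\<^sub>R \<phi> s"
  note [measurable] = F_measurable[OF \<phi>]
  have "smooth_rv_deriv T F (\<lambda>\<omega>. cos (F \<phi> \<omega> + a)) ?U"
    unfolding smooth_rv_deriv_def
    by (rule exI[of _ 1], rule exI[of _ ?f], rule exI[of _ "\<lambda>_. \<phi>"])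
       (use smooth_poly_growth_cos \<phi> in auto)
  moreover have "bounded_rv M (\<lambda>\<omega>. cos (F \<phi> \<omega> + (a + pi / 2)))" "bounded_rv M (\<lambda>\<omega>. cos (F \<phi> \<omega> + a))"
    unfolding bounded_rv_def by (auto intro!: exI[of _ 1])
  then have "?U \<in> L2 M\<^sub>T" "(\<lambda>\<omega>. cos (F \<phi> \<omega> + a)) \<in> L2 M"
    using bounded_tensor_L2[of "\<lambda>\<omega>. cos (F \<phi> \<omega> + (a + pi / 2))" \<phi>] \<phi>
      bounded_mult_L2[of "\<lambda>_. 1" "\<lambda>\<omega>. cos (F \<phi> \<omega> + a)"]
    by (auto simp: c L2_def)
  ultimately show ?thesis
    unfolding has_malliavin_deriv_def
    by (intro exI[of _ ?U] exI[of _ "\<lambda>_. \<lambda>\<omega>. cos (F \<phi> \<omega> + a)"] exI[of _ "\<lambda>_. ?U"])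
       (auto intro!: L2_tendsto_const dest: L2_measurable)
qed

text \<open>Trigonometric functions of the noise are total in \<open>L\<^sup>2(\<Omega>)\<close>.\<close>

lemma has_divergence_unique:
  assumes gen: "generated_by M T F" and Y: "has_divergence M T F u Y" and Y': "has_divergence M T F u Y'"
  shows "AE \<omega> in M. Y \<omega> = Y' \<omega>"
proof -
  define D where "D \<omega> = Y \<omega> - Y' \<omega>" for \<omega>
  have YL: "Y \<in> L2 M" "Y' \<in> L2 M" using Y Y' by (auto simp: has_divergence_def)
  have DL: "D \<in> L2 M" unfolding D_def[abs_def] by (rule L2_diff[OF YL])
  have one: "(\<lambda>_. 1::real) \<in> L2 M" by (simp add: L2_def)
  have iD: "integrable M D" using L2_mult_integrable[OF DL one] by simp
  note [measurable] = L2_measurable[OF DL]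
  let ?V = "{F \<phi> | \<phi>. \<phi> \<in> L2 (time T)}"
  have zero: "(\<integral>\<omega>. D \<omega> * cos (F \<phi> \<omega> + a) \<partial>M) = 0" if \<phi>: "\<phi> \<in> L2 (time T)" for \<phi> a
  proof -
    obtain U where U: "has_malliavin_deriv M T F (\<lambda>\<omega>. cos (F \<phi> \<omega> + a)) U" using malliavin_cos[OF \<phi>] by blast
    have cL: "(\<lambda>\<omega>. cos (F \<phi> \<omega> + a)) \<in> L2 M"
      using U by (auto simp: has_malliavin_deriv_def L2_tendsto_def)
    have "(\<integral>\<omega>. cos (F \<phi> \<omega> + a) * Y \<omega> \<partial>M) = (\<integral>\<omega>. cos (F \<phi> \<omega> + a) * Y' \<omega> \<partial>M)"
      using Y Y' U by (auto simp: has_divergence_def)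
    then show ?thesis
      using L2_mult_integrable[OF cL YL(1)] L2_mult_integrable[OF cL YL(2)]
      by (simp add: D_def left_diff_distrib mult.commute)
  qed
  have gsets: "sets M = generated_sets M ?V"
  proof -
    have "{V -` B \<inter> space M | V B. V \<in> ?V \<and> B \<in> sets borel} = {F \<phi> -` B \<inter> space M | \<phi> B. \<phi> \<in> L2 (time T) \<and> B \<in> sets borel}"
      by blast
    then show ?thesis using gen by (simp only: generated_by_def generated_sets_def)
  qed
  \<comment> \<open>Phases \<open>0\<close> and \<open>- pi / 2\<close> give the real and imaginary
    part of the transform, so \<open>D\<close> is orthogonal to every exponential of the noise and
    therefore to every event that the noise generates.\<close>
  have ind: "(\<integral>\<omega>. D \<omega> * indicator E \<omega> \<partial>M) = 0" if "E \<in> sets M" for E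
  proof (rule integral_indicator_eq_0_of_generated[OF iD])
    show "?V \<subseteq> borel_measurable M" using F_measurable by auto
    show "?V \<noteq> {}" using zero_L2 by blast
    show "E \<in> generated_sets M ?V" using that gsets by simp
    show "\<exists>U\<in>?V. AE x in M. U x = V x + u * W x" if VW: "V \<in> ?V" "W \<in> ?V" for V W u
    proof -
      obtain \<phi> \<theta> where *: "V = F \<phi>" "\<phi> \<in> L2 (time T)" "W = F \<theta>" "\<theta> \<in> L2 (time T)" using VW by auto
      then have "F (\<lambda>s. \<phi> s + u *\<^sub>R \<theta> s) \<in> ?V" using L2_lin by blast
      then show ?thesis using F_lin[OF *(2,4), of u] * by blast
    qed
    fix V assume "V \<in> ?V"
    then obtain \<phi> where \<phi>: "V = F \<phi>" "\<phi> \<in> L2 (time T)" by auto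
    note [measurable] = F_measurable[OF \<phi>(2)]
    have i: "integrable M (\<lambda>\<omega>. complex_of_real (D \<omega>) * iexp (V \<omega>))"
      using iD by (intro integrable_norm_le_1) (auto simp: \<phi>)
    have "Re (\<integral>\<omega>. complex_of_real (D \<omega>) * iexp (V \<omega>) \<partial>M) = (\<integral>\<omega>. D \<omega> * cos (F \<phi> \<omega> + 0) \<partial>M)"
      unfolding integral_Re[OF i, symmetric]
      by (intro Bochner_Integration.integral_cong) (auto simp: \<phi> Re_exp)
    moreover have "Im (\<integral>\<omega>. complex_of_real (D \<omega>) * iexp (V \<omega>) \<partial>M) = (\<integral>\<omega>. D \<omega> * cos (F \<phi> \<omega> + (- pi / 2)) \<partial>M)"
      unfolding integral_Im[OF i, symmetric]
      by (intro Bochner_Integration.integral_cong) (auto simp: \<phi> Im_exp cos_diff)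
    ultimately show "(\<integral>\<omega>. complex_of_real (D \<omega>) * iexp (V \<omega>) \<partial>M) = 0"
      using zero[OF \<phi>(2)] by (simp only: complex_eq_iff) simp
  qed
  have iE: "integrable M (\<lambda>\<omega>. D \<omega> * indicator E \<omega>)" if "E \<in> sets M" for E
    using iD that by (auto intro!: integrable_norm_le_1 simp: indicator_def)
  \<comment> \<open>On these sets \<open>D\<close> has a fixed sign, so a vanishing integral forces
    the integrand to vanish almost everywhere.\<close>
  let ?P = "{\<omega> \<in> space M. 0 \<le> D \<omega>}" and ?N = "{\<omega> \<in> space M. D \<omega> \<le> 0}"
  have PN: "?P \<in> sets M" "?N \<in> sets M" by measurable
  have "AE \<omega> in M. D \<omega> * indicator ?P \<omega> = 0"
    using integral_nonneg_eq_0_iff_AE[OF iE[OF PN(1)]] ind[OF PN(1)] by (auto simp: indicator_def)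
  moreover have "AE \<omega> in M. - (D \<omega> * indicator ?N \<omega>) = 0"
    using integral_nonneg_eq_0_iff_AE[OF integrable_minus[OF iE[OF PN(2)]]] ind[OF PN(2)]
    by (auto simp: indicator_def)
  ultimately show ?thesis
    using AE_space by eventually_elim (auto simp: D_def indicator_def split: if_splits)
qed

end

section \<open>Representatives in the completion\<close>

lemma iter_partial_lin:
  fixes f g :: "real^'d::finite \<Rightarrow> real"
  assumes "smooth f" "smooth g"
  shows "iter_partial is (\<lambda>x. f x + c * g x) = (\<lambda>x. iter_partial is f x + c * iter_partial is g x)"
proof (induction "is")
  case Nil then show ?case by (simp add: iter_partial_def)
next
  case (Cons i "is")
  have d: "iter_partial is f differentiable (at x)" "iter_partial is g differentiable (at x)" for x
    using assms by (auto simp: smooth_def)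
  have "partial_deriv i (\<lambda>x. iter_partial is f x + c * iter_partial is g x) x =
     partial_deriv i (iter_partial is f) x + c * partial_deriv i (iter_partial is g) x" for x
  proof -
    have "((\<lambda>x. iter_partial is f x + c * iter_partial is g x) has_derivative
      (\<lambda>h. frechet_derivative (iter_partial is f) (at x) h + c * frechet_derivative (iter_partial is g) (at x) h)) (at x)"
      using d[of x] by (intro has_derivative_add has_derivative_mult_right) (auto simp: frechet_derivative_works[symmetric])
    from frechet_derivative_at[OF this] show ?thesis
      by (simp add: partial_deriv_def fun_eq_iff)
  qed
  then show ?case using Cons by (simp add: iter_partial_def)
qed

lemma smooth_lin:
  fixes f g :: "real^'d::finite \<Rightarrow> real"
  assumes "smooth f" "smooth g"
  shows "smooth (\<lambda>x. f x + c * g x)"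
  unfolding smooth_def iter_partial_lin[OF assms]
  using assms by (auto simp: smooth_def intro!: differentiable_add differentiable_mult)

lemma schwartz_lin:
  fixes f g :: "real^'d::finite \<Rightarrow> real"
  assumes f: "f \<in> schwartz" and g: "g \<in> schwartz"
  shows "(\<lambda>x. f x + c * g x) \<in> schwartz"
proof -
  have s: "smooth f" "smooth g" using f g by (auto simp: schwartz_def)
  have "bdd_above (range (\<lambda>x. norm x ^ k * norm (iter_partial is (\<lambda>x. f x + c * g x) x)))" for "is" k
  proof -
    obtain B B' where B: "\<And>x. norm x ^ k * norm (iter_partial is f x) \<le> B"
      "\<And>x. norm x ^ k * norm (iter_partial is g x) \<le> B'"
      using f g unfolding schwartz_def bdd_above_def by blast
    have "norm x ^ k * norm (iter_partial is f x + c * iter_partial is g x) \<le> B + \<bar>c\<bar> * B'" for x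
    proof -
      have "norm x ^ k * norm (iter_partial is f x + c * iter_partial is g x) \<le>
        norm x ^ k * (norm (iter_partial is f x) + \<bar>c\<bar> * norm (iter_partial is g x))"
        by (intro mult_left_mono order_trans[OF norm_triangle_ineq]) (auto simp: abs_mult)
      also have "\<dots> = norm x ^ k * norm (iter_partial is f x) + \<bar>c\<bar> * (norm x ^ k * norm (iter_partial is g x))"
        by (simp add: algebra_simps)
      also have "\<dots> \<le> B + \<bar>c\<bar> * B'" by (intro add_mono mult_left_mono B) auto
      finally show ?thesis .
    qed
    then show ?thesis unfolding iter_partial_lin[OF s] bdd_above_def by blast
  qed
  then show ?thesis using smooth_lin[OF s] by (simp add: schwartz_def)
qed

lemma schwartz_measurable [measurable_dest]:
  fixes f :: "real^'d::finite \<Rightarrow> real"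
  assumes "f \<in> schwartz"
  shows "f \<in> borel_measurable borel"
proof -
  have "\<forall>is x. iter_partial is f differentiable (at x)" using assms unfolding schwartz_def smooth_def by blast
  from this[rule_format, of "[]"] have "iter_partial [] f differentiable (at x)" for x .
  then have "continuous_on UNIV f"
    by (intro continuous_at_imp_continuous_on) (auto simp: iter_partial_def intro: differentiable_imp_continuous_within)
  then show ?thesis by (rule borel_measurable_continuous_onI)
qed

lemma schwartz_decay:
  fixes f :: "real^'d::finite \<Rightarrow> real"
  assumes "f \<in> schwartz"
  shows "\<exists>C. \<forall>x. (1 + norm x) ^ k * \<bar>f x\<bar> \<le> C"
proof -
  have "smooth f \<and> (\<forall>is k. bdd_above (range (\<lambda>x. norm x ^ k * norm (iter_partial is f x))))"
    using assms unfolding schwartz_def by (rule CollectD)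
  then have "\<forall>is k. bdd_above (range (\<lambda>x. norm x ^ k * norm (iter_partial is f x)))" ..
  from this[rule_format, of _ "[]"] have "\<exists>B. \<forall>x. norm x ^ j * \<bar>f x\<bar> \<le> B" for j
    unfolding bdd_above_def iter_partial_def by auto
  then obtain B B' where B: "\<And>x. norm x ^ 0 * \<bar>f x\<bar> \<le> B" "\<And>x. norm x ^ k * \<bar>f x\<bar> \<le> B'" by blast
  have "(1 + norm x) ^ k * \<bar>f x\<bar> \<le> 2 ^ k * (B + B')" for x
  proof -
    have "(1 + norm x) ^ k * \<bar>f x\<bar> \<le> (2 ^ k * (1 ^ k + norm x ^ k)) * \<bar>f x\<bar>"
      by (intro mult_right_mono power_add_le) auto
    also have "\<dots> = 2 ^ k * (norm x ^ 0 * \<bar>f x\<bar> + norm x ^ k * \<bar>f x\<bar>)" by (simp add: algebra_simps)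
    also have "\<dots> \<le> 2 ^ k * (B + B')" by (intro mult_left_mono add_mono B) auto
    finally show ?thesis .
  qed
  then show ?thesis by blast
qed

lemma suminf_ennreal_ge: "f n \<le> (\<Sum>n. f n :: ennreal)"
  using sum_le_suminf[OF summableI, of "{n}" f] by simp

text \<open>The ball of radius \<open>n + 1\<close> has volume of order
  \<open>(n + 1) ^ DIM\<close>, so the exponent of dimension plus two leaves the convergent series
  of \<open>1 / (n + 1)\<^sup>2\<close>. Full balls in place of shells have an explicit volume and
  do not spoil convergence.\<close>

lemma integrable_inverse_power_norm:
  "integrable lborel (\<lambda>x::real^'d::finite. 1 / (1 + norm x) ^ (DIM(real^'d) + 2))"
proof (rule integrableI_bounded)
  let ?D = "DIM(real^'d)" and ?V = "unit_ball_vol (real DIM(real^'d))"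
  have V: "0 \<le> ?V" by simp
  have le: "ennreal (norm (1 / (1 + norm x) ^ (?D + 2))) \<le>
      (\<Sum>n. ennreal (1 / (1 + real n) ^ (?D + 2)) * indicator (cball 0 (real n + 1)) x)" (is "_ \<le> (\<Sum>n. ?f n)") for x :: "real^'d"
  proof -
    define n where "n = nat \<lfloor>norm x\<rfloor>"
    have n: "real n \<le> norm x" "norm x \<le> real n + 1"
    proof -
      have "real n = of_int \<lfloor>norm x\<rfloor>" by (simp add: n_def)
      then show "real n \<le> norm x" "norm x \<le> real n + 1" by linarith+
    qed
    have "1 / (1 + norm x) ^ (?D + 2) \<le> 1 / (1 + real n) ^ (?D + 2)"
      using n by (intro divide_left_mono power_mono mult_pos_pos) auto
    then have "ennreal (norm (1 / (1 + norm x) ^ (?D + 2))) \<le> ?f n"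
      using n by (auto intro!: ennreal_leI simp: mem_cball)
    also have "\<dots> \<le> (\<Sum>n. ?f n)"
      by (rule suminf_ennreal_ge)
    finally show ?thesis .
  qed
  have "(\<integral>\<^sup>+x. ennreal (norm (1 / (1 + norm (x::real^'d)) ^ (?D + 2))) \<partial>lborel) \<le>
     (\<integral>\<^sup>+x. (\<Sum>n. ennreal (1 / (1 + real n) ^ (?D + 2)) * indicator (cball 0 (real n + 1)) (x::real^'d)) \<partial>lborel)"
    by (intro nn_integral_mono le)
  also have "\<dots> = (\<Sum>n. ennreal (1 / (1 + real n) ^ (?D + 2)) * emeasure lborel (cball (0::real^'d) (real n + 1)))"
    by (subst nn_integral_suminf)
       (auto simp: nn_integral_cmult_indicator intro!: borel_measurable_times_ennreal borel_measurable_indicator)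
  also have "\<dots> = (\<Sum>n. ennreal (?V * (1 / real (Suc n) ^ 2)))"
  proof (intro suminf_cong)
    fix n
    have "ennreal (1 / (1 + real n) ^ (?D + 2)) * emeasure lborel (cball (0::real^'d) (real n + 1)) =
       ennreal (1 / (1 + real n) ^ (?D + 2)) * ennreal (?V * (real n + 1) ^ ?D)"
      by (subst emeasure_cball) auto
    also have "\<dots> = ennreal (1 / (1 + real n) ^ (?D + 2) * (?V * (real n + 1) ^ ?D))"
      by (rule ennreal_mult'[symmetric]) simp
    also have "1 / (1 + real n) ^ (?D + 2) * (?V * (real n + 1) ^ ?D) = ?V * (1 / real (Suc n) ^ 2)"
    proof -
      have "1 / (a * b) * (v * a) = v * (1 / b)" if "a \<noteq> 0" "b \<noteq> 0" for a b v :: real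
        using that by simp
      from this[of "(1 + real n) ^ ?D" "(1 + real n) ^ 2" ?V] show ?thesis
        by (simp add: power_add add.commute power2_eq_square)
    qed
    finally show "ennreal (1 / (1 + real n) ^ (?D + 2)) * emeasure lborel (cball (0::real^'d) (real n + 1)) =
      ennreal (?V * (1 / real (Suc n) ^ 2))" .
  qed
  also have "\<dots> < \<infinity>"
  proof (subst suminf_ennreal2)
    show "summable (\<lambda>n. ?V * (1 / real (Suc n) ^ 2))"
    proof (rule summable_mult)
      have "summable (\<lambda>n. 1 / real n ^ 2)"
        using inverse_power_summable[of 2, where 'a = real] by (simp add: inverse_eq_divide)
      then show "summable (\<lambda>n. 1 / real (Suc n) ^ 2)" by (subst summable_Suc_iff)
    qed
  qed (use V in auto)
  finally show "(\<integral>\<^sup>+x. ennreal (norm (1 / (1 + norm (x::real^'d)) ^ (?D + 2))) \<partial>lborel) < \<infinity>" .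
qed measurable

lemma schwartz_weight_integrable:
  fixes f :: "real^'d::finite \<Rightarrow> real"
  assumes f: "f \<in> schwartz"
  shows "integrable lborel (\<lambda>x. (1 + norm x) ^ k * \<bar>f x\<bar>)"
proof -
  let ?D = "DIM(real^'d)"
  note [measurable] = schwartz_measurable[OF f]
  obtain C where C: "\<And>x. (1 + norm x) ^ (k + (?D + 2)) * \<bar>f x\<bar> \<le> C" using schwartz_decay[OF f] by blast
  have "integrable lborel (\<lambda>x::real^'d. C * (1 / (1 + norm x) ^ (?D + 2)))"
    by (intro integrable_mult_right integrable_inverse_power_norm)
  then show ?thesis
  proof (rule integrable_bound_pointwise)
    show "norm ((1 + norm x) ^ k * \<bar>f x\<bar>) \<le> norm (C * (1 / (1 + norm x) ^ (?D + 2)))" for x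
    proof -
      have p: "0 < (1 + norm x) ^ (?D + 2)" by (intro zero_less_power) (simp add: add_pos_nonneg)
      have "(1 + norm x) ^ k * \<bar>f x\<bar> \<le> C * (1 / (1 + norm x) ^ (?D + 2))"
        using C[of x] p unfolding power_add[of _ k] by (simp add: field_simps del: power_Suc)
      moreover have "0 \<le> (1 + norm x) ^ k * \<bar>f x\<bar>" by simp
      ultimately show ?thesis unfolding real_norm_def by linarith
    qed
  qed measurable
qed

lemma schwartz_integrable:
  fixes f :: "real^'d::finite \<Rightarrow> real"
  assumes "f \<in> schwartz"
  shows "integrable lborel f"
  using schwartz_weight_integrable[OF assms, of 0] schwartz_measurable[OF assms]
  by (simp add: integrable_abs_iff)

lemma reflect_schwartz_integrable:
  fixes f :: "real^'d::finite \<Rightarrow> real"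
  assumes "f \<in> schwartz"
  shows "integrable lborel (\<lambda>x. (1 + norm x) ^ k * \<bar>reflect f x\<bar>)"
proof -
  have uminus_eq: "distr lborel borel uminus = (lborel :: (real^'d) measure)"
    using lborel_affine[of "-1" "0 :: real^'d"] by (simp add: density_1)
  have "integrable (distr lborel borel uminus) (\<lambda>x::real^'d. (1 + norm x) ^ k * \<bar>f x\<bar>)"
    unfolding uminus_eq by (rule schwartz_weight_integrable[OF assms])
  then show ?thesis
    using schwartz_measurable[OF assms]
    by (subst (asm) integrable_distr_eq) (auto simp: reflect_def)
qed

lemma conv_integrable:
  fixes f g :: "real^'d::finite \<Rightarrow> real"
  assumes f: "f \<in> schwartz" and g: "g \<in> schwartz"
  shows "integrable lborel (\<lambda>y. f (x - y) * reflect g y)"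
proof -
  note [measurable] = schwartz_measurable[OF f] schwartz_measurable[OF g]
  obtain C where C: "\<And>x. (1 + norm x) ^ 0 * \<bar>f x\<bar> \<le> C" using schwartz_decay[OF f] by blast
  have "integrable lborel (\<lambda>y. C * ((1 + norm y) ^ 0 * \<bar>reflect g y\<bar>))"
    by (intro integrable_mult_right reflect_schwartz_integrable g)
  then show ?thesis
  proof (rule integrable_bound_pointwise)
    show "norm (f (x - y) * reflect g y) \<le> norm (C * ((1 + norm y) ^ 0 * \<bar>reflect g y\<bar>))" for y
    proof -
      have "\<bar>f (x - y)\<bar> \<le> \<bar>C\<bar>" using C[of "x - y"] by simp
      then show ?thesis by (simp add: abs_mult mult_right_mono)
    qed
  qed (simp add: reflect_def)
qed

text \<open>The inequality \<open>1 + norm x \<le> (1 + norm (x - y)) * (1 + norm y)\<close>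
  distributes the weight over the two factors: the first is bounded after weighting, the second
  integrable.\<close>

lemma conv_decay:
  fixes f g :: "real^'d::finite \<Rightarrow> real"
  assumes f: "f \<in> schwartz" and g: "g \<in> schwartz"
  shows "\<exists>C. \<forall>x. (1 + norm x) ^ k * \<bar>conv f (reflect g) x\<bar> \<le> C"
proof -
  obtain C where C: "\<And>x. (1 + norm x) ^ k * \<bar>f x\<bar> \<le> C" using schwartz_decay[OF f] by blast
  let ?w = "\<lambda>y. (1 + norm y) ^ k * \<bar>reflect g y\<bar>"
  have "(1 + norm x) ^ k * \<bar>conv f (reflect g) x\<bar> \<le> C * (\<integral>y. ?w y \<partial>lborel)" for x
  proof -
    have i: "integrable lborel (\<lambda>y. \<bar>f (x - y) * reflect g y\<bar>)" by (intro integrable_abs conv_integrable f g)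
    have "(1 + norm x) ^ k * \<bar>conv f (reflect g) x\<bar> \<le> (1 + norm x) ^ k * (\<integral>y. \<bar>f (x - y) * reflect g y\<bar> \<partial>lborel)"
      unfolding conv_def by (intro mult_left_mono integral_abs_bound) auto
    also have "\<dots> = (\<integral>y. (1 + norm x) ^ k * \<bar>f (x - y) * reflect g y\<bar> \<partial>lborel)" by simp
    also have "\<dots> \<le> (\<integral>y. C * ?w y \<partial>lborel)"
    proof (rule integral_mono)
      show "integrable lborel (\<lambda>y. (1 + norm x) ^ k * \<bar>f (x - y) * reflect g y\<bar>)" using i by simp
      show "integrable lborel (\<lambda>y. C * ?w y)" by (intro integrable_mult_right reflect_schwartz_integrable g)
      fix y
      have "norm x \<le> norm (x - y) + norm y" using norm_triangle_ineq[of "x - y" y] by simp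
      then have "1 + norm x \<le> (1 + norm (x - y)) * (1 + norm y)"
        using mult_nonneg_nonneg[OF norm_ge_zero[of "x - y"] norm_ge_zero[of y]]
        by (simp only: distrib_left distrib_right mult_1 mult_1_right)
      then have "(1 + norm x) ^ k \<le> (1 + norm (x - y)) ^ k * (1 + norm y) ^ k"
        unfolding power_mult_distrib[symmetric] by (intro power_mono) auto
      then have "(1 + norm x) ^ k * \<bar>f (x - y) * reflect g y\<bar> \<le>
         ((1 + norm (x - y)) ^ k * (1 + norm y) ^ k) * \<bar>f (x - y) * reflect g y\<bar>"
        by (intro mult_right_mono) auto
      also have "\<dots> = ((1 + norm (x - y)) ^ k * \<bar>f (x - y)\<bar>) * ?w y" by (simp add: abs_mult)
      also have "\<dots> \<le> C * ?w y" by (intro mult_right_mono C) auto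
      finally show "(1 + norm x) ^ k * \<bar>f (x - y) * reflect g y\<bar> \<le> C * ?w y" .
    qed
    finally show ?thesis by simp
  qed
  then show ?thesis by blast
qed

lemma conv_measurable [measurable]:
  fixes f g :: "real^'d::finite \<Rightarrow> real"
  assumes [measurable]: "f \<in> borel_measurable borel" "g \<in> borel_measurable borel"
  shows "conv f g \<in> borel_measurable borel"
  unfolding conv_def[abs_def] by measurable

text \<open>Additivity of the inner product formula over \<Gamma> rests on this, since integrals of
  non-integrable functions are \<open>0\<close> by convention. Decay of order \<open>2 * k\<close>
  beats the weight \<open>(1 + (norm x)\<^sup>2) ^ k\<close> of the tempered measure.\<close>

lemma conv_tempered_integrable:
  fixes f g :: "real^'d::finite \<Rightarrow> real"
  assumes \<Gamma>: "tempered_measure \<Gamma>" and f: "f \<in> schwartz" and g: "g \<in> schwartz"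
  shows "integrable \<Gamma> (conv f (reflect g))"
proof -
  obtain k :: nat where sets: "sets \<Gamma> = sets borel"
    and k: "(\<integral>\<^sup>+x. ennreal (1 / (1 + (norm x)\<^sup>2) ^ k) \<partial>\<Gamma>) < \<infinity>"
    using \<Gamma> by (auto simp: tempered_measure_def)
  note [measurable_cong] = sets
  note [measurable] = schwartz_measurable[OF f] schwartz_measurable[OF g]
  obtain C where C: "\<And>x. (1 + norm x) ^ (2 * k) * \<bar>conv f (reflect g) x\<bar> \<le> C" using conv_decay[OF f g] by blast
  have "integrable \<Gamma> (\<lambda>x. 1 / (1 + (norm x)\<^sup>2) ^ k)"
    using k by (intro integrableI_bounded) auto
  then have "integrable \<Gamma> (\<lambda>x. C * (1 / (1 + (norm x)\<^sup>2) ^ k))" by (rule integrable_mult_right)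
  then show ?thesis
  proof (rule integrable_bound_pointwise)
    have "reflect g \<in> borel_measurable borel" unfolding reflect_def[abs_def] by measurable
    then show "conv f (reflect g) \<in> borel_measurable \<Gamma>" by measurable
    show "norm (conv f (reflect g) x) \<le> norm (C * (1 / (1 + (norm x)\<^sup>2) ^ k))" for x
    proof -
      have p: "0 < (1 + (norm x)\<^sup>2) ^ k" by (intro zero_less_power) (simp add: add_pos_nonneg)
      have "(1 + (norm x)\<^sup>2) ^ k \<le> ((1 + norm x)\<^sup>2) ^ k" by (intro power_mono) (auto simp: power2_sum)
      then have "(1 + (norm x)\<^sup>2) ^ k * \<bar>conv f (reflect g) x\<bar> \<le> (1 + norm x) ^ (2 * k) * \<bar>conv f (reflect g) x\<bar>"
        by (intro mult_right_mono) (auto simp: power_mult)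
      also note C[of x]
      finally have "\<bar>conv f (reflect g) x\<bar> \<le> C * (1 / (1 + (norm x)\<^sup>2) ^ k)"
        using p by (simp add: field_simps)
      then show ?thesis unfolding real_norm_def by linarith
    qed
  qed
qed

section \<open>The completion map and the elements represented by functions\<close>

context
  fixes \<Gamma> \<mu> :: "(real^'d::finite) measure"
    and \<iota> :: "(real^'d \<Rightarrow> real) \<Rightarrow> 'h::{real_inner,banach,second_countable_topology}"
  assumes cov: "spectral_covariance \<Gamma> \<mu>" and compl: "is_completion \<Gamma> \<mu> \<iota>"
begin

lemma inner_\<iota>_\<Gamma>: "f \<in> schwartz \<Longrightarrow> g \<in> schwartz \<Longrightarrow> \<iota> f \<bullet> \<iota> g = (\<integral>x. conv f (reflect g) x \<partial>\<Gamma>)"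
  using compl unfolding is_completion_def by blast

lemma inner_\<iota>_\<mu>:
  "f \<in> schwartz \<Longrightarrow> g \<in> schwartz \<Longrightarrow> complex_of_real (\<iota> f \<bullet> \<iota> g) = (\<integral>\<xi>. rfourier f \<xi> * cnj (rfourier g \<xi>) \<partial>\<mu>)"
  using compl unfolding is_completion_def by blast

text \<open>By bilinearity of the inner product formula the defect is orthogonal to the image of
  every Schwartz function. It is itself a combination of such images, hence orthogonal to
  itself.\<close>

lemma \<iota>_lin:
  assumes f: "f \<in> schwartz" and g: "g \<in> schwartz"
  shows "\<iota> (\<lambda>x. f x + c * g x) = \<iota> f + c *\<^sub>R \<iota> g"
proof -
  let ?h = "\<lambda>x. f x + c * g x"
  let ?d = "\<iota> ?h - (\<iota> f + c *\<^sub>R \<iota> g)"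
  have h: "?h \<in> schwartz" by (rule schwartz_lin[OF f g])
  have T: "tempered_measure \<Gamma>" using cov by (simp add: spectral_covariance_def)
  have z: "?d \<bullet> \<iota> p = 0" if p: "p \<in> schwartz" for p
  proof -
    have "conv ?h (reflect p) x = conv f (reflect p) x + c * conv g (reflect p) x" for x
      unfolding conv_def using conv_integrable[OF f p, of x] conv_integrable[OF g p, of x]
      by (simp add: distrib_right mult.assoc)
    then have "\<iota> ?h \<bullet> \<iota> p = (\<integral>x. conv f (reflect p) x + c * conv g (reflect p) x \<partial>\<Gamma>)"
      by (simp add: inner_\<iota>_\<Gamma>[OF h p])
    also have "\<dots> = \<iota> f \<bullet> \<iota> p + c * (\<iota> g \<bullet> \<iota> p)"
      using conv_tempered_integrable[OF T f p] conv_tempered_integrable[OF T g p]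
      by (simp add: inner_\<iota>_\<Gamma> f g p)
    finally show ?thesis by (simp add: inner_diff_left inner_add_left)
  qed
  have "?d \<bullet> ?d = ?d \<bullet> \<iota> ?h - ?d \<bullet> \<iota> f - c * (?d \<bullet> \<iota> g)"
    by (simp only: inner_diff_right inner_add_right inner_scaleR_right diff_diff_eq)
  also have "\<dots> = 0" unfolding z[OF h] z[OF f] z[OF g] by simp
  finally show ?thesis by simp
qed

lemma fourier_measurable:
  assumes [measurable]: "(f :: real^'d \<Rightarrow> complex) \<in> borel_measurable borel"
  shows "fourier f \<in> borel_measurable borel"
proof -
  have "continuous_on UNIV cis" unfolding cis_conv_exp by (intro continuous_intros)
  then have [measurable]: "cis \<in> borel_measurable borel" by (rule borel_measurable_continuous_onI)
  show ?thesis unfolding fourier_def[abs_def] by measurable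
qed

lemma sets_\<mu>: "sets \<mu> = sets borel"
  using cov by (simp add: spectral_covariance_def tempered_measure_def)

lemma rfourier_measurable:
  assumes "integrable lborel (f :: real^'d \<Rightarrow> real)"
  shows "rfourier f \<in> borel_measurable \<mu>"
  using fourier_measurable[of "\<lambda>x. complex_of_real (f x)"] assms
  by (simp add: measurable_cong_sets[OF sets_\<mu> refl])

lemma fourier_integrable:
  assumes "integrable lborel (f :: real^'d \<Rightarrow> real)"
  shows "integrable lborel (\<lambda>x. cis (- (\<xi> \<bullet> x)) * complex_of_real (f x))"
proof (rule integrable_bound_pointwise[OF assms])
  have [measurable]: "f \<in> borel_measurable borel" using assms by simp
  have "continuous_on UNIV (\<lambda>x. cis (- (\<xi> \<bullet> x)))" unfolding cis_conv_exp by (intro continuous_intros)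
  then have [measurable]: "(\<lambda>x. cis (- (\<xi> \<bullet> x))) \<in> borel_measurable borel" by (rule borel_measurable_continuous_onI)
  show "(\<lambda>x. cis (- (\<xi> \<bullet> x)) * complex_of_real (f x)) \<in> borel_measurable lborel" by measurable
qed (simp add: norm_mult)

lemma rfourier_lin:
  fixes f g :: "real^'d \<Rightarrow> real"
  assumes "integrable lborel f" "integrable lborel g"
  shows "rfourier (\<lambda>x. f x + c * g x) \<xi> = rfourier f \<xi> + complex_of_real c * rfourier g \<xi>"
proof -
  have "rfourier (\<lambda>x. f x + c * g x) \<xi> = (\<integral>x. cis (- (\<xi> \<bullet> x)) * complex_of_real (f x)
      + complex_of_real c * (cis (- (\<xi> \<bullet> x)) * complex_of_real (g x)) \<partial>lborel)"
    unfolding fourier_def by (intro Bochner_Integration.integral_cong) (auto simp: algebra_simps)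
  then show ?thesis
    using fourier_integrable[OF assms(1), of \<xi>] fourier_integrable[OF assms(2), of \<xi>] by (simp add: fourier_def)
qed

lemma represents_lin:
  assumes "represents \<mu> \<iota> f h" "represents \<mu> \<iota> f' h'"
  shows "represents \<mu> \<iota> (\<lambda>x. f x + c * f' x) (h + c *\<^sub>R h')"
proof -
  obtain \<phi> \<phi>' where f: "integrable lborel f" "integrable lborel f'"
    and \<phi>: "\<And>n. \<phi> n \<in> schwartz" "(\<lambda>n. \<iota> (\<phi> n)) \<longlonglongrightarrow> h" "\<And>n. \<phi>' n \<in> schwartz" "(\<lambda>n. \<iota> (\<phi>' n)) \<longlonglongrightarrow> h'"
    and lim: "(\<lambda>n. \<integral>\<^sup>+\<xi>. ennreal ((cmod (rfourier (\<phi> n) \<xi> - rfourier f \<xi>))\<^sup>2) \<partial>\<mu>) \<longlonglongrightarrow> 0"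
      "(\<lambda>n. \<integral>\<^sup>+\<xi>. ennreal ((cmod (rfourier (\<phi>' n) \<xi> - rfourier f' \<xi>))\<^sup>2) \<partial>\<mu>) \<longlonglongrightarrow> 0"
    using assms by (auto simp: represents_def)
  let ?\<phi> = "\<lambda>n x. \<phi> n x + c * \<phi>' n x"
  note [measurable] = rfourier_measurable[OF f(1)] rfourier_measurable[OF f(2)]
    rfourier_measurable[OF schwartz_integrable[OF \<phi>(1)]] rfourier_measurable[OF schwartz_integrable[OF \<phi>(3)]]
  have le: "(\<integral>\<^sup>+\<xi>. ennreal ((cmod (rfourier (?\<phi> n) \<xi> - rfourier (\<lambda>x. f x + c * f' x) \<xi>))\<^sup>2) \<partial>\<mu>) \<le>
     2 * (\<integral>\<^sup>+\<xi>. ennreal ((cmod (rfourier (\<phi> n) \<xi> - rfourier f \<xi>))\<^sup>2) \<partial>\<mu>)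
     + 2 * (ennreal (c\<^sup>2) * (\<integral>\<^sup>+\<xi>. ennreal ((cmod (rfourier (\<phi>' n) \<xi> - rfourier f' \<xi>))\<^sup>2) \<partial>\<mu>))" for n
  proof -
    have "rfourier (?\<phi> n) \<xi> - rfourier (\<lambda>x. f x + c * f' x) \<xi> =
       (rfourier (\<phi> n) \<xi> - rfourier f \<xi>) + complex_of_real c * (rfourier (\<phi>' n) \<xi> - rfourier f' \<xi>)" for \<xi>
      unfolding rfourier_lin[OF schwartz_integrable[OF \<phi>(1)] schwartz_integrable[OF \<phi>(3)]] rfourier_lin[OF f]
      by (simp add: algebra_simps)
    then have "(\<integral>\<^sup>+\<xi>. ennreal ((cmod (rfourier (?\<phi> n) \<xi> - rfourier (\<lambda>x. f x + c * f' x) \<xi>))\<^sup>2) \<partial>\<mu>) \<le>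
      2 * (\<integral>\<^sup>+\<xi>. ennreal ((cmod (rfourier (\<phi> n) \<xi> - rfourier f \<xi>))\<^sup>2) \<partial>\<mu>) +
      2 * (\<integral>\<^sup>+\<xi>. ennreal ((cmod (complex_of_real c * (rfourier (\<phi>' n) \<xi> - rfourier f' \<xi>)))\<^sup>2) \<partial>\<mu>)"
      by (simp only:) (rule nn_integral_sq_norm_add_le; measurable)
    also have "(\<integral>\<^sup>+\<xi>. ennreal ((cmod (complex_of_real c * (rfourier (\<phi>' n) \<xi> - rfourier f' \<xi>)))\<^sup>2) \<partial>\<mu>) =
      (\<integral>\<^sup>+\<xi>. ennreal (c\<^sup>2) * ennreal ((cmod (rfourier (\<phi>' n) \<xi> - rfourier f' \<xi>))\<^sup>2) \<partial>\<mu>)"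
      by (simp add: norm_mult power_mult_distrib ennreal_mult')
    also have "\<dots> = ennreal (c\<^sup>2) * (\<integral>\<^sup>+\<xi>. ennreal ((cmod (rfourier (\<phi>' n) \<xi> - rfourier f' \<xi>))\<^sup>2) \<partial>\<mu>)"
      by (rule nn_integral_cmult) measurable
    finally show ?thesis .
  qed
  have "(\<lambda>n. 2 * (\<integral>\<^sup>+\<xi>. ennreal ((cmod (rfourier (\<phi> n) \<xi> - rfourier f \<xi>))\<^sup>2) \<partial>\<mu>)
     + 2 * (ennreal (c\<^sup>2) * (\<integral>\<^sup>+\<xi>. ennreal ((cmod (rfourier (\<phi>' n) \<xi> - rfourier f' \<xi>))\<^sup>2) \<partial>\<mu>))) \<longlonglongrightarrow> 2 * 0 + 2 * (ennreal (c\<^sup>2) * 0)"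
    by (intro tendsto_add ennreal_tendsto_cmult lim) auto
  then have L: "(\<lambda>n. \<integral>\<^sup>+\<xi>. ennreal ((cmod (rfourier (?\<phi> n) \<xi> - rfourier (\<lambda>x. f x + c * f' x) \<xi>))\<^sup>2) \<partial>\<mu>) \<longlonglongrightarrow> 0"
    by (intro tendsto_sandwich[OF _ always_eventually[OF allI[OF le]] tendsto_const]) auto
  have "?\<phi> n \<in> schwartz" for n by (rule schwartz_lin[OF \<phi>(1,3)])
  moreover have "(\<lambda>n. \<iota> (?\<phi> n)) \<longlonglongrightarrow> h + c *\<^sub>R h'"
    unfolding \<iota>_lin[OF \<phi>(1,3)] by (intro tendsto_intros \<phi>)
  moreover have "integrable lborel (\<lambda>x. f x + c * f' x)" using f by simp
  ultimately show ?thesis unfolding represents_def using L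
    by (intro conjI exI[of _ ?\<phi>] allI)
qed

text \<open>The squared norms of the approximants are at most their spectral integrals, which tend
  to zero. Together with linearity this gives uniqueness of representatives.\<close>

lemma represents_zero:
  assumes "represents \<mu> \<iota> (\<lambda>_. 0) h"
  shows "h = 0"
proof -
  obtain \<phi> where \<phi>: "\<And>n. \<phi> n \<in> schwartz" "(\<lambda>n. \<iota> (\<phi> n)) \<longlonglongrightarrow> h"
    and lim: "(\<lambda>n. \<integral>\<^sup>+\<xi>. ennreal ((cmod (rfourier (\<phi> n) \<xi>))\<^sup>2) \<partial>\<mu>) \<longlonglongrightarrow> 0"
    using assms by (auto simp: represents_def fourier_def)
  have "ennreal ((norm (\<iota> (\<phi> n)))\<^sup>2) \<le> (\<integral>\<^sup>+\<xi>. ennreal ((cmod (rfourier (\<phi> n) \<xi>))\<^sup>2) \<partial>\<mu>)" for n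
  proof (cases "integrable \<mu> (\<lambda>\<xi>. rfourier (\<phi> n) \<xi> * cnj (rfourier (\<phi> n) \<xi>))")
    case True
    have "ennreal (norm (complex_of_real (\<iota> (\<phi> n) \<bullet> \<iota> (\<phi> n)))) \<le> (\<integral>\<^sup>+\<xi>. ennreal (norm (rfourier (\<phi> n) \<xi> * cnj (rfourier (\<phi> n) \<xi>))) \<partial>\<mu>)"
      unfolding inner_\<iota>_\<mu>[OF \<phi>(1) \<phi>(1)] by (rule integral_norm_bound_ennreal[OF True])
    then show ?thesis by (simp add: norm_mult power2_eq_square dot_square_norm)
  next
    \<comment> \<open>The integral in the inner product formula then has the default value
      \<open>0\<close>, so the norm is zero and the bound is trivial.\<close>
    case False
    then have "complex_of_real (\<iota> (\<phi> n) \<bullet> \<iota> (\<phi> n)) = 0"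
      unfolding inner_\<iota>_\<mu>[OF \<phi>(1) \<phi>(1)] by (rule not_integrable_integral_eq)
    then show ?thesis by simp
  qed
  then have "(\<lambda>n. ennreal ((norm (\<iota> (\<phi> n)))\<^sup>2)) \<longlonglongrightarrow> 0"
    by (intro tendsto_sandwich[OF _ _ tendsto_const lim] always_eventually) auto
  moreover have "(\<lambda>n. ennreal ((norm (\<iota> (\<phi> n)))\<^sup>2)) \<longlonglongrightarrow> ennreal ((norm h)\<^sup>2)"
    by (intro tendsto_intros \<phi>)
  ultimately have "ennreal ((norm h)\<^sup>2) = 0" by (rule LIMSEQ_unique[rotated])
  then show ?thesis by simp
qed

text \<open>Not every \<open>f i\<close> need be representable; the \<open>h i\<close> only extend the partially defined linear
  map from coefficients to representatives.\<close>

lemma represents_combination: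
  fixes f :: "nat \<Rightarrow> real^'d \<Rightarrow> real"
  shows "\<exists>h. \<forall>c G. represents \<mu> \<iota> (\<lambda>y. \<Sum>i<N. c i * f i y) G \<longrightarrow> G = (\<Sum>i<N. c i *\<^sub>R h i)"
proof (induction N)
  case 0 then show ?case using represents_zero by auto
next
  case (Suc N)
  then obtain h where h: "\<And>c G. represents \<mu> \<iota> (\<lambda>y. \<Sum>i<N. c i * f i y) G \<Longrightarrow> G = (\<Sum>i<N. c i *\<^sub>R h i)" by blast
  show ?case
  \<comment> \<open>If some representable combination involves the last function, its representative
    determines the value of the extension there. Otherwise, by scaling, every representable
    combination has last coefficient \<open>0\<close>, and the value is free.\<close>
  proof (cases "\<exists>c G. c N = 1 \<and> represents \<mu> \<iota> (\<lambda>y. \<Sum>i<Suc N. c i * f i y) G")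
    case True
    then obtain b H where b: "b N = 1" "represents \<mu> \<iota> (\<lambda>y. \<Sum>i<Suc N. b i * f i y) H" by blast
    \<comment> \<open>Subtracting what \<open>h\<close> already accounts for makes \<open>k\<close>
      send the coefficients \<open>b\<close> to \<open>H\<close>. Any other combination differs from
      a multiple of \<open>b\<close> by one without the last function.\<close>
    define k where "k = h(N := H - (\<Sum>i<N. b i *\<^sub>R h i))"
    have "G = (\<Sum>i<Suc N. c i *\<^sub>R k i)" if G: "represents \<mu> \<iota> (\<lambda>y. \<Sum>i<Suc N. c i * f i y) G" for c G
    proof -
      have "represents \<mu> \<iota> (\<lambda>y. (\<Sum>i<Suc N. c i * f i y) + (- c N) * (\<Sum>i<Suc N. b i * f i y)) (G + (- c N) *\<^sub>R H)"
        by (rule represents_lin[OF G b(2)])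
      also have "(\<lambda>y. (\<Sum>i<Suc N. c i * f i y) + (- c N) * (\<Sum>i<Suc N. b i * f i y)) =
         (\<lambda>y. \<Sum>i<N. (c i - c N * b i) * f i y)"
        by (rule ext) (simp add: b(1) sum_distrib_left sum_subtractf sum_negf algebra_simps)
      finally have "G + (- c N) *\<^sub>R H = (\<Sum>i<N. (c i - c N * b i) *\<^sub>R h i)" by (rule h)
      then have "G = (\<Sum>i<N. (c i - c N * b i) *\<^sub>R h i) + c N *\<^sub>R H" by (simp add: algebra_simps)
      also have "\<dots> = (\<Sum>i<N. c i *\<^sub>R h i) + c N *\<^sub>R (H - (\<Sum>i<N. b i *\<^sub>R h i))"
        by (simp add: scaleR_left_diff_distrib scaleR_right_diff_distrib sum_subtractf scaleR_sum_right)
      also have "\<dots> = (\<Sum>i<Suc N. c i *\<^sub>R k i)" by (simp add: k_def)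
      finally show ?thesis .
    qed
    then show ?thesis by blast
  next
    case False
    have "G = (\<Sum>i<Suc N. c i *\<^sub>R (h(N := 0)) i)" if G: "represents \<mu> \<iota> (\<lambda>y. \<Sum>i<Suc N. c i * f i y) G" for c G
    proof (cases "c N = 0")
      case True
      then show ?thesis using h[of c G] G by simp
    next
      case cN: False
      \<comment> \<open>Scaling by \<open>1 / c N\<close>, written as a sum so that linearity of
        representatives applies.\<close>
      have "represents \<mu> \<iota> (\<lambda>y. (\<Sum>i<Suc N. c i * f i y) + (1 / c N - 1) * (\<Sum>i<Suc N. c i * f i y)) (G + (1 / c N - 1) *\<^sub>R G)"
        by (rule represents_lin[OF G G])
      also have "(\<lambda>y. (\<Sum>i<Suc N. c i * f i y) + (1 / c N - 1) * (\<Sum>i<Suc N. c i * f i y)) = (\<lambda>y. \<Sum>i<Suc N. (c i / c N) * f i y)"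
      proof
        fix y
        have "(\<Sum>i<Suc N. c i * f i y) + (1 / c N - 1) * (\<Sum>i<Suc N. c i * f i y) = (1 / c N) * (\<Sum>i<Suc N. c i * f i y)"
          by (simp only: left_diff_distrib)
        then show "(\<Sum>i<Suc N. c i * f i y) + (1 / c N - 1) * (\<Sum>i<Suc N. c i * f i y) = (\<Sum>i<Suc N. (c i / c N) * f i y)"
          by (simp only: sum_distrib_left) (simp add: field_simps)
      qed
      finally have "c N / c N = 1 \<and> represents \<mu> \<iota> (\<lambda>y. \<Sum>i<Suc N. (c i / c N) * f i y) (G + (1 / c N - 1) *\<^sub>R G)"
        using cN by simp
      then have "\<exists>c G. c N = 1 \<and> represents \<mu> \<iota> (\<lambda>y. \<Sum>i<Suc N. c i * f i y) G"
        by (intro exI[of _ "\<lambda>i. c i / c N"] exI)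
      with False show ?thesis by blast
    qed
    then show ?thesis by blast
  qed
qed

end

section \<open>Stochastic integrals of elements of the completion\<close>

text \<open>The partial sum is the orthogonal projection onto the span of the vectors met so far,
  hence the best approximation there. Comparison with \<open>0\<close> gives the bound, comparison
  with a nearby element of the dense span the convergence.\<close>

lemma orthonormal_expansion:
  fixes e :: "nat \<Rightarrow> 'h::real_inner"
  assumes "complete_orthonormal K e"
  shows "norm (h - (\<Sum>k\<in>K \<inter> {..<n}. (h \<bullet> e k) *\<^sub>R e k)) \<le> norm h"
    and "(\<lambda>n. \<Sum>k\<in>K \<inter> {..<n}. (h \<bullet> e k) *\<^sub>R e k) \<longlonglongrightarrow> h"
proof -
  have on: "\<And>j k. j \<in> K \<Longrightarrow> k \<in> K \<Longrightarrow> e j \<bullet> e k = (if j = k then 1 else 0)" and dense: "closure (span (e ` K)) = UNIV"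
    using assms by (auto simp: complete_orthonormal_def)
  define S where "S n = (\<Sum>k\<in>K \<inter> {..<n}. (h \<bullet> e k) *\<^sub>R e k)" for n
  let ?V = "\<lambda>n. span (e ` (K \<inter> {..<n}))"
  have orth: "(h - S n) \<bullet> e j = 0" if "j \<in> K \<inter> {..<n}" for j n
  proof -
    have "S n \<bullet> e j = (\<Sum>k\<in>K \<inter> {..<n}. if k = j then h \<bullet> e j else 0)"
      unfolding S_def inner_sum_left using that by (intro sum.cong) (auto simp: on)
    also have "\<dots> = h \<bullet> e j" using that by simp
    finally show ?thesis by (simp add: inner_diff_left)
  qed
  have orthV: "(h - S n) \<bullet> v = 0" if "v \<in> ?V n" for v n
    using that
  proof (induction rule: span_induct)
    case base show ?case by (auto simp: subspace_def inner_add_right)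
  next
    case (step x) then show ?case using orth by auto
  qed
  have SV: "S n \<in> ?V n" for n
    unfolding S_def by (intro span_sum span_scale span_base) auto
  have best: "norm (h - S n) \<le> norm (h - v)" if v: "v \<in> ?V n" for v n
  proof -
    have "(h - S n) \<bullet> (S n - v) = 0" by (rule orthV) (intro span_diff SV v)
    then have "(norm ((h - S n) + (S n - v)))\<^sup>2 = (norm (h - S n))\<^sup>2 + (norm (S n - v))\<^sup>2"
      by (simp only: power2_norm_eq_inner inner_add_left inner_add_right inner_commute[of "S n - v" "h - S n"])
    then have "(norm (h - S n))\<^sup>2 \<le> (norm (h - v))\<^sup>2" by simp
    then show ?thesis by (rule power2_le_imp_le) simp
  qed
  show "norm (h - (\<Sum>k\<in>K \<inter> {..<n}. (h \<bullet> e k) *\<^sub>R e k)) \<le> norm h"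
    using best[of 0 n] by (simp add: span_zero S_def)
  have "S \<longlonglongrightarrow> h"
  proof (rule LIMSEQ_I)
    fix r :: real assume "0 < r"
    moreover have "h \<in> closure (span (e ` K))" using dense by simp
    ultimately obtain v where v: "v \<in> span (e ` K)" "dist v h < r" unfolding closure_approachable by blast
    obtain t c where t: "finite t" "t \<subseteq> e ` K" "v = (\<Sum>a\<in>t. c a *\<^sub>R a)" using v(1) unfolding span_explicit by blast
    obtain C where C: "C \<subseteq> K" "finite C" "t = e ` C" using finite_subset_image[OF t(1,2)] by blast
    obtain n0 where n0: "C \<subseteq> {..<n0}" using finite_nat_set_iff_bounded[THEN iffD1, OF C(2)] by auto
    have "norm (S n - h) < r" if "n \<ge> n0" for n
    proof -
      have "C \<subseteq> K \<inter> {..<n}" using C(1) n0 that by auto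
      then have "a \<in> ?V n" if "a \<in> e ` C" for a using that by (intro span_base) blast
      then have "v \<in> ?V n" unfolding t(3) C(3) by (intro span_sum span_scale)
      from best[OF this] v(2) show ?thesis by (simp add: dist_norm norm_minus_commute)
    qed
    then show "\<exists>n0. \<forall>n\<ge>n0. norm (S n - h) < r" by blast
  qed
  then show "(\<lambda>n. \<Sum>k\<in>K \<inter> {..<n}. (h \<bullet> e k) *\<^sub>R e k) \<longlonglongrightarrow> h" by (simp add: S_def[abs_def])
qed

text \<open>Pointwise convergence of the expansions suffices, because the projection errors are
  dominated by \<open>norm (\<Phi> p)\<close>.\<close>

lemma L2_tendsto_expansion:
  fixes \<Phi> :: "'a \<Rightarrow> 'h::{real_inner,banach,second_countable_topology}"
  assumes e: "complete_orthonormal K e" and \<Phi>: "\<Phi> \<in> L2 N"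
  shows "L2_tendsto N (\<lambda>n p. \<Sum>k\<in>K \<inter> {..<n}. (\<Phi> p \<bullet> e k) *\<^sub>R e k) \<Phi>"
proof -
  note [measurable] = L2_measurable[OF \<Phi>]
  let ?S = "\<lambda>n p. \<Sum>k\<in>K \<inter> {..<n}. (\<Phi> p \<bullet> e k) *\<^sub>R e k"
  have d: "(\<lambda>p. \<Phi> p - ?S n p) \<in> L2 N" for n
    by (rule L2_bound[OF \<Phi>]) (auto intro!: orthonormal_expansion(1)[OF e])
  have "?S n \<in> L2 N" for n using L2_diff[OF \<Phi> d[of n]] by simp
  moreover have "(\<lambda>n. \<integral>p. (norm (?S n p - \<Phi> p))\<^sup>2 \<partial>N) \<longlonglongrightarrow> (\<integral>p. 0 \<partial>N)"
  proof (rule integral_dominated_convergence)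
    show "integrable N (\<lambda>p. (norm (\<Phi> p))\<^sup>2)" by (rule L2_integrable[OF \<Phi>])
    have "(\<lambda>n. (norm (?S n p - \<Phi> p))\<^sup>2) \<longlonglongrightarrow> (norm (\<Phi> p - \<Phi> p))\<^sup>2" for p
      by (intro tendsto_intros orthonormal_expansion(2)[OF e])
    then show "AE p in N. (\<lambda>n. (norm (?S n p - \<Phi> p))\<^sup>2) \<longlonglongrightarrow> 0" by simp
    show "AE p in N. norm ((norm (?S n p - \<Phi> p))\<^sup>2) \<le> (norm (\<Phi> p))\<^sup>2" for n
      using orthonormal_expansion(1)[OF e] by (auto intro!: power_mono simp: norm_minus_commute)
  qed measurable
  ultimately show ?thesis using \<Phi> by (simp add: L2_tendsto_iff)
qed

section \<open>Integrals against the coordinate Brownian motions, stopped at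
  \<open>t\<close>\<close>

context noise_filtration begin

lemma noise_path_diff:
  fixes h :: 'b
  assumes "0 \<le> a" "a < b" "0 \<le> t"
  shows "AE \<omega> in M. F (\<lambda>s. indicat_real ({a<..b} \<inter> {..t}) s *\<^sub>R h) \<omega> =
    noise_path F h (min b t) \<omega> - noise_path F h (min a t) \<omega>"
proof -
  \<comment> \<open>Both closed intervals start at \<open>0\<close>, so their difference is the
    half-open interval between the stopped end points; for \<open>t \<le> a\<close> they coincide
    and both sides are zero.\<close>
  have eq: "(\<lambda>s. indicat_real ({a<..b} \<inter> {..t}) s *\<^sub>R h) =
      (\<lambda>s. indicat_real {0..min b t} s *\<^sub>R h + (-1) *\<^sub>R (indicat_real {0..min a t} s *\<^sub>R h))"
    using assms by (auto simp: fun_eq_iff indicator_def)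
  show ?thesis
    unfolding eq noise_path_def
    using F_lin[OF indicator_L2[of "{0..min b t}" h] indicator_L2[of "{0..min a t}" h], of "-1"] by simp
qed

text \<open>Stopping the path at \<open>t\<close> amounts to cutting the integrand off after
  \<open>t\<close>. In that form the elementary integral is, up to null sets, a sum of generating
  products.\<close>

lemma ito_elementary:
  assumes "elementary_ito \<FF> T (noise_path F h0) t h Y" and t: "0 \<le> t"
  shows "ito (\<lambda>(\<omega>, s). (indicat_real {..t} s * h (\<omega>, s)) *\<^sub>R h0) Y"
proof -
  obtain N :: nat and a b X where ab: "\<And>i. i < N \<Longrightarrow> 0 \<le> a i \<and> a i < b i \<and> b i \<le> T"
    and X: "\<And>i. i < N \<Longrightarrow> bounded_rv (\<FF> (a i)) (X i)"
    and h: "h = (\<lambda>(\<omega>, s). \<Sum>i<N. indicator {a i<..b i} s * X i \<omega>)"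
    and Y: "Y = (\<lambda>\<omega>. \<Sum>i<N. X i \<omega> * (noise_path F h0 (min (b i) t) \<omega> - noise_path F h0 (min (a i) t) \<omega>))"
    using assms(1) unfolding elementary_ito_def by blast
  let ?\<psi> = "\<lambda>i s. indicat_real ({a i<..b i} \<inter> {..t}) s *\<^sub>R h0"
  have \<psi>: "?\<psi> i \<in> L2 (time T)" for i by (rule indicator_L2) simp
  have "ito (\<lambda>p. \<Sum>i<N. (case p of (\<omega>, s) \<Rightarrow> X i \<omega> *\<^sub>R ?\<psi> i s)) (\<lambda>\<omega>. \<Sum>i<N. X i \<omega> * F (?\<psi> i) \<omega>)"
  proof (rule ito_sum)
    fix i assume "i \<in> {..<N}"
    then show "ito (\<lambda>(\<omega>, s). X i \<omega> *\<^sub>R ?\<psi> i s) (\<lambda>\<omega>. X i \<omega> * F (?\<psi> i) \<omega>)"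
      by (intro ito.base[OF X \<psi>]) (simp_all add: indicator_def)
  qed simp
  moreover have "(\<lambda>p. \<Sum>i<N. (case p of (\<omega>, s) \<Rightarrow> X i \<omega> *\<^sub>R ?\<psi> i s)) = (\<lambda>(\<omega>, s). (indicat_real {..t} s * h (\<omega>, s)) *\<^sub>R h0)"
  proof
    fix p
    show "(\<Sum>i<N. (case p of (\<omega>, s) \<Rightarrow> X i \<omega> *\<^sub>R ?\<psi> i s)) = (case p of (\<omega>, s) \<Rightarrow> (indicat_real {..t} s * h (\<omega>, s)) *\<^sub>R h0)"
      unfolding h split_beta' fst_conv snd_conv sum_distrib_left scaleR_sum_left indicator_inter_arith
      by (intro sum.cong refl) (simp only: scaleR_scaleR ac_simps)
  qed
  ultimately have i: "ito (\<lambda>(\<omega>, s). (indicat_real {..t} s * h (\<omega>, s)) *\<^sub>R h0) (\<lambda>\<omega>. \<Sum>i<N. X i \<omega> * F (?\<psi> i) \<omega>)"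
    by (simp only:)
  have np: "noise_path F h0 r \<in> borel_measurable M" for r
    unfolding noise_path_def by (rule F_measurable[OF indicator_L2]) simp
  show ?thesis
  proof (rule ito_AE_cong[OF i])
    show "(\<lambda>(\<omega>, s). (indicat_real {..t} s * h (\<omega>, s)) *\<^sub>R h0) \<in> borel_measurable M\<^sub>T"
      using ito_L2[OF i] L2_measurable by blast
    have "X i \<in> borel_measurable M" if "i < N" for i using bounded_rv_M[OF X[OF that]] by (simp add: bounded_rv_def)
    then show "Y \<in> borel_measurable M" unfolding Y using np
      by (intro borel_measurable_sum borel_measurable_times borel_measurable_diff) auto
    have "AE \<omega> in M. i < N \<longrightarrow> F (?\<psi> i) \<omega> = noise_path F h0 (min (b i) t) \<omega> - noise_path F h0 (min (a i) t) \<omega>" for i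
    proof (cases "i < N")
      case True
      with noise_path_diff[of "a i" "b i" t h0] ab[OF True] t show ?thesis by simp
    qed simp
    then have "AE \<omega> in M. \<forall>i. i < N \<longrightarrow> F (?\<psi> i) \<omega> = noise_path F h0 (min (b i) t) \<omega> - noise_path F h0 (min (a i) t) \<omega>"
      by (simp add: AE_all_countable)
    then show "AE \<omega> in M. (\<Sum>i<N. X i \<omega> * F (?\<psi> i) \<omega>) = Y \<omega>"
      unfolding Y by eventually_elim (auto intro!: sum.cong)
  qed simp
qed

lemma L2_tendsto_coefficient:
  assumes hs: "L2_tendsto M\<^sub>T hs h" and e: "norm (e0 :: 'b) = 1"
  shows "L2_tendsto M\<^sub>T (\<lambda>n (\<omega>, s). (indicat_real {..t} s * hs n (\<omega>, s)) *\<^sub>R e0)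
    (\<lambda>(\<omega>, s). (indicat_real {..t} s * h (\<omega>, s)) *\<^sub>R e0)"
proof -
  have [measurable]: "hs n \<in> borel_measurable M\<^sub>T" "h \<in> borel_measurable M\<^sub>T" for n
    using hs by (auto simp: L2_tendsto_def L2_def)
  have [measurable]: "indicat_real {..t} \<in> borel_measurable (time T)"
    by (rule measurable_restrict_space1) measurable
  show ?thesis
    unfolding split_beta' prod.collapse
  proof (rule L2_tendsto_sandwich[OF hs])
    show "AE p in M\<^sub>T. norm ((indicat_real {..t} (snd p) * hs n p) *\<^sub>R e0) \<le> norm (hs n p)" for n
      by (simp add: e indicator_def)
    show "AE p in M\<^sub>T. norm ((indicat_real {..t} (snd p) * hs n p) *\<^sub>R e0 - (indicat_real {..t} (snd p) * h p) *\<^sub>R e0)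
        \<le> norm (hs n p - h p)" for n
      unfolding scaleR_left_diff_distrib[symmetric] right_diff_distrib[symmetric]
      by (simp add: e indicator_def)
  qed measurable
qed

text \<open>An integrand of \<open>has_ito_integral\<close> may live beyond \<open>t\<close>
  although its integral stops there, whereas \<open>ito\<close> accounts for all times; the cutoff
  reconciles the two.\<close>

lemma ito_of_has_ito_integral:
  assumes "has_ito_integral M \<FF> T (noise_path F e0) t g I" "norm e0 = 1" "0 \<le> t"
  shows "ito (\<lambda>(\<omega>, s). (indicat_real {..t} s * g (\<omega>, s)) *\<^sub>R e0) I"
proof -
  obtain hs Ys where h: "\<And>n. elementary_ito \<FF> T (noise_path F e0) t (hs n) (Ys n)"
    and lim: "L2_tendsto M\<^sub>T hs g" "L2_tendsto M Ys I"
    using assms(1) by (auto simp: has_ito_integral_def)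
  show ?thesis
    by (rule ito.lim[OF ito_elementary[OF h assms(3)] L2_tendsto_coefficient[OF lim(1) assms(2)] lim(2)])
qed

lemma has_ito_integral_exists:
  assumes h: "\<And>n. elementary_ito \<FF> T (noise_path F e0) t (hs n) (Ys n)"
    and lim: "L2_tendsto M\<^sub>T hs g" and "norm e0 = 1" "0 \<le> t"
  shows "\<exists>I. has_ito_integral M \<FF> T (noise_path F e0) t g I"
  using ito_lim_exists[OF ito_elementary[OF h assms(4)] L2_tendsto_coefficient[OF lim assms(3)]] h lim
  unfolding has_ito_integral_def by blast

text \<open>Vanishing of \<Phi> after \<open>t\<close> removes the cutoff, so that the components
  add up to projections of \<Phi> itself.\<close>

lemma ito_components:
  assumes \<Phi>: "\<Phi> \<in> L2 M\<^sub>T" and after: "AE p in M\<^sub>T. t < snd p \<longrightarrow> \<Phi> p = 0"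
    and e: "complete_orthonormal K e" and t: "0 \<le> t" and "finite J" "J \<subseteq> K"
    and I: "\<And>k. k \<in> K \<Longrightarrow> has_ito_integral M \<FF> T (noise_path F (e k)) t (\<lambda>p. \<Phi> p \<bullet> e k) (I k)"
  shows "ito (\<lambda>p. \<Sum>k\<in>J. (\<Phi> p \<bullet> e k) *\<^sub>R e k) (\<lambda>\<omega>. \<Sum>k\<in>J. I k \<omega>)"
proof (rule ito_sum[OF \<open>finite J\<close>])
  fix k assume "k \<in> J"
  then have k: "k \<in> K" using assms by auto
  have n: "norm (e k) = 1" using e k by (simp add: complete_orthonormal_def norm_eq_sqrt_inner)
  note [measurable] = L2_measurable[OF \<Phi>]
  note ik = ito_of_has_ito_integral[OF I[OF k] n t]
  show "ito (\<lambda>p. (\<Phi> p \<bullet> e k) *\<^sub>R e k) (I k)"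
  proof (rule ito_AE_cong[OF ik])
    show "AE p in M\<^sub>T. (case p of (\<omega>, s) \<Rightarrow> (indicat_real {..t} s * (\<Phi> (\<omega>, s) \<bullet> e k)) *\<^sub>R e k) = (\<Phi> p \<bullet> e k) *\<^sub>R e k"
      using after by eventually_elim (auto simp: indicator_def split_beta')
    show "I k \<in> borel_measurable M" using ito_L2[OF ik] L2_measurable by blast
  qed auto
qed

lemma ito_of_has_stoch_integral:
  assumes \<Phi>: "\<Phi> \<in> L2 M\<^sub>T" and after: "AE p in M\<^sub>T. t < snd p \<longrightarrow> \<Phi> p = 0"
    and e: "complete_orthonormal K e" and t: "0 \<le> t"
    and Y: "has_stoch_integral M \<FF> T F K e \<Phi> t Y"
  shows "ito \<Phi> Y"
proof -
  obtain I where I: "\<And>k. k \<in> K \<Longrightarrow> has_ito_integral M \<FF> T (noise_path F (e k)) t (\<lambda>p. \<Phi> p \<bullet> e k) (I k)"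
    and lim: "L2_tendsto M (\<lambda>n \<omega>. \<Sum>k\<in>K \<inter> {..<n}. I k \<omega>) Y"
    using Y by (auto simp: has_stoch_integral_def)
  show ?thesis
    by (rule ito.lim[OF ito_components[OF \<Phi> after e t _ _ I] L2_tendsto_expansion[OF e \<Phi>] lim]) auto
qed

text \<open>The component integrals can be chosen independently for each \<open>k\<close>: their
  partial sums converge because the matching integrands converge to \<Phi>.\<close>

lemma has_stoch_integral_exists:
  assumes \<Phi>: "\<Phi> \<in> L2 M\<^sub>T" and after: "AE p in M\<^sub>T. t < snd p \<longrightarrow> \<Phi> p = 0"
    and e: "complete_orthonormal K e" and t: "0 \<le> t"
    and ex: "\<And>k. k \<in> K \<Longrightarrow> \<exists>I. has_ito_integral M \<FF> T (noise_path F (e k)) t (\<lambda>p. \<Phi> p \<bullet> e k) I"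
  shows "\<exists>Y. has_stoch_integral M \<FF> T F K e \<Phi> t Y"
proof -
  obtain I where I: "\<And>k. k \<in> K \<Longrightarrow> has_ito_integral M \<FF> T (noise_path F (e k)) t (\<lambda>p. \<Phi> p \<bullet> e k) (I k)"
    using ex by metis
  have "ito (\<lambda>p. \<Sum>k\<in>K \<inter> {..<n}. (\<Phi> p \<bullet> e k) *\<^sub>R e k) (\<lambda>\<omega>. \<Sum>k\<in>K \<inter> {..<n}. I k \<omega>)" for n
    by (rule ito_components[OF \<Phi> after e t _ _ I]) auto
  from ito_lim_exists[OF this L2_tendsto_expansion[OF e \<Phi>]] I show ?thesis
    unfolding has_stoch_integral_def by blast
qed

end

text \<open>The vectors \<open>h i\<close> do not depend on \<open>p\<close>: at almost every
  \<open>p\<close> the process is a combination of the fixed functions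
  \<open>indicator (A i)\<close>, only its coefficients vary, and one linear extension serves all
  coefficients at once.\<close>

lemma simple_process_representative:
  fixes \<Gamma> \<mu> :: "(real^'d::finite) measure"
    and \<iota> :: "(real^'d \<Rightarrow> real) \<Rightarrow> 'h::{real_inner,banach,second_countable_topology}"
  assumes "spectral_covariance \<Gamma> \<mu>" "is_completion \<Gamma> \<mu> \<iota>"
    and "simple_process \<FF> T g" "represents_process M T \<mu> \<iota> g G"
  shows "\<exists>(N::nat) a b X h. (\<forall>i<N. 0 \<le> a i \<and> a i < b i \<and> b i \<le> T \<and> bounded_rv (\<FF> (a i)) (X i)) \<and>
     (AE p in M \<Otimes>\<^sub>M time T. G p = (\<Sum>i<N. (indicat_real {a i<..b i} (snd p) * X i (fst p)) *\<^sub>R h i))"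
proof -
  obtain N :: nat and a b A X where c: "\<forall>i<N. 0 \<le> a i \<and> a i < b i \<and> b i \<le> T \<and> A i \<in> sets borel \<and> bounded (A i) \<and>
            bounded_rv (\<FF> (a i)) (X i)"
    and g: "g = (\<lambda>s y \<omega>. \<Sum>i<N. indicator {a i<..b i} s * indicator (A i) y * X i \<omega>)"
    using assms(3) unfolding simple_process_def by blast
  obtain h where h: "\<And>c G. represents \<mu> \<iota> (\<lambda>y. \<Sum>i<N. c i * indicator (A i) y) G \<Longrightarrow> G = (\<Sum>i<N. c i *\<^sub>R h i)"
    using represents_combination[OF assms(1,2), where N = N and f = "\<lambda>i. indicator (A i)"] by blast
  have "AE p in M \<Otimes>\<^sub>M time T. represents \<mu> \<iota> (\<lambda>y. g (snd p) y (fst p)) (G p)"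
    using assms(4) by (simp add: represents_process_def split_beta')
  then have "AE p in M \<Otimes>\<^sub>M time T. G p = (\<Sum>i<N. (indicat_real {a i<..b i} (snd p) * X i (fst p)) *\<^sub>R h i)"
  proof eventually_elim
    case (elim p)
    then show ?case by (intro h) (simp add: g ac_simps)
  qed
  with c show ?thesis by blast
qed

lemma (in noise_filtration) P0_has_ito_integral:
  fixes \<Gamma> \<mu> :: "(real^'d::finite) measure" and \<iota> :: "(real^'d \<Rightarrow> real) \<Rightarrow> 'b"
  assumes cov: "spectral_covariance \<Gamma> \<mu>" and compl: "is_completion \<Gamma> \<mu> \<iota>"
    and \<Phi>: "\<Phi> \<in> P0 M \<FF> T \<mu> \<iota>" and e: "norm e0 = 1" and t: "0 \<le> t"
  shows "\<exists>I. has_ito_integral M \<FF> T (noise_path F e0) t (\<lambda>p. \<Phi> p \<bullet> e0) I"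
proof -
  obtain g Gs where g: "\<And>n. simple_process \<FF> T (g n)" "\<And>n. represents_process M T \<mu> \<iota> (g n) (Gs n)"
    and lim: "L2_tendsto M\<^sub>T Gs \<Phi>"
    using \<Phi> by (auto simp: P0_def)
  have "\<exists>h Y. elementary_ito \<FF> T (noise_path F e0) t h Y \<and> h \<in> borel_measurable M\<^sub>T \<and>
      (AE p in M\<^sub>T. h p = Gs n p \<bullet> e0)" for n
  proof -
    obtain N :: nat and a b X k where c: "\<forall>i<N. 0 \<le> a i \<and> a i < b i \<and> b i \<le> T \<and> bounded_rv (\<FF> (a i)) (X i)"
      and G: "AE p in M\<^sub>T. Gs n p = (\<Sum>i<N. (indicat_real {a i<..b i} (snd p) * X i (fst p)) *\<^sub>R k i)"
      using simple_process_representative[OF cov compl g(1)[of n] g(2)[of n]] by blast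
    \<comment> \<open>The inner products with \<open>e0\<close> are deterministic, so they can be
      absorbed into the bounded variables; what remains is a real step process on the same time
      intervals.\<close>
    let ?X = "\<lambda>i \<omega>. X i \<omega> * (k i \<bullet> e0)"
    let ?h = "\<lambda>(\<omega>, s). \<Sum>i<N. indicator {a i<..b i} s * ?X i \<omega>"
    let ?Y = "\<lambda>\<omega>. \<Sum>i<N. ?X i \<omega> * (noise_path F e0 (min (b i) t) \<omega> - noise_path F e0 (min (a i) t) \<omega>)"
    have bX: "bounded_rv (\<FF> (a i)) (?X i)" if "i < N" for i
      using c that by (intro bounded_rv_mult) (auto simp: bounded_rv_def)
    have [measurable]: "X i \<in> borel_measurable M" if "i < N" for i
      using c that bounded_rv_M[of "a i" "X i"] by (auto simp: bounded_rv_def)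
    have [measurable]: "indicat_real {a i<..b i} \<in> borel_measurable (time T)" for i
      by (rule measurable_restrict_space1) measurable
    have "elementary_ito \<FF> T (noise_path F e0) t ?h ?Y"
      unfolding elementary_ito_def using c bX
      by (intro exI[of _ N] exI[of _ a] exI[of _ b] exI[of _ ?X] conjI refl) auto
    moreover have "?h \<in> borel_measurable M\<^sub>T" unfolding split_beta' by measurable
    moreover have "AE p in M\<^sub>T. ?h p = Gs n p \<bullet> e0"
      using G by eventually_elim (simp add: inner_sum_left split_beta' mult.assoc)
    ultimately show ?thesis by blast
  qed
  from choice[OF allI[OF this]] obtain hs where
    "\<forall>n. \<exists>Y. elementary_ito \<FF> T (noise_path F e0) t (hs n) Y \<and> hs n \<in> borel_measurable M\<^sub>T \<and>
      (AE p in M\<^sub>T. hs n p = Gs n p \<bullet> e0)" ..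
  from choice[OF this] obtain Ys where *:
    "\<forall>n. elementary_ito \<FF> T (noise_path F e0) t (hs n) (Ys n) \<and> hs n \<in> borel_measurable M\<^sub>T \<and>
      (AE p in M\<^sub>T. hs n p = Gs n p \<bullet> e0)" ..
  have h: "\<And>n. elementary_ito \<FF> T (noise_path F e0) t (hs n) (Ys n)"
    and hm: "\<And>n. hs n \<in> borel_measurable M\<^sub>T"
    and hG: "\<And>n. AE p in M\<^sub>T. hs n p = Gs n p \<bullet> e0" using * by blast+
  have \<Phi>m [measurable]: "\<Phi> \<in> borel_measurable M\<^sub>T" using lim by (auto simp: L2_tendsto_def L2_def)
  have le: "norm (v \<bullet> e0) \<le> norm v" for v using Cauchy_Schwarz_ineq2[of v e0] e by simp
  have "L2_tendsto M\<^sub>T hs (\<lambda>p. \<Phi> p \<bullet> e0)"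
  proof (rule L2_tendsto_sandwich[OF lim hm])
    show "AE p in M\<^sub>T. norm (hs n p) \<le> norm (Gs n p)" for n
      using hG[of n] by eventually_elim (simp only: le)
    show "AE p in M\<^sub>T. norm (hs n p - \<Phi> p \<bullet> e0) \<le> norm (Gs n p - \<Phi> p)" for n
      using hG[of n] by eventually_elim (simp only: inner_diff_left[symmetric] le)
  qed measurable
  from has_ito_integral_exists[OF h this e t] show ?thesis .
qed

lemma P0_limit_vanishes:
  fixes \<Gamma> \<mu> :: "(real^'d::finite) measure"
    and \<iota> :: "(real^'d \<Rightarrow> real) \<Rightarrow> 'h::{real_inner,banach,second_countable_topology}"
  assumes cov: "spectral_covariance \<Gamma> \<mu>" and compl: "is_completion \<Gamma> \<mu> \<iota>"
    and \<Phi>: "P0_limit M \<FF> T \<mu> \<iota> (mollified_process \<Lambda> \<zeta> Z t x) \<Phi>"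
  shows "AE p in M \<Otimes>\<^sub>M time T. t < snd p \<longrightarrow> \<Phi> p = 0"
proof -
  obtain G where G: "\<And>n. n \<ge> 1 \<Longrightarrow> represents_process M T \<mu> \<iota> (mollified_process \<Lambda> \<zeta> Z t x n) (G n)"
    and lim: "L2_tendsto (M \<Otimes>\<^sub>M time T) G \<Phi>"
    using \<Phi> by (auto simp: P0_limit_def)
  have [measurable]: "G n \<in> borel_measurable (M \<Otimes>\<^sub>M time T)" "\<Phi> \<in> borel_measurable (M \<Otimes>\<^sub>M time T)" for n
    using lim by (auto simp: L2_tendsto_def L2_def)
  have [measurable]: "indicat_real {t<..} \<in> borel_measurable (time T)"
    by (rule measurable_restrict_space1) measurable
  let ?N = "\<lambda>p. ennreal ((norm (indicat_real {t<..} (snd p) *\<^sub>R \<Phi> p))\<^sup>2)"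
  \<comment> \<open>The index starts at \<open>1\<close> because \<open>P0_limit\<close> says
    nothing about what \<open>G 0\<close> represents. At times after \<open>t\<close> the mollified
    process is zero, and zero has only the zero representative.\<close>
  have G0: "AE p in M \<Otimes>\<^sub>M time T. t < snd p \<longrightarrow> G n p = 0" if "n \<ge> 1" for n
  proof -
    have "AE p in M \<Otimes>\<^sub>M time T. represents \<mu> \<iota> (\<lambda>y. mollified_process \<Lambda> \<zeta> Z t x n (snd p) y (fst p)) (G n p)"
      using G[OF that] by (simp add: represents_process_def split_beta')
    then show ?thesis
    proof eventually_elim
      case (elim p)
      show ?case
      proof
        assume "t < snd p"
        then have "represents \<mu> \<iota> (\<lambda>_. 0) (G n p)" using elim by (simp add: mollified_process_def)
        then show "G n p = 0" by (rule represents_zero[OF cov compl])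
      qed
    qed
  qed
  \<comment> \<open>After \<open>t\<close> the difference \<open>G n p - \<Phi> p\<close> is just
    \<open>- \<Phi> p\<close>, so the mass of \<Phi> there lies below a null sequence.\<close>
  have "(\<integral>\<^sup>+p. ?N p \<partial>(M \<Otimes>\<^sub>M time T)) \<le> (\<integral>\<^sup>+p. ennreal ((norm (G n p - \<Phi> p))\<^sup>2) \<partial>(M \<Otimes>\<^sub>M time T))" if "n \<ge> 1" for n
    using G0[OF that] by (intro nn_integral_mono_AE) (auto elim!: eventually_mono simp: indicator_def)
  moreover have "(\<lambda>n. \<integral>\<^sup>+p. ennreal ((norm (G n p - \<Phi> p))\<^sup>2) \<partial>(M \<Otimes>\<^sub>M time T)) \<longlonglongrightarrow> 0"
    using lim by (simp add: L2_tendsto_def)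
  ultimately have "(\<integral>\<^sup>+p. ?N p \<partial>(M \<Otimes>\<^sub>M time T)) \<le> 0"
    by (intro LIMSEQ_le_const[of _ 0]) auto
  then have "(\<integral>\<^sup>+p. ?N p \<partial>(M \<Otimes>\<^sub>M time T)) = 0" by simp
  then have "AE p in M \<Otimes>\<^sub>M time T. ?N p = 0" by (subst (asm) nn_integral_0_iff_AE) auto
  then show ?thesis by eventually_elim (auto simp: indicator_def)
qed

lemma (in gaussian_noise) noise_filtration_natural_filtration:
  fixes \<mu> :: "(real^'d::finite) measure" and \<iota> :: "(real^'d \<Rightarrow> real) \<Rightarrow> 'h"
  shows "noise_filtration M T F (natural_filtration M \<mu> \<iota> F)"
proof -
  define gen where "gen c = {martingale_measure \<mu> \<iota> F s A -` B \<inter> space M | s A B.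
         0 \<le> s \<and> s \<le> c \<and> A \<in> sets borel \<and> bounded A \<and> B \<in> sets borel} \<union> null_sets M" for c
  have gen: "gen c \<subseteq> Pow (space M)" for c
    unfolding gen_def by (auto dest: null_setsD2 sets.sets_into_space)
  have sp: "space (natural_filtration M \<mu> \<iota> F c) = space M" for c
    unfolding natural_filtration_def gen_def[symmetric] by (rule space_measure_of[OF gen])
  have st: "sets (natural_filtration M \<mu> \<iota> F c) = sigma_sets (space M) (gen c)" for c
    unfolding natural_filtration_def gen_def[symmetric] by (rule sets_measure_of[OF gen])
  show ?thesis
  proof (intro noise_filtration.intro noise_filtration_axioms.intro)
    show "gaussian_noise M T F" by unfold_locales
    show "space (natural_filtration M \<mu> \<iota> F c) = space M" for c by (rule sp)
    show "sets (natural_filtration M \<mu> \<iota> F c) \<subseteq> sets (natural_filtration M \<mu> \<iota> F c')" if "c \<le> c'" for c c'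
      unfolding st gen_def using that by (intro sigma_sets_mono') (auto, metis order_trans)
    fix \<psi> :: "real \<Rightarrow> 'h" and c assume \<psi>: "\<psi> \<in> L2 (time T)" "\<And>s. s \<le> c \<Longrightarrow> \<psi> s = 0"
    show "sets (natural_filtration M \<mu> \<iota> F c) \<subseteq> sets (orth_sigma \<psi>)"
      unfolding st sets_orth_sigma generated_sets_def
    proof (rule sigma_sets_mono)
      show "gen c \<subseteq> sigma_sets (space M) ({V -` B \<inter> space M | V B. V \<in> orth \<psi> \<and> B \<in> sets borel} \<union> null_sets M)"
      proof
        fix E assume "E \<in> gen c"
        then consider "E \<in> null_sets M"
          | s A B where "E = martingale_measure \<mu> \<iota> F s A -` B \<inter> space M" "s \<le> c" "B \<in> sets borel"
          unfolding gen_def by blast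
        then show "E \<in> sigma_sets (space M) ({V -` B \<inter> space M | V B. V \<in> orth \<psi> \<and> B \<in> sets borel} \<union> null_sets M)"
        proof cases
          case 1 then show ?thesis by (intro sigma_sets.Basic UnI2)
        next
          case 2
          \<comment> \<open>Whatever element \<open>H_of\<close> yields, possibly the unspecified
            one of an unrepresentable indicator, its kernel lives on \<open>{0..s}\<close> with
            \<open>s \<le> c\<close>, where \<psi> is zero; so the two are orthogonal
            pointwise.\<close>
          define h where "h = H_of \<mu> \<iota> (indicator A)"
          have L: "(\<lambda>r. indicat_real {0..s} r *\<^sub>R h) \<in> L2 (time T)" by (rule indicator_L2) simp
          have "(\<lambda>r. (indicat_real {0..s} r *\<^sub>R h) \<bullet> \<psi> r) = (\<lambda>_. 0)"
            using \<psi>(2) 2(2) by (auto simp: fun_eq_iff indicator_def)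
          then have "ip (\<lambda>r. indicat_real {0..s} r *\<^sub>R h) \<psi> = 0" by simp
          with L have "martingale_measure \<mu> \<iota> F s A \<in> orth \<psi>"
            unfolding orth_def martingale_measure_def noise_path_def h_def by blast
          with 2 show ?thesis by (intro sigma_sets.Basic UnI1) blast
        qed
      qed
    qed
  qed
qed

theorem proposition4p4:
  fixes M :: "'w measure"
    and T t :: real
    and x :: "real^'d::finite"
    and \<Gamma> \<mu> :: "(real^'d) measure"
    and \<iota> :: "(real^'d \<Rightarrow> real) \<Rightarrow> 'h::{real_inner,banach,second_countable_topology}"
    and F :: "(real \<Rightarrow> 'h) \<Rightarrow> 'w \<Rightarrow> real"
    and \<FF> :: "real \<Rightarrow> 'w measure"
    and K :: "nat set"
    and e :: "nat \<Rightarrow> 'h"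
    and \<zeta> :: "real^'d \<Rightarrow> real"
    and \<Lambda> :: "real \<Rightarrow> (real^'d \<Rightarrow> real) \<Rightarrow> real"
    and Z :: "real \<Rightarrow> real^'d \<Rightarrow> 'w \<Rightarrow> real"
    and \<Phi> :: "'w \<times> real \<Rightarrow> 'h"
  assumes T: "0 < T"
    and covariance: "spectral_covariance \<Gamma> \<mu>"
    and completion: "is_completion \<Gamma> \<mu> \<iota>"
    and prob: "prob_space M"
    and isonormal: "isonormal M T F"
    and canonical: "generated_by M T F"
    and filtration: "\<FF> = natural_filtration M \<mu> \<iota> F"
    and basis: "complete_orthonormal K e"
    and bump: "\<zeta> \<in> unit_bumps"
    and \<Lambda>_dist: "\<forall>s\<in>{0..T}. \<Lambda> s \<in> rapid_decrease"
    and \<Lambda>_meas: "(\<lambda>(s, \<xi>). fourier_dist (\<Lambda> s) \<xi>)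
        \<in> borel_measurable (restrict_space borel {0..T} \<Otimes>\<^sub>M borel)"
    and \<Lambda>_int: "(\<integral>\<^sup>+s. (SUP \<eta>. \<integral>\<^sup>+\<xi>. ennreal ((cmod (fourier_dist (\<Lambda> s) (\<xi> + \<eta>)))\<^sup>2) \<partial>\<mu>)
        \<partial>time T) < \<infinity>"
    and \<Lambda>_cond:
      "(\<forall>\<phi>\<in>unit_bumps. \<forall>a b. 0 \<le> a \<and> a \<le> b \<and> b \<le> T \<longrightarrow>
          (\<forall>y. set_integrable lborel {a..b} (\<lambda>s. dist_conv (\<Lambda> s) \<phi> y)) \<and>
          (\<lambda>y. LINT s:{a..b}|lborel. dist_conv (\<Lambda> s) \<phi> y) \<in> schwartz \<and>
          (\<integral>\<^sup>+y. (\<integral>\<^sup>+s\<in>{a..b}. ennreal \<bar>dist_conv (\<Lambda> s) \<phi> y\<bar> \<partial>lborel) \<partial>lborel) < \<infinity>)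
       \<or> ((\<lambda>h. \<integral>\<^sup>+s. (SUP \<eta>. \<integral>\<^sup>+\<xi>.
              (SUP r\<in>{s<..<s + h} \<inter> {0..T}.
                ennreal ((cmod (fourier_dist (\<Lambda> r) (\<xi> + \<eta>) - fourier_dist (\<Lambda> s) (\<xi> + \<eta>)))\<^sup>2))
              \<partial>\<mu>) \<partial>time T) \<longlongrightarrow> 0) (at_right 0)"
    and Z_pred: "predictable M \<FF> T Z"
    and Z_bdd: "(SUP s\<in>{0..T}. SUP y. \<integral>\<^sup>+\<omega>. ennreal ((Z s y \<omega>)\<^sup>2) \<partial>M) < \<infinity>"
    and Z_cov: "\<forall>s\<in>{0..T}. \<forall>y z.
        (\<integral>\<omega>. Z s y \<omega> * Z s (y + z) \<omega> \<partial>M) = (\<integral>\<omega>. Z s 0 \<omega> * Z s z \<omega> \<partial>M)"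
    and t: "t \<in> {0..T}"
    and \<Phi>: "P0_limit M \<FF> T \<mu> \<iota> (mollified_process \<Lambda> \<zeta> Z t x) \<Phi>"
  shows "\<Phi> \<in> divergence_domain M T F \<and>
    (\<exists>Y. has_stoch_integral M \<FF> T F K e \<Phi> t Y) \<and>
    (AE \<omega> in M. divergence M T F \<Phi> \<omega> = stoch_integral M \<FF> T F K e \<Phi> t \<omega>)"
proof -
  interpret gaussian_noise M T F
    by (intro gaussian_noise.intro gaussian_noise_axioms.intro prob isonormal)
  interpret noise_filtration M T F \<FF>
    unfolding filtration by (rule noise_filtration_natural_filtration)
  have t0: "0 \<le> t" using t by simp
  have P0: "\<Phi> \<in> P0 M \<FF> T \<mu> \<iota>" and L: "\<Phi> \<in> L2 (M \<Otimes>\<^sub>M time T)"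
    using \<Phi> by (auto simp: P0_limit_def L2_tendsto_def)
  note after = P0_limit_vanishes[OF covariance completion \<Phi>]
  have "\<exists>I. has_ito_integral M \<FF> T (noise_path F (e k)) t (\<lambda>p. \<Phi> p \<bullet> e k) I" if "k \<in> K" for k
    using basis that
    by (intro P0_has_ito_integral[OF covariance completion P0 _ t0])
       (simp add: complete_orthonormal_def norm_eq_sqrt_inner)
  from has_stoch_integral_exists[OF L after basis t0 this]
  obtain Y where Y: "has_stoch_integral M \<FF> T F K e \<Phi> t Y" by blast
  \<comment> \<open>Both integrals in the claim are arbitrary choices, so existence has to come
    first. The chosen stochastic integral is a divergence of \<Phi>, which also shows that the
    chosen divergence is one; uniqueness then compares the two.\<close>
  then have "has_stoch_integral M \<FF> T F K e \<Phi> t (stoch_integral M \<FF> T F K e \<Phi> t)"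
    unfolding stoch_integral_def by (rule someI[of "has_stoch_integral M \<FF> T F K e \<Phi> t"])
  from ito_has_divergence[OF ito_of_has_stoch_integral[OF L after basis t0 this]]
  have S: "has_divergence M T F \<Phi> (stoch_integral M \<FF> T F K e \<Phi> t)" .
  then have D: "has_divergence M T F \<Phi> (divergence M T F \<Phi>)"
    unfolding divergence_def by (rule someI[of "has_divergence M T F \<Phi>"])
  show ?thesis
  proof (intro conjI)
    show "\<Phi> \<in> divergence_domain M T F" using S by (auto simp: divergence_domain_def)
    show "\<exists>Y. has_stoch_integral M \<FF> T F K e \<Phi> t Y" using Y by blast
    show "AE \<omega> in M. divergence M T F \<Phi> \<omega> = stoch_integral M \<FF> T F K e \<Phi> t \<omega>"
      by (rule has_divergence_unique[OF canonical D S])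
  qed
qed

end
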